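(* Let $Y\subset\mathbb{C}^n$ be an open set, and for each $y\in Y$ let $$w(y)=\sup\{\mathrm{Vol}\,E : E\in\mathbb{E}_0,\ E+y\subset Y\}\in(0,\infty].$$ If $Y$ is pseudoconvex, then $-\log w$ is plurisubharmonic on $Y$.
   Context: $\mathbb{E}_0$ denotes the set of hermitian ellipsoids in $\mathbb{C}^n$, i.e. the images of the open unit ball of $\mathbb{C}^n$ under invertible complex linear maps $\mathbb{C}^n\to\mathbb{C}^n$ (in particular they are centered at $0$). $\mathrm{Vol}$ is Lebesgue measure on $\mathbb{C}^n$, and $E+y$ is the translate of $E$ by $y$. Convention: $-\log\infty=-\infty$, and a plurisubharmonic function may be identically $-\infty$ (on connected components of its domain). *)

theory Defs
  imports "HOL-Analysis.Analysis"
begin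

subsection \<open>Subharmonic and plurisubharmonic functions\<close>

definition usc_on :: "'a::topological_space set \<Rightarrow> ('a \<Rightarrow> ereal) \<Rightarrow> bool" where
  "usc_on S u \<longleftrightarrow> (\<forall>c. openin (top_of_set S) {x \<in> S. u x < c})"

text \<open>
  The mean of \<open>u\<close> over the circle of centre \<open>a\<close> and radius \<open>r\<close>, computed as the integral of the
  positive part minus the integral of the negative part; \<^const>\<open>e2ennreal\<close> sends negative numbers
  to 0. A function with values in \<open>[-\<infinity>, \<infinity>)\<close> that is upper semicontinuous on the circle is bounded
  above there, so the first integral is finite and the mean is a well-defined element of
  \<open>[-\<infinity>, \<infinity>)\<close>.
\<close>

definition circle_mean :: "(complex \<Rightarrow> ereal) \<Rightarrow> complex \<Rightarrow> real \<Rightarrow> ereal" where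
  "circle_mean u a r =
     (enn2ereal (\<integral>\<^sup>+t\<in>{0..2*pi}. e2ennreal (u (a + rcis r t)) \<partial>lborel)
      - enn2ereal (\<integral>\<^sup>+t\<in>{0..2*pi}. e2ennreal (- u (a + rcis r t)) \<partial>lborel))
     / ereal (2 * pi)"

text \<open>\<open>u\<close> may be identically \<open>-\<infinity>\<close> on components of \<open>S\<close>.\<close>

definition subharmonic_on :: "complex set \<Rightarrow> (complex \<Rightarrow> ereal) \<Rightarrow> bool" where
  "subharmonic_on S u \<longleftrightarrow>
     usc_on S u \<and> (\<forall>z\<in>S. u z < \<infinity>) \<and>
     (\<forall>a r. 0 < r \<longrightarrow> cball a r \<subseteq> S \<longrightarrow> u a \<le> circle_mean u a r)"

definition plurisubharmonic_on :: "(complex^'n) set \<Rightarrow> (complex^'n \<Rightarrow> ereal) \<Rightarrow> bool" where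
  "plurisubharmonic_on Y u \<longleftrightarrow>
     usc_on Y u \<and> (\<forall>y\<in>Y. u y < \<infinity>) \<and>
     (\<forall>a b. subharmonic_on {z. a + z *s b \<in> Y} (\<lambda>z. u (a + z *s b)))"

text \<open>An open set is pseudoconvex if it has a continuous plurisubharmonic exhaustion function.\<close>

definition pseudoconvex :: "(complex^'n) set \<Rightarrow> bool" where
  "pseudoconvex Y \<longleftrightarrow> open Y \<and>
     (\<exists>\<phi> :: complex^'n \<Rightarrow> real.
        continuous_on Y \<phi> \<and> plurisubharmonic_on Y (\<lambda>y. ereal (\<phi> y)) \<and>
        (\<forall>c. compact {y \<in> Y. \<phi> y \<le> c}))"

subsection \<open>Hermitian ellipsoids\<close>

text \<open>
  \<^term>\<open>Vector_Spaces.linear (*s) (*s)\<close> is linearity over the scalar field \<^typ>\<open>complex\<close>, whereas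
  \<^const>\<open>linear\<close> would only be real linearity; the norm on \<^typ>\<open>complex^'n\<close> is the Euclidean one.
\<close>

definition hermitian_ellipsoids :: "(complex^'n) set set" where
  "hermitian_ellipsoids =
     {f ` ball 0 1 | f :: complex^'n \<Rightarrow> complex^'n. Vector_Spaces.linear (*s) (*s) f \<and> bij f}"

definition max_ellipsoid_vol :: "(complex^'n) set \<Rightarrow> complex^'n \<Rightarrow> ennreal" where
  "max_ellipsoid_vol Y y =
     (SUP E \<in> {E \<in> hermitian_ellipsoids. (\<lambda>z. z + y) ` E \<subseteq> Y}. emeasure lborel E)"

lemma max_ellipsoid_vol_pos:
  fixes Y :: "(complex^'n) set"
  assumes "open Y" "y \<in> Y"
  shows "0 < max_ellipsoid_vol Y y"
proof -
  obtain r where r: "0 < r" "ball y r \<subseteq> Y"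
    using assms openE by blast
  define f :: "complex^'n \<Rightarrow> complex^'n" where "f = (\<lambda>x. of_real r *s x)"
  have f_scaleR: "f = (\<lambda>x. r *\<^sub>R x)"
    by (auto simp: f_def vec_eq_iff fun_eq_iff scaleR_conv_of_real[where 'a = complex])
  have "Vector_Spaces.linear (*s) (*s) f"
    unfolding f_def
    by (unfold_locales) (simp_all add: vec.scale_right_distrib vec.scale_left_distrib mult.commute)
  moreover have "bij f"
    unfolding f_scaleR using r(1)
    by (intro bij_betw_byWitness[where f' = "\<lambda>x. (1/r) *\<^sub>R x"]) auto
  moreover have img: "f ` ball 0 1 = ball 0 r"
    unfolding f_scaleR using r(1) ball_scale[of r "0 :: complex^'n" 1] by simp
  ultimately have E: "ball 0 r \<in> (hermitian_ellipsoids :: (complex^'n) set set)"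
    unfolding hermitian_ellipsoids_def by (force simp: img[symmetric])
  have "(\<lambda>z. z + y) ` ball 0 r \<subseteq> Y"
    using r(2) by (auto simp: dist_norm subset_iff)
  with E have "emeasure lborel (ball (0 :: complex^'n) r) \<le> max_ellipsoid_vol Y y"
    unfolding max_ellipsoid_vol_def by (intro SUP_upper) auto
  moreover have "emeasure lborel (ball (0 :: complex^'n) r) > 0"
    using r(1) emeasure_lborel_ball_finite[of "0 :: complex^'n" r]
      content_ball_pos[of r "0 :: complex^'n"]
    by (simp add: emeasure_eq_ennreal_measure less_top[symmetric] zero_less_measure_iff)
  ultimately show ?thesis by order
qed

text \<open>The logarithm on \<open>[0, \<infinity>]\<close>, with \<open>log 0 = -\<infinity>\<close> and \<open>log \<infinity> = \<infinity>\<close>.\<close>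

definition ln_ennreal :: "ennreal \<Rightarrow> ereal" where
  "ln_ennreal x = (if x = 0 then -\<infinity> else if x = \<infinity> then \<infinity> else ereal (ln (enn2real x)))"

end

theory Submission
  imports Defs "HOL-Complex_Analysis.Conformal_Mappings"
begin

text \<open>
  Write \<open>\<zeta>\<close> for a point of the unit circle. Up to its centre a hermitian ellipsoid is the image of the
  unit ball under an invertible complex matrix \<open>A\<close>, and its volume is \<open>\<bar>det A\<bar>\<^sup>2\<close> times that of the
  ball (\<open>emeasure_ellipsoid\<close>). Shrinking an ellipsoid slightly leaves room to move its centre, so
  \<open>log w\<close> is lower semicontinuous. The point is the mean value inequality on a disc \<open>y + z d\<close>,
  \<open>\<bar>z\<bar> \<le> 1\<close>, contained in \<open>Y\<close>: from ellipsoids at the boundary points of the disc one has to make an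
  ellipsoid at its centre whose logarithmic volume is at least the mean of theirs, up to an error.

  By lower semicontinuity and Fatou's lemma the ellipsoids on the boundary may be taken constant on
  short arcs (\<open>arcs_from_mean\<close>), and by shrinking them to small balls at the ends of the arcs they
  come from a continuous matrix function \<open>A(\<zeta>)\<close> on the circle, with little loss in the mean of
  \<open>log \<bar>det A\<bar>\<close>. If \<open>A\<close> extended to a holomorphic \<open>P(z)\<close> on the disc, then
  each \<open>u\<close> in the ball would give a holomorphic disc \<open>y + z d + P(z) u\<close> with boundary in \<open>Y\<close>; by
  pseudoconvexity its centre \<open>y + P(0) u\<close> is in \<open>Y\<close>, and the mean value inequality
  would follow by applying that of \<open>log \<bar>det P\<bar>\<close>. In general \<open>A\<close> does not extend. But \<open>A\<close> matters only up to a unitary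
  factor on the right, and the theorem of Wiener, Masani, Helson and Lowdenslager says that
  \<open>A A\<^sup>* = P P\<^sup>*\<close> on the circle for some holomorphic \<open>P\<close> with \<open>log \<bar>det P(0)\<bar>\<close> equal to the mean of
  \<open>log \<bar>det A\<bar>\<close>. The approximate form \<open>approximate_spectral_factor\<close> suffices: a matrix polynomial
  \<open>P\<close> with \<open>\<bar>A\<^sup>-\<^sup>1 P\<bar> \<le> 1 + \<epsilon>\<close> on the circle and almost the right determinant at \<open>0\<close>.

  It comes from Szego's extremal problem: minimise the mean of \<open>\<bar>F A\<bar>\<^sup>2\<close> over the matrix functions
  \<open>F\<close> in the Hardy class with \<open>F(0) = 1\<close>. At a minimum \<open>F A A\<^sup>*\<close> is orthogonal to \<open>z F, z\<^sup>2 F, \<dots>\<close>,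
  so all Fourier coefficients of \<open>F A A\<^sup>* F\<^sup>*\<close> but the constant one vanish and this function is a
  constant \<open>C\<close>; then \<open>A (F A)\<^sup>* = F\<^sup>-\<^sup>1 C\<close> is the holomorphic factor, up to a constant matrix. No minimum
  has to exist: a minimising sequence has these properties in the limit by the parallelogram law
  (\<open>extremal_sequence\<close>), and smoothing with a trigonometric kernel turns convergence in the mean
  into uniform bounds (\<open>smoothing_bound\<close>).

  Pseudoconvexity is used through a psh exhaustion function \<open>\<phi>\<close>, which obeys the maximum principle on
  holomorphic discs (\<open>poly_disc_maximum_principle\<close>) and hence the continuity principle
  (\<open>disc_continuity_principle\<close>). As \<open>\<phi>\<close> is only continuous and plurisubharmonicity speaks of
  complex lines, the maximum principle on curved discs is proved by maximising over small
  translates of the disc as well.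
\<close>

section \<open>Complex matrices and their adjoints\<close>

definition adj :: "complex^'n^'m \<Rightarrow> complex^'m^'n" where
  "adj M = (\<chi> i j. cnj (M $ j $ i))"

text \<open>
  Matrices carry the Frobenius norm and its real inner product; only real multiples are
  provided by the vector space structure, so complex multiples need a notation.
\<close>

definition cscale :: "complex \<Rightarrow> complex^'n^'m \<Rightarrow> complex^'n^'m" where
  "cscale c M = (\<chi> i j. c * M $ i $ j)"

lemma adj_nth [simp]: "adj M $ i $ j = cnj (M $ j $ i)"
  by (simp add: adj_def)

lemma cscale_nth [simp]: "cscale c M $ i $ j = c * M $ i $ j"
  by (simp add: cscale_def)

lemma mm_nth: "(A ** B) $ i $ j = (\<Sum>k\<in>UNIV. A $ i $ k * B $ k $ j)"
  by (simp add: matrix_matrix_mult_def)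

lemma adj_adj [simp]: "adj (adj M) = M"
  by (simp add: vec_eq_iff)

lemma scaleR_mv: "(r *\<^sub>R A) *v x = r *\<^sub>R (A *v x)" for A :: "complex^'n^'m"
  by (simp add: vec_eq_iff matrix_vector_mult_def scaleR_sum_right)

lemma adj_mult: "adj (A ** B) = adj B ** adj A"
  by (simp add: vec_eq_iff mm_nth mult.commute)

lemma adj_mat_1 [simp]: "adj (mat 1) = mat 1"
  by (simp add: vec_eq_iff mat_def)

lemma adj_cscale: "adj (cscale c M) = cscale (cnj c) (adj M)"
  by (simp add: vec_eq_iff)

lemma cscale_mult_left: "cscale c A ** B = cscale c (A ** B)"
  by (simp add: vec_eq_iff mm_nth sum_distrib_left mult.assoc)

lemma cscale_mult_right: "A ** cscale c B = cscale c (A ** B)"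
  by (simp add: vec_eq_iff mm_nth sum_distrib_left mult.left_commute)

lemma cscale_cscale: "cscale c (cscale d A) = cscale (c * d) A"
  by (simp add: vec_eq_iff mult.assoc)

lemma cscale_1 [simp]: "cscale 1 A = A"
  by (simp add: vec_eq_iff)

lemma cscale_of_real: "cscale (of_real r) A = r *\<^sub>R A"
  by (simp add: vec_eq_iff scaleR_conv_of_real[where 'a = complex])

lemma inner_complex_Re: "inner x y = Re (x * cnj y)" for x y :: complex
  by (simp add: inner_complex_def)

lemma inner_cscale: "inner (cscale c X) Y = inner X (cscale (cnj c) Y)"
  by (simp add: inner_vec_def inner_complex_Re mult_ac)

text \<open>
  Left multiplication by \<open>E\<close> is moved to the other side of the trace form; this turns a statement
  about all \<open>E\<close> into one about the matrix \<open>Y X\<^sup>*\<close>.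
\<close>

lemma inner_mult_left: "inner (E ** X) Y = inner E (Y ** adj X)"
proof -
  have "inner (E ** X) Y = (\<Sum>i\<in>UNIV. \<Sum>j\<in>UNIV. \<Sum>k\<in>UNIV. Re (E $ i $ k * X $ k $ j * cnj (Y $ i $ j)))"
    by (simp add: inner_vec_def inner_complex_Re mm_nth sum_distrib_right Re_sum del: complex_cnj_mult)
  also have "\<dots> = (\<Sum>i\<in>UNIV. \<Sum>k\<in>UNIV. \<Sum>j\<in>UNIV. Re (E $ i $ k * X $ k $ j * cnj (Y $ i $ j)))"
    by (intro sum.cong refl sum.swap)
  also have "\<dots> = inner E (Y ** adj X)"
    by (simp add: inner_vec_def inner_complex_Re mm_nth sum_distrib_left mult_ac Re_sum
        del: times_complex.simps)
  finally show ?thesis .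
qed

lemma inner_mv_left: "inner (M *v u) v = inner u (adj M *v v)"
proof -
  have "inner (M *v u) v = (\<Sum>i\<in>UNIV. \<Sum>j\<in>UNIV. Re (M $ i $ j * u $ j * cnj (v $ i)))"
    by (simp add: inner_vec_def inner_complex_Re matrix_vector_mult_def sum_distrib_right Re_sum del: complex_cnj_mult)
  also have "\<dots> = (\<Sum>j\<in>UNIV. \<Sum>i\<in>UNIV. Re (M $ i $ j * u $ j * cnj (v $ i)))"
    by (rule sum.swap)
  also have "\<dots> = inner u (adj M *v v)"
    by (simp add: inner_vec_def inner_complex_Re matrix_vector_mult_def sum_distrib_left mult_ac Re_sum
        del: times_complex.simps)
  finally show ?thesis .
qed

lemma norm_sq_vec: "(norm (x :: 'a::real_normed_vector ^'n))\<^sup>2 = (\<Sum>i\<in>UNIV. (norm (x $ i))\<^sup>2)"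
  by (simp add: norm_vec_def L2_set_def sum_nonneg)

lemma norm_adj [simp]: "norm (adj M) = norm M"
proof -
  have "(norm (adj M))\<^sup>2 = (norm M)\<^sup>2"
    unfolding norm_sq_vec by (subst sum.swap) simp
  thus ?thesis by simp
qed

lemma norm_cscale [simp]: "norm (cscale c M) = cmod c * norm M"
proof -
  have "(norm (cscale c M))\<^sup>2 = (cmod c * norm M)\<^sup>2"
    by (simp add: norm_sq_vec power_mult_distrib norm_mult sum_distrib_left)
  thus ?thesis by (metis norm_ge_zero mult_nonneg_nonneg power2_eq_imp_eq)
qed

lemma norm_mv: "norm (A *v x) \<le> norm A * norm x" for A :: "complex^'n^'m"
proof -
  have 1: "norm ((A *v x) $ i) \<le> norm (A $ i) * norm x" for i
  proof -
    have "norm ((A *v x) $ i) \<le> (\<Sum>j\<in>UNIV. norm (A $ i $ j) * norm (x $ j))"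
      unfolding matrix_vector_mult_def by (auto intro!: sum_norm_le simp: norm_mult)
    also have "\<dots> \<le> norm (A $ i) * norm x"
      unfolding norm_vec_def using L2_set_mult_ineq[of "\<lambda>j. norm (A $ i $ j)" "\<lambda>j. norm (x $ j)" UNIV] by simp
    finally show ?thesis .
  qed
  have "(norm (A *v x))\<^sup>2 \<le> (\<Sum>i\<in>UNIV. (norm (A $ i) * norm x)\<^sup>2)"
    unfolding norm_sq_vec[of "A *v x"] using 1 by (intro sum_mono power_mono) auto
  also have "\<dots> = (norm A * norm x)\<^sup>2"
    by (simp add: norm_sq_vec[of A] power_mult_distrib sum_distrib_right)
  finally show ?thesis by (meson norm_ge_zero mult_nonneg_nonneg power2_le_imp_le)
qed

lemma norm_mm: "norm (A ** B) \<le> norm A * norm B" for A :: "complex^'n^'m" and B :: "complex^'k^'n"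
proof -
  let ?t = "\<lambda>M j. (\<chi> i. M $ i $ j)"
  have T: "(norm M)\<^sup>2 = (\<Sum>j\<in>UNIV. (norm (?t M j))\<^sup>2)" for M :: "complex^'b^'a"
    unfolding norm_sq_vec by (subst sum.swap) simp
  have "(norm (A ** B))\<^sup>2 = (\<Sum>j\<in>UNIV. (norm (A *v ?t B j))\<^sup>2)"
    unfolding T[of "A ** B"] by (simp add: matrix_vector_mult_def mm_nth)
  also have "\<dots> \<le> (\<Sum>j\<in>UNIV. (norm A * norm (?t B j))\<^sup>2)"
    by (intro sum_mono power_mono norm_mv) auto
  also have "\<dots> = (norm A * norm B)\<^sup>2"
    by (simp add: T[of B] power_mult_distrib sum_distrib_left)
  finally show ?thesis by (meson norm_ge_zero mult_nonneg_nonneg power2_le_imp_le)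
qed

lemma det_adj: "det (adj A) = cnj (det A)" for A :: "complex^'n^'n"
proof -
  have "det (adj A) = det (transpose (\<chi> i j. cnj (A $ i $ j)))"
    by (rule arg_cong[where f = det]) (simp add: vec_eq_iff transpose_def)
  also have "\<dots> = cnj (det A)"
    unfolding det_transpose by (simp add: det_def)
  finally show ?thesis .
qed

text \<open>
  If \<open>X X\<^sup>*\<close> is close to the identity then \<open>X\<^sup>*\<close> hardly expands vectors, since
  \<open>\<bar>X\<^sup>* u\<bar>\<^sup>2 = \<langle>u, X X\<^sup>* u\<rangle>\<close>.
\<close>

lemma norm_adj_mv_le:
  "norm (adj X *v u) \<le> (1 + norm (X ** adj X - mat 1)) * norm u"
proof -
  let ?D = "X ** adj X - mat 1"
  have "(norm (adj X *v u))\<^sup>2 = inner u (X *v (adj X *v u))"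
    using inner_mv_left[of "adj X" u "adj X *v u"] by (simp add: power2_norm_eq_inner)
  also have "\<dots> = inner u u + inner u (?D *v u)"
    by (simp add: matrix_vector_mul_assoc matrix_vector_mult_diff_rdistrib inner_diff_right)
  also have "\<dots> \<le> (norm u)\<^sup>2 + norm u * (norm ?D * norm u)"
    by (intro add_mono order.trans[OF norm_cauchy_schwarz] mult_left_mono norm_mv) (auto simp: power2_norm_eq_inner[symmetric] power2_eq_square)
  also have "\<dots> \<le> ((1 + norm ?D) * norm u)\<^sup>2"
    by (simp add: power2_eq_square algebra_simps)
  finally show ?thesis by (meson norm_ge_zero add_nonneg_nonneg zero_le_one mult_nonneg_nonneg power2_le_imp_le)
qed

section \<open>Elementary matrices and orthonormalisation\<close>

text \<open>
  One definition covers both kinds of row operation: for \<open>i \<noteq> j\<close> it adds \<open>c\<close> times row \<open>j\<close> to row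
  \<open>i\<close>, and for \<open>i = j\<close> it scales row \<open>i\<close> by \<open>1 + c\<close>.
\<close>

definition elementary :: "'n \<Rightarrow> 'n \<Rightarrow> complex \<Rightarrow> complex^'n^'n" where
  "elementary i j c = (\<chi> k l. (if k = l then 1 else 0) + (if k = i \<and> l = j then c else 0))"

lemma elementary_mult: "(elementary i j c ** M) $ k $ l = M $ k $ l + (if k = i then c * M $ j $ l else 0)"
  for M :: "complex^'m^'n"
proof -
  have "(elementary i j c ** M) $ k $ l =
      (\<Sum>m\<in>UNIV. (if k = m then M $ m $ l else 0) + (if m = j then (if k = i then c * M $ m $ l else 0) else 0))"
    unfolding mm_nth elementary_def by (intro sum.cong) (auto simp: algebra_simps)
  thus ?thesis by (simp add: sum.distrib)
qed

lemma mult_adj_elementary: "(M ** adj (elementary i j c)) $ k $ l = M $ k $ l + (if l = i then cnj c * M $ k $ j else 0)"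
proof -
  have "M ** adj (elementary i j c) = adj (elementary i j c ** adj M)"
    by (simp add: adj_mult)
  thus ?thesis by (simp add: elementary_mult)
qed

lemma elementary_add: "elementary i j c ** elementary i j d = elementary i j (c + d + (if i = j then c * d else 0))"
  by (auto simp: vec_eq_iff elementary_mult) (auto simp: elementary_def algebra_simps)

lemma elementary_0: "elementary i j 0 = mat 1"
  by (simp add: vec_eq_iff elementary_def mat_def)

lemma det_elementary: "det (elementary i j c) = (if i = j then 1 + c else 1)"
proof (cases "i = j")
  case True
  have "det (elementary i i c) = (\<Prod>k\<in>UNIV. elementary i i c $ k $ k)"
    by (rule det_diagonal) (auto simp: elementary_def)
  also have "\<dots> = (\<Prod>k\<in>UNIV. if k = i then 1 + c else 1)"
    by (intro prod.cong) (auto simp: elementary_def)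
  finally show ?thesis using True by simp
next
  case False
  have "elementary i j c = (\<chi> k. if k = i then row i (mat 1) + c *s row j (mat 1) else row k (mat 1))"
    using False by (auto simp: vec_eq_iff elementary_def row_def mat_def)
  also have "det \<dots> = det (mat 1 :: complex^'a^'a)"
    by (rule det_row_operation[OF False])
  finally show ?thesis using False by simp
qed

inductive elem_prod :: "complex^'n^'n \<Rightarrow> bool" where
  elem_prod_one: "elem_prod (mat 1)"
| elem_prod_mult: "elem_prod E \<Longrightarrow> (i = j \<Longrightarrow> 1 + c \<noteq> 0) \<Longrightarrow> elem_prod (elementary i j c ** E)"

lemma elem_prod_det: "elem_prod E \<Longrightarrow> det E \<noteq> 0"
  by (induction rule: elem_prod.induct) (auto simp: det_mul det_elementary)

definition posdef :: "complex^'n^'n \<Rightarrow> bool" where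
  "posdef C \<longleftrightarrow> adj C = C \<and> (\<forall>x. x \<noteq> 0 \<longrightarrow> 0 < inner x (C *v x))"

lemma posdef_congruence:
  assumes "posdef C" "det E \<noteq> 0"
  shows "posdef (E ** C ** adj E)"
proof -
  have inj: "adj E *v x \<noteq> 0" if "x \<noteq> 0" for x
  proof
    assume "adj E *v x = 0"
    moreover have "invertible (adj E)"
      using assms(2) by (simp add: invertible_det_nz det_adj)
    ultimately show False
      using that by (metis invertible_def matrix_vector_mul_assoc matrix_vector_mul_lid matrix_vector_mult_0_right)
  qed
  have "inner x ((E ** C ** adj E) *v x) = inner (adj E *v x) (C *v (adj E *v x))" for x
    by (simp add: inner_mv_left matrix_vector_mul_assoc matrix_mul_assoc)
  with assms inj show ?thesis
    by (simp add: posdef_def adj_mult matrix_mul_assoc)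
qed

lemma posdef_diag:
  assumes "posdef C"
  shows "C $ i $ i = of_real (Re (C $ i $ i))" "0 < Re (C $ i $ i)"
proof -
  have "C $ i $ i = cnj (C $ i $ i)"
    using assms unfolding posdef_def by (metis adj_nth)
  thus "C $ i $ i = of_real (Re (C $ i $ i))"
    by (simp add: complex_eq_iff)
  have "(C *v axis i 1) $ i = (\<Sum>k\<in>UNIV. if k = i then C $ i $ k else 0)"
    unfolding matrix_vector_mult_def vec_lambda_beta by (intro sum.cong) (auto simp: axis_def)
  hence "inner (axis i 1) (C *v axis i 1) = Re (C $ i $ i)"
    by (simp add: inner_axis' inner_complex_Re)
  moreover have "axis i (1::complex) \<noteq> (0 :: complex^'a)"
    by (simp add: axis_eq_0_iff)
  ultimately show "0 < Re (C $ i $ i)"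
    using assms unfolding posdef_def by metis
qed

text \<open>
  Gram-Schmidt for the rows of \<open>E\<close> with respect to the form \<open>C\<close>, as a sequence of row operations:
  row \<open>i\<close> is made orthogonal to the rows already orthonormal, one after the other, and then
  normalised.
\<close>

lemma elem_orthonormalise_on:
  assumes C: "posdef (C :: complex^'n^'n)" and "finite S"
  shows "\<exists>E. elem_prod E \<and> (\<forall>i\<in>S. \<forall>j\<in>S. (E ** C ** adj E) $ i $ j = (if i = j then 1 else 0))"
  using \<open>finite S\<close>
proof induction
  case empty
  show ?case using elem_prod_one by blast
next
  case (insert i S)
  let ?D = "\<lambda>E. E ** C ** adj E"
  let ?on = "\<lambda>E S. \<forall>i\<in>S. \<forall>j\<in>S. ?D E $ i $ j = (if i = j then 1 else 0)"
  have step: "?D (elementary a b c ** E) = elementary a b c ** ?D E ** adj (elementary a b c)" for a b c E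
    by (simp add: adj_mult matrix_mul_assoc)
  have "finite T \<Longrightarrow> T \<subseteq> S \<Longrightarrow> \<exists>E. elem_prod E \<and> ?on E S \<and> (\<forall>j\<in>T. ?D E $ i $ j = 0)" for T
  proof (induction rule: finite_induct)
    case empty
    then show ?case using insert.IH by auto
  next
    case (insert j T)
    then obtain E where E: "elem_prod E" "?on E S" "\<forall>j\<in>T. ?D E $ i $ j = 0" by auto
    have ij: "i \<noteq> j" "j \<in> S" using insert.prems \<open>i \<notin> S\<close> by auto
    let ?E = "elementary i j (- ?D E $ i $ j) ** E"
    have "elem_prod ?E" using E(1) ij by (intro elem_prod_mult) auto
    moreover have "?on ?E S"
      unfolding step using E(2) \<open>i \<notin> S\<close> by (auto simp: mult_adj_elementary elementary_mult)
    moreover have "\<forall>k\<in>insert j T. ?D ?E $ i $ k = 0"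
      unfolding step using E(2,3) \<open>i \<notin> S\<close> ij insert.prems insert.hyps
      by (auto simp: mult_adj_elementary elementary_mult subset_iff)
    ultimately show ?case by blast
  qed
  from this[of S] insert.hyps obtain E
    where E: "elem_prod E" "?on E S" "\<forall>j\<in>S. ?D E $ i $ j = 0" by auto
  have pd: "posdef (?D E)" using C E(1) by (simp add: posdef_congruence elem_prod_det)
  have D0: "?D E $ j $ i = 0" if "j \<in> S" for j
    using pd E(3) that unfolding posdef_def by (metis adj_nth complex_cnj_zero)
  define d where "d = Re (?D E $ i $ i)"
  have d: "0 < d" "?D E $ i $ i = of_real d" using posdef_diag[OF pd, of i] by (auto simp: d_def)
  \<comment> \<open>Row \<open>i\<close> is scaled by \<open>1 + c = 1 / sqrt d\<close>.\<close>
  define c :: complex where "c = of_real (1 / sqrt d) - 1"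
  let ?E = "elementary i i c ** E"
  have ep: "elem_prod ?E" using E(1) d by (intro elem_prod_mult) (auto simp: c_def)
  have cc: "of_real d + c * of_real d + cnj c * (of_real d + c * of_real d) = 1"
  proof -
    have "of_real d + c * of_real d + cnj c * (of_real d + c * of_real d) = of_real ((1 / sqrt d)\<^sup>2 * d)"
      by (simp add: c_def algebra_simps power2_eq_square del: of_real_mult) (simp add: algebra_simps flip: of_real_mult)?
    also have "(1 / sqrt d)\<^sup>2 * d = 1" using d by (simp add: power_divide)
    finally show ?thesis by simp
  qed
  have "?on ?E (insert i S)"
    unfolding step using E(2,3) D0 \<open>i \<notin> S\<close> d cc by (auto simp: mult_adj_elementary elementary_mult)
  with ep show ?case by blast
qed

lemma elem_orthonormalise:
  assumes "posdef (C :: complex^'n^'n)"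
  obtains E where "elem_prod E" "E ** C ** adj E = mat 1"
  using elem_orthonormalise_on[OF assms, of UNIV] by (force simp: vec_eq_iff mat_def)

section \<open>Volumes of ellipsoids\<close>

text \<open>
  The volume formula for real linear maps is stated for index types with a well-order, which
  \<open>'n bit0\<close> has and \<open>'n \<times> bool\<close> has not. Any bijection between them will do.
\<close>

definition re_im_index :: "'n \<times> bool \<Rightarrow> 'n::finite bit0" where
  "re_im_index = (SOME g. bij g)"

lemma bij_re_im_index: "bij (re_im_index :: 'n \<times> bool \<Rightarrow> 'n::finite bit0)"
proof -
  have "card (UNIV :: ('n \<times> bool) set) = card (UNIV :: 'n bit0 set)"
    by (simp add: card_prod)
  then obtain g :: "'n \<times> bool \<Rightarrow> 'n bit0" where "bij g"
    using finite_same_card_bij[of "UNIV :: ('n \<times> bool) set" "UNIV :: 'n bit0 set"] by auto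
  thus ?thesis unfolding re_im_index_def by (rule someI[of bij])
qed

lemma re_im_index_cases:
  obtains i b where "p = re_im_index (i, b)"
  using bij_re_im_index[THEN bij_is_surj] by (metis surj_pair surjE)

lemma re_im_index_eq [simp]: "re_im_index p = re_im_index q \<longleftrightarrow> p = q"
  using bij_re_im_index[THEN bij_is_inj] by (rule inj_eq)

lemma inv_re_im_index [simp]: "inv re_im_index (re_im_index p) = p"
  using bij_re_im_index[THEN bij_is_inj] by (rule inv_f_f)

lemma prod_re_im_index:
  "(\<Prod>p\<in>UNIV. f p) = (\<Prod>i\<in>UNIV. \<Prod>b\<in>UNIV. f (re_im_index (i, b)))"
  for f :: "'n::finite bit0 \<Rightarrow> 'c::comm_monoid_mult"
proof -
  have "(\<Prod>p\<in>UNIV. f p) = (\<Prod>q\<in>UNIV. f (re_im_index q))"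
    using bij_re_im_index by (rule prod.reindex_bij_betw[symmetric])
  thus ?thesis by (simp add: prod.cartesian_product case_prod_beta)
qed

definition cplx :: "real^('n::finite bit0) \<Rightarrow> complex^'n" where
  "cplx x = (\<chi> i. Complex (x $ re_im_index (i, False)) (x $ re_im_index (i, True)))"

definition uncplx :: "complex^'n \<Rightarrow> real^('n::finite bit0)" where
  "uncplx z = (\<chi> p. case inv re_im_index p of (i, b) \<Rightarrow> if b then Im (z $ i) else Re (z $ i))"

lemma cplx_nth: "Re (cplx x $ i) = x $ re_im_index (i, False)" "Im (cplx x $ i) = x $ re_im_index (i, True)"
  by (simp_all add: cplx_def)

lemma uncplx_nth: "uncplx z $ re_im_index (i, b) = (if b then Im (z $ i) else Re (z $ i))"
  by (simp add: uncplx_def)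

lemma vec_bit0_eq_iff: "x = y \<longleftrightarrow> (\<forall>i b. x $ re_im_index (i, b) = y $ re_im_index (i, b))"
  for x y :: "'a^('n::finite bit0)"
  unfolding vec_eq_iff by (metis re_im_index_cases)

lemma cplx_uncplx [simp]: "cplx (uncplx z) = z" "uncplx (cplx x) = x"
  by (auto simp: vec_bit0_eq_iff vec_eq_iff complex_eq_iff cplx_nth uncplx_nth)

lemma linear_cplx: "linear cplx" "linear uncplx"
  by (auto intro!: linearI simp: vec_bit0_eq_iff vec_eq_iff complex_eq_iff cplx_nth uncplx_nth)

lemma continuous_on_cplx: "continuous_on S cplx"
  using linear_cplx(1) by (intro linear_continuous_on) (simp add: linear_conv_bounded_linear)

lemma borel_measurable_cplx: "cplx \<in> borel_measurable lborel"
  by (simp add: borel_measurable_continuous_onI continuous_on_cplx)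

lemma cplx_lborel: "distr lborel borel cplx = (lborel :: (complex^'n) measure)"
proof (rule lborel_eqI[symmetric])
  fix l u :: "complex^'n"
  assume le: "\<And>b. b \<in> Basis \<Longrightarrow> l \<bullet> b \<le> u \<bullet> b"
  have B: "z \<bullet> axis i 1 = Re (z $ i)" "z \<bullet> axis i \<i> = Im (z $ i)" for z :: "complex^'n" and i
    by (simp_all add: inner_axis inner_complex_Re)
  have le': "uncplx l $ p \<le> uncplx u $ p" for p
  proof -
    obtain i b where "p = re_im_index (i, b)" by (rule re_im_index_cases)
    thus ?thesis
      using le[of "axis i 1"] le[of "axis i \<i>"] unfolding B
      by (auto simp: uncplx_nth Basis_vec_def Basis_complex_def)
  qed
  have "cplx -` box l u = box (uncplx l) (uncplx u)"
  proof -
    have "x \<in> box (uncplx l) (uncplx u) \<longleftrightarrow> (\<forall>i b. uncplx l $ re_im_index (i, b) < x $ re_im_index (i, b) \<and> x $ re_im_index (i, b) < uncplx u $ re_im_index (i, b))" for x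
      unfolding mem_box_cart by (metis re_im_index_cases)
    moreover have "x \<in> cplx -` box l u \<longleftrightarrow> (\<forall>i b. uncplx l $ re_im_index (i, b) < x $ re_im_index (i, b) \<and> x $ re_im_index (i, b) < uncplx u $ re_im_index (i, b))" for x
      by (auto simp: mem_box Basis_vec_def Basis_complex_def cplx_nth uncplx_nth B ball_Un all_bool_eq)
    ultimately show ?thesis by blast
  qed
  hence "emeasure (distr lborel borel cplx) (box l u) = emeasure lborel (box (uncplx l) (uncplx u))"
    by (subst emeasure_distr[OF borel_measurable_cplx]) auto
  also have "\<dots> = (\<Prod>b\<in>Basis. (uncplx u - uncplx l) \<bullet> b)"
    using le' by (intro emeasure_lborel_box) (auto simp: Basis_vec_def inner_axis)
  also have "(\<Prod>b\<in>Basis. (uncplx u - uncplx l) \<bullet> b) = (\<Prod>p\<in>UNIV. (uncplx u - uncplx l) $ p)"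
  proof -
    have "bij_betw (\<lambda>p. axis p (1::real)) UNIV (Basis :: (real^('n bit0)) set)"
      by (auto simp: bij_betw_def inj_on_def axis_eq_axis Basis_vec_def)
    from prod.reindex_bij_betw[OF this, of "\<lambda>b. (uncplx u - uncplx l) \<bullet> b"] show ?thesis
      by (simp add: inner_axis)
  qed
  also have "\<dots> = (\<Prod>i\<in>UNIV. Re (u $ i - l $ i) * Im (u $ i - l $ i))"
    unfolding prod_re_im_index by (simp add: UNIV_bool uncplx_nth mult.commute)
  also have "\<dots> = (\<Prod>i\<in>UNIV. \<Prod>b\<in>{1,\<i>}. (u - l) \<bullet> axis i b)"
    by (simp add: B)
  also have "\<dots> = (\<Prod>(i,b)\<in>UNIV\<times>{1,\<i>}. (u - l) \<bullet> axis i b)"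
    by (rule prod.cartesian_product)
  also have "\<dots> = (\<Prod>b\<in>Basis. (u - l) \<bullet> b)"
  proof -
    have "bij_betw (\<lambda>(i, b). axis i b) (UNIV \<times> {1, \<i>}) (Basis :: (complex^'n) set)"
      by (auto simp: bij_betw_def inj_on_def axis_eq_axis Basis_vec_def Basis_complex_def)
    from prod.reindex_bij_betw[OF this, of "\<lambda>b. (u - l) \<bullet> b"] show ?thesis
      by (simp add: case_prod_beta)
  qed
  finally show "emeasure (distr lborel borel cplx) (box l u) = ennreal (\<Prod>b\<in>Basis. (u - l) \<bullet> b)" .
qed simp

text \<open>
  The factor by which a complex matrix scales real volume; multiplicativity is immediate from this
  form, and its value \<open>\<bar>det A\<bar>\<^sup>2\<close> is found from multiplicativity.
\<close>

definition rdet :: "complex^'n^'n \<Rightarrow> real" where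
  "rdet A = \<bar>det (matrix (\<lambda>x. uncplx (A *v cplx x)))\<bar>"

lemma linear_real_form: "linear (\<lambda>x. uncplx (A *v cplx x))"
  using linear_compose[OF linear_compose[OF linear_cplx(1) matrix_vector_mul_linear[of A]] linear_cplx(2)]
  by (simp add: o_def)

lemma rdet_mult: "rdet (A ** B) = rdet A * rdet B"
proof -
  have "(\<lambda>x. uncplx ((A ** B) *v cplx x)) = (\<lambda>x. uncplx (A *v cplx x)) \<circ> (\<lambda>x. uncplx (B *v cplx x))"
    by (simp add: fun_eq_iff matrix_vector_mul_assoc)
  thus ?thesis
    by (simp add: rdet_def matrix_compose linear_real_form det_mul abs_mult)
qed

lemma emeasure_uncplx:
  assumes "open S"
  shows "emeasure lborel (uncplx ` S) = emeasure lborel S"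
proof -
  have "cplx -` S = uncplx ` S"
    by (auto simp: image_iff) (metis cplx_uncplx(2))
  with assms show ?thesis
    using emeasure_distr[OF borel_measurable_cplx, of S] unfolding cplx_lborel by simp
qed

lemma open_image_mv:
  fixes A :: "complex^'n^'n"
  assumes "det A \<noteq> 0" "open S"
  shows "open ((*v) A ` S)"
proof -
  obtain B where B: "A ** B = mat 1" "B ** A = mat 1"
    using assms(1) by (auto simp: invertible_det_nz[symmetric] invertible_def)
  have "(*v) A ` S = (*v) B -` S"
    using B by (auto simp: image_iff matrix_vector_mul_assoc) (metis matrix_vector_mul_assoc matrix_vector_mul_lid)
  moreover have "continuous_on UNIV ((*v) B)"
    by (intro linear_continuous_on) simp
  ultimately show ?thesis
    using open_vimage[OF assms(2)] by simp
qed

lemma emeasure_image_ball_rdet: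
  fixes A :: "complex^'n^'n"
  assumes "det A \<noteq> 0"
  shows "emeasure lborel ((*v) A ` ball 0 1) = ennreal (rdet A * measure lborel (ball (0 :: complex^'n) 1))"
proof -
  let ?f = "\<lambda>x. uncplx (A *v cplx x)"
  let ?U = "uncplx ` ball (0 :: complex^'n) 1"
  have oU: "open (uncplx ` S)" if "open S" for S :: "(complex^'n) set"
  proof -
    have "uncplx ` S = cplx -` S"
      by (auto simp: image_iff) (metis cplx_uncplx(2))
    thus ?thesis
      using open_vimage[OF that continuous_on_cplx] by simp
  qed
  have U: "?U \<in> lmeasurable"
    using oU[of "ball 0 1"] bounded_linear_image[OF bounded_ball, of uncplx] linear_cplx(2)
    by (intro bounded_set_imp_lmeasurable) (auto simp: linear_conv_bounded_linear)
  have mU: "measure lebesgue ?U = measure lborel (ball (0 :: complex^'n) 1)"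
    using oU[of "ball 0 1"] emeasure_uncplx[of "ball (0 :: complex^'n) 1"]
    by (simp add: measure_def)
  have im: "uncplx ` (*v) A ` ball 0 1 = ?f ` ?U"
    by (simp add: image_image)
  have fU: "?f ` ?U \<in> lmeasurable" and "measure lebesgue (?f ` ?U) = \<bar>det (matrix ?f)\<bar> * measure lebesgue ?U"
    using measurable_linear_image[OF linear_real_form U] measure_linear_image[OF linear_real_form U] by auto
  hence "measure lebesgue (?f ` ?U) = rdet A * measure lborel (ball (0 :: complex^'n) 1)"
    by (simp add: rdet_def mU)
  moreover have "emeasure lborel ((*v) A ` ball 0 1) = emeasure lborel (?f ` ?U)"
    using emeasure_uncplx[OF open_image_mv[OF assms open_ball]] im by metis
  moreover have "\<dots> = emeasure lebesgue (?f ` ?U)"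
    using borel_open[OF oU[OF open_image_mv[OF assms open_ball]], of 0 1] unfolding im by simp
  moreover have "\<dots> = ennreal (measure lebesgue (?f ` ?U))"
    using fU by (simp add: emeasure_eq_measure2)
  ultimately show ?thesis by simp
qed

lemma rdet_unitary:
  fixes X :: "complex^'n^'n"
  assumes X: "X ** adj X = mat 1"
  shows "rdet X = 1" "cmod (det X) = 1"
proof -
  have X': "adj X ** X = mat 1"
    using X by (simp add: matrix_left_right_inverse)
  have n: "norm (Y *v x) = norm x" if "adj Y ** Y = mat 1" for Y :: "complex^'n^'n" and x
    using inner_mv_left[of Y x "Y *v x"] that
    by (simp add: matrix_vector_mul_assoc norm_eq_sqrt_inner)
  have "(*v) X ` ball 0 1 = ball 0 1"
  proof (intro equalityI subsetI)
    fix y :: "complex^'n" assume "y \<in> ball 0 1"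
    hence "adj X *v y \<in> ball 0 1" using n[of "adj X" y] X by simp
    moreover have "y = X *v (adj X *v y)" using X by (simp add: matrix_vector_mul_assoc)
    ultimately show "y \<in> (*v) X ` ball 0 1" by blast
  qed (use n[OF X'] in auto)
  have "det X * cnj (det X) = 1"
    using arg_cong[OF X, of det] by (simp add: det_mul det_adj)
  hence "complex_of_real ((cmod (det X))\<^sup>2) = 1" by (simp only: complex_norm_square)
  hence "(cmod (det X))\<^sup>2 = 1" by (simp only: of_real_eq_1_iff)
  thus d: "cmod (det X) = 1"
    by (metis norm_ge_zero power2_eq_1_iff neg_0_le_iff_le not_one_le_zero)
  hence "det X \<noteq> 0" by auto
  from emeasure_image_ball_rdet[OF this] \<open>(*v) X ` ball 0 1 = ball 0 1\<close>
  have "emeasure lborel (ball (0 :: complex^'n) 1) = ennreal (rdet X * measure lborel (ball (0 :: complex^'n) 1))"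
    by simp
  moreover have "emeasure lborel (ball (0 :: complex^'n) 1) = ennreal (measure lborel (ball (0 :: complex^'n) 1))"
    using emeasure_lborel_ball_finite[of "0 :: complex^'n" 1] by (simp add: emeasure_eq_ennreal_measure)
  moreover have "0 < measure lborel (ball (0 :: complex^'n) 1)"
    using content_ball_pos[of 1 "0 :: complex^'n"] by simp
  moreover have "0 \<le> rdet X" by (simp add: rdet_def)
  ultimately show "rdet X = 1" by (simp add: ennreal_inj)
qed

lemma rdet_one [simp]: "rdet (mat 1) = 1"
  by (rule rdet_unitary) simp

lemma rdet_scale: 
  assumes "0 < r"
  shows "rdet (elementary i i (of_real (r - 1))) = r\<^sup>2"
proof -
  let ?f = "\<lambda>x. uncplx (elementary i i (of_real (r - 1)) *v cplx x)"
  have e: "(elementary i i c *v x) $ k = x $ k + (if k = i then c * x $ k else 0)" for c k and x :: "complex^'a"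
  proof -
    have "(elementary i i c *v x) $ k = (\<Sum>m\<in>UNIV. (if m = k then x $ m else 0) + (if m = i then (if k = i then c * x $ m else 0) else 0))"
      unfolding matrix_vector_mult_def elementary_def by (simp, intro sum.cong) (auto simp: algebra_simps)
    thus ?thesis by (simp add: sum.distrib)
  qed
  have f: "?f x $ p = (if fst (inv re_im_index p) = i then r else 1) * x $ p" for x p
  proof -
    obtain k b where "p = re_im_index (k, b)" by (rule re_im_index_cases)
    thus ?thesis by (auto simp: uncplx_nth e cplx_nth algebra_simps)
  qed
  have m: "matrix ?f $ p $ q = (if p = q then (if fst (inv re_im_index p) = i then r else 1) else 0)" for p q
    unfolding matrix_def vec_lambda_beta f by (simp add: axis_def)
  have "det (matrix ?f) = (\<Prod>p\<in>UNIV. matrix ?f $ p $ p)"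
    by (rule det_diagonal) (simp only: m if_False)
  also have "\<dots> = (\<Prod>k\<in>UNIV. \<Prod>b\<in>(UNIV::bool set). if k = i then r else 1)"
    unfolding m prod_re_im_index by simp
  also have "\<dots> = (\<Prod>k\<in>UNIV. if k = i then r\<^sup>2 else 1)"
    by (intro prod.cong) (auto simp: UNIV_bool power2_eq_square)
  finally show ?thesis by (simp add: rdet_def)
qed

text \<open>
  A shear \<open>T\<^sub>c\<close> is conjugate to \<open>T\<^sub>2\<^sub>c = T\<^sub>c\<^sup>2\<close> by a diagonal matrix, so a multiplicative function takes
  the value \<open>1\<close> on it. A diagonal matrix is the product of a positive one, where the real
  determinant is visible, and a unitary one, which preserves the ball.
\<close>

lemma rdet_elementary:
  assumes "i = j \<Longrightarrow> 1 + c \<noteq> 0"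
  shows "rdet (elementary i j c :: complex^'n^'n) = (cmod (det (elementary i j c :: complex^'n^'n)))\<^sup>2"
proof (cases "i = j")
  case False
  let ?e = "\<lambda>c. elementary i j c :: complex^'n^'n"
  \<comment> \<open>\<open>?D\<close> doubles row \<open>i\<close> and \<open>?D'\<close> halves it.\<close>
  let ?D = "elementary i i 1 :: complex^'n^'n" and ?D' = "elementary i i (- 1 / 2) :: complex^'n^'n"
  have "?D ** ?D' = mat 1" by (simp add: elementary_add elementary_0)
  hence DD: "rdet ?D * rdet ?D' = 1" by (metis rdet_mult rdet_one)
  have "?e c ** ?e (- c) = mat 1" using False by (simp add: elementary_add elementary_0)
  hence "rdet (?e c) * rdet (?e (-c)) = 1" by (metis rdet_mult rdet_one)
  hence nz: "rdet (?e c) \<noteq> 0" by auto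
  have "?D ** ?e c ** ?D' = ?e (c + c)"
    unfolding matrix_mul_assoc[symmetric] using False
    by (auto simp: vec_eq_iff elementary_mult) (auto simp: elementary_def algebra_simps)
  also have "\<dots> = ?e c ** ?e c" using False by (simp add: elementary_add)
  finally have "rdet ?D * rdet (?e c) * rdet ?D' = rdet (?e c) * rdet (?e c)" by (metis rdet_mult)
  with DD nz have "rdet (?e c) = 1" by (simp add: mult.commute mult.left_commute)
  with False show ?thesis by (simp add: det_elementary)
next
  case True
  define r where "r = cmod (1 + c)"
  define u where "u = (1 + c) / of_real r"
  have r: "0 < r" using assms True by (simp add: r_def)
  have u: "cmod u = 1" using r by (simp add: u_def norm_divide r_def)
  hence uu: "u * cnj u = 1" by (simp add: complex_norm_square[symmetric])
  have "of_real r * u = 1 + c" using r by (simp add: u_def)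
  hence "of_real (r - 1) + (u - 1) + of_real (r - 1) * (u - 1) = c"
    by (simp add: algebra_simps)
  hence "elementary i i c = elementary i i (of_real (r - 1)) ** (elementary i i (u - 1) :: complex^'n^'n)"
    by (simp add: elementary_add)
  hence "rdet (elementary i i c :: complex^'n^'n) = r\<^sup>2 * rdet (elementary i i (u - 1) :: complex^'n^'n)"
    by (metis rdet_mult rdet_scale[OF r])
  moreover have "rdet (elementary i i (u - 1) :: complex^'n^'n) = 1"
    using uu by (intro rdet_unitary) (auto simp: vec_eq_iff mult_adj_elementary, auto simp: elementary_def mat_def algebra_simps)
  ultimately show ?thesis using True by (simp add: det_elementary r_def)
qed

text \<open>
  Row operations turn \<open>A\<close> into a unitary matrix, namely those that orthonormalise \<open>A A\<^sup>*\<close>.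
\<close>

lemma rdet_eq:
  fixes A :: "complex^'n^'n"
  assumes "det A \<noteq> 0"
  shows "rdet A = (cmod (det A))\<^sup>2"
proof -
  have "posdef (mat 1 :: complex^'n^'n)" by (simp add: posdef_def)
  from posdef_congruence[OF this assms] have "posdef (A ** adj A)" by simp
  then obtain E where E: "elem_prod E" "E ** (A ** adj A) ** adj E = mat 1"
    by (rule elem_orthonormalise)
  have E2: "rdet E = (cmod (det E))\<^sup>2" using E(1)
    by induction (auto simp: rdet_mult rdet_elementary det_mul norm_mult power_mult_distrib)
  have "(E ** A) ** adj (E ** A) = mat 1" using E(2) by (simp add: adj_mult matrix_mul_assoc)
  from rdet_unitary[OF this] have "rdet E * rdet A = 1" "(cmod (det E))\<^sup>2 * (cmod (det A))\<^sup>2 = 1"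
    by (simp_all add: rdet_mult det_mul norm_mult flip: power_mult_distrib)
  thus ?thesis unfolding E2 by (metis mult_left_cancel mult_zero_left zero_neq_one)
qed

definition unit_vol :: "'n::finite itself \<Rightarrow> real" where
  "unit_vol _ = measure lborel (ball (0 :: complex^'n) 1)"

lemma unit_vol_pos: "0 < unit_vol TYPE('n::finite)"
  unfolding unit_vol_def using content_ball_pos[of 1 "0 :: complex^'n"] by simp

theorem emeasure_ellipsoid:
  fixes A :: "complex^'n^'n"
  assumes "det A \<noteq> 0"
  shows "emeasure lborel ((*v) A ` ball 0 1) = ennreal ((cmod (det A))\<^sup>2 * unit_vol TYPE('n))"
  using emeasure_image_ball_rdet[OF assms] by (simp add: rdet_eq[OF assms] unit_vol_def)

text \<open>
  Compare volumes: \<open>A\<close> maps the unit ball into the ball of radius \<open>c\<close>.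
\<close>

lemma det_le_of_contraction:
  fixes A :: "complex^'n^'n"
  assumes "\<And>u. norm (A *v u) \<le> c * norm u" "0 < c"
  shows "cmod (det A) \<le> c ^ CARD('n)"
proof (cases "det A = 0")
  case False
  let ?S = "c *\<^sub>R (mat 1 :: complex^'n^'n)"
  have "?S = (\<chi> i. of_real c *s (mat 1 :: complex^'n^'n) $ i)"
    by (simp add: vec_eq_iff scaleR_conv_of_real[where 'a = complex])
  hence dS: "det ?S = of_real c ^ CARD('n)"
    using det_rows_mul[of "\<lambda>i::'n. of_real c" "\<lambda>i. (mat 1 :: complex^'n^'n) $ i"] by simp
  have "(*v) A ` ball 0 1 \<subseteq> (*v) ?S ` ball 0 1"
  proof (rule image_subsetI)
    fix u :: "complex^'n" assume "u \<in> ball 0 1"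
    hence "c * norm u < c * 1" using assms(2) by (intro mult_strict_left_mono) auto
    with assms(1)[of u] have "norm (A *v u) < c" by linarith
    hence "(1/c) *\<^sub>R (A *v u) \<in> ball 0 1"
      using assms(2) by (simp add: divide_simps)
    moreover have "A *v u = ?S *v ((1/c) *\<^sub>R (A *v u))"
      using assms(2) unfolding scaleR_mv by simp
    ultimately show "A *v u \<in> (*v) ?S ` ball 0 1" by blast
  qed
  moreover have "(*v) ?S ` ball 0 1 \<in> sets lborel"
    using open_image_mv[of ?S "ball 0 1"] dS assms(2) by simp
  ultimately have "emeasure lborel ((*v) A ` ball 0 1) \<le> emeasure lborel ((*v) ?S ` ball 0 1)"
    by (rule emeasure_mono)
  hence "(cmod (det A))\<^sup>2 \<le> (cmod (det ?S))\<^sup>2"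
    using emeasure_ellipsoid[OF False] emeasure_ellipsoid[of ?S] dS assms(2) unit_vol_pos[where 'n='n]
    by (simp add: ennreal_le_iff)
  thus ?thesis using assms(2) by (simp add: dS norm_power)
qed (use assms in simp)

section \<open>Means over the unit circle\<close>

abbreviation circ :: "complex set" where "circ \<equiv> sphere 0 1"

definition circle_avg :: "(complex \<Rightarrow> 'b::euclidean_space) \<Rightarrow> 'b" where
  "circle_avg f = (1 / (2 * pi)) *\<^sub>R integral {0..2*pi} (\<lambda>t. f (cis t))"

lemma circle_avg_integrable:
  fixes f :: "complex \<Rightarrow> 'b::euclidean_space"
  assumes "continuous_on circ f"
  shows "(\<lambda>t. f (cis t)) integrable_on {0..2*pi}"
proof -
  have "continuous_on {0..2*pi} (f \<circ> cis)"
    by (rule continuous_on_compose) (auto intro!: continuous_intros continuous_on_subset[OF assms] simp: )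
  hence "continuous_on {0..2*pi} (\<lambda>t. f (cis t))" by (simp add: o_def)
  thus ?thesis by (rule integrable_continuous_real)
qed

lemma circle_avg_add: "continuous_on circ f \<Longrightarrow> continuous_on circ g \<Longrightarrow> circle_avg (\<lambda>w. f w + g w) = circle_avg f + circle_avg g"
  unfolding circle_avg_def by (subst integral_add) (auto intro: circle_avg_integrable simp: scaleR_add_right)

lemma circle_avg_diff: "continuous_on circ f \<Longrightarrow> continuous_on circ g \<Longrightarrow> circle_avg (\<lambda>w. f w - g w) = circle_avg f - circle_avg g"
  unfolding circle_avg_def by (subst integral_diff) (auto intro: circle_avg_integrable simp: scaleR_diff_right)

lemma circle_avg_linear:
  fixes L :: "'a::euclidean_space \<Rightarrow> 'b::euclidean_space"
  assumes "linear L" "continuous_on circ f"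
  shows "circle_avg (\<lambda>w. L (f w)) = L (circle_avg f)"
proof -
  have L: "bounded_linear L" using assms(1) by (simp add: linear_conv_bounded_linear)
  have "integral {0..2*pi} (L \<circ> (\<lambda>t. f (cis t))) = L (integral {0..2*pi} (\<lambda>t. f (cis t)))"
    by (rule integral_linear[OF circle_avg_integrable[OF assms(2)] L])
  thus ?thesis
    unfolding circle_avg_def by (simp add: o_def linear_scale[OF assms(1)])
qed

lemma circle_avg_scaleR: "continuous_on circ f \<Longrightarrow> circle_avg (\<lambda>w. c *\<^sub>R f w) = c *\<^sub>R circle_avg f"
  by (intro circle_avg_linear linearI) (auto simp: algebra_simps)

lemma circle_avg_mult_left: "continuous_on circ f \<Longrightarrow> circle_avg (\<lambda>w. c * f w) = c * circle_avg f"
  for c :: "'b::{euclidean_space,real_normed_field}"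
  by (intro circle_avg_linear linearI) (auto simp: algebra_simps)

lemma circle_avg_const [simp]: "circle_avg (\<lambda>w. c) = c"
  by (simp add: circle_avg_def)

lemma circle_avg_sum: 
  assumes "finite I" "\<And>i. i \<in> I \<Longrightarrow> continuous_on circ (f i)"
  shows "circle_avg (\<lambda>w. \<Sum>i\<in>I. f i w) = (\<Sum>i\<in>I. circle_avg (f i))"
  using assms by (induction) (auto simp: circle_avg_add continuous_on_sum)

lemma cis_circ [simp]: "cis t \<in> circ"
  by simp

lemma circle_avg_cong: "(\<And>w. w \<in> circ \<Longrightarrow> f w = g w) \<Longrightarrow> circle_avg f = circle_avg g"
  unfolding circle_avg_def by simp

lemma circle_avg_mono:
  fixes f g :: "complex \<Rightarrow> real"
  assumes "continuous_on circ f" "continuous_on circ g" "\<And>w. w \<in> circ \<Longrightarrow> f w \<le> g w"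
  shows "circle_avg f \<le> circle_avg g"
proof -
  have "integral {0..2*pi} (\<lambda>t. f (cis t)) \<le> integral {0..2*pi} (\<lambda>t. g (cis t))"
    using assms by (intro integral_le circle_avg_integrable) auto
  thus ?thesis by (simp add: circle_avg_def divide_right_mono)
qed

lemma circle_avg_nonneg:
  fixes f :: "complex \<Rightarrow> real"
  assumes "continuous_on circ f" "\<And>w. w \<in> circ \<Longrightarrow> 0 \<le> f w"
  shows "0 \<le> circle_avg f"
  using circle_avg_mono[of "\<lambda>_. 0" f] assms by simp

lemma norm_avg_le:
  assumes "continuous_on circ f"
  shows "norm (circle_avg f) \<le> circle_avg (\<lambda>w. norm (f w))"
proof -
  have "norm (integral {0..2*pi} (\<lambda>t. f (cis t))) \<le> integral {0..2*pi} (\<lambda>t. norm (f (cis t)))"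
    using assms by (intro integral_norm_bound_integral circle_avg_integrable continuous_intros) auto
  thus ?thesis by (simp add: circle_avg_def divide_right_mono)
qed

lemma norm_avg_bound:
  assumes "continuous_on circ f" "continuous_on circ g" "\<And>w. w \<in> circ \<Longrightarrow> norm (f w) \<le> g w"
  shows "norm (circle_avg f) \<le> circle_avg g"
  using norm_avg_le[OF assms(1)] circle_avg_mono[OF continuous_on_norm[OF assms(1)] assms(2,3)]
  by linarith

lemma quadratic_nonneg_imp:
  fixes a b c :: real
  assumes "\<And>t. 0 \<le> a + 2 * t * c + t\<^sup>2 * b"
  shows "c\<^sup>2 \<le> a * b"
proof (cases "b = 0")
  case True
  have "c = 0"
  proof (rule ccontr)
    assume "c \<noteq> 0"
    with assms[of "- (a + 1) / (2 * c)"] True show False by (simp add: field_simps)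
  qed
  with assms[of 0] True show ?thesis by simp
next
  case False
  have "0 \<le> b"
  proof (rule ccontr)
    assume b: "\<not> 0 \<le> b"
    have *: "0 \<le> a + t\<^sup>2 * b" for t
    proof -
      have "0 \<le> a + 2 * (- t) * c + t\<^sup>2 * b" using assms[of "- t"] by (simp only: power2_minus)
      with assms[of t] show ?thesis by (simp add: mult_minus_left mult_minus_right)
    qed
    have a: "0 \<le> a" using *[of 0] by simp
    have "0 \<le> a + (a + 1) / (- b) * b" 
      using *[of "sqrt ((a + 1) / (- b))"] a b by (simp add: divide_nonneg_neg)
    thus False using b by simp
  qed
  with False have "0 < b" by simp
  with assms[of "- c / b"] show ?thesis by (simp add: field_simps power2_eq_square)
qed

lemma circle_avg_cauchy_schwarz:
  fixes f g :: "complex \<Rightarrow> real"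
  assumes "continuous_on circ f" "continuous_on circ g"
  shows "circle_avg (\<lambda>w. f w * g w) \<le> sqrt (circle_avg (\<lambda>w. (f w)\<^sup>2)) * sqrt (circle_avg (\<lambda>w. (g w)\<^sup>2))"
proof -
  have "0 \<le> circle_avg (\<lambda>w. (f w)\<^sup>2) + 2 * t * circle_avg (\<lambda>w. f w * g w) + t\<^sup>2 * circle_avg (\<lambda>w. (g w)\<^sup>2)" for t
  proof -
    have "0 \<le> circle_avg (\<lambda>w. (f w + t * g w)\<^sup>2)"
      using assms by (intro circle_avg_nonneg continuous_intros) auto
    also have "(\<lambda>w. (f w + t * g w)\<^sup>2) = (\<lambda>w. (f w)\<^sup>2 + (2 * t * (f w * g w) + t\<^sup>2 * (g w)\<^sup>2))"
      by (auto simp: power2_eq_square algebra_simps)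
    also have "circle_avg \<dots> = circle_avg (\<lambda>w. (f w)\<^sup>2) + 2 * t * circle_avg (\<lambda>w. f w * g w) + t\<^sup>2 * circle_avg (\<lambda>w. (g w)\<^sup>2)"
      using assms by (simp add: circle_avg_add circle_avg_mult_left continuous_intros)
    finally show ?thesis .
  qed
  from quadratic_nonneg_imp[OF this]
  have "circle_avg (\<lambda>w. f w * g w) \<le> sqrt (circle_avg (\<lambda>w. (f w)\<^sup>2) * circle_avg (\<lambda>w. (g w)\<^sup>2))"
    by (rule real_le_rsqrt)
  thus ?thesis by (simp add: real_sqrt_mult)
qed

lemma circle_avg_powi: "circle_avg (\<lambda>w. w powi p) = (if p = 0 then 1 else 0)"
proof (cases "p = 0")
  case False
  have "((\<lambda>t. cis t powi p) has_integral (cis (of_int p * (2 * pi)) / (\<i> * of_int p) - cis (of_int p * 0) / (\<i> * of_int p))) {0..2*pi}"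
  proof (rule fundamental_theorem_of_calculus)
    fix t :: real
    show "((\<lambda>t. cis (of_int p * t) / (\<i> * of_int p)) has_vector_derivative cis t powi p) (at t within {0..2*pi})"
    proof -
      have "((\<lambda>z. exp (\<i> * of_int p * z) / (\<i> * of_int p)) has_field_derivative exp (\<i> * of_int p * of_real t)) (at (of_real t))"
        using False by (auto intro!: derivative_eq_intros)
      from has_vector_derivative_real_field[OF this]
      moreover have "cis (of_int p * s) = exp (\<i> * of_int p * of_real s)" for s
        by (simp add: cis_conv_exp mult_ac)
      ultimately show ?thesis by (simp add: cis_power_int)
    qed
  qed simp
  moreover have "cis (of_int p * (2 * pi)) = 1"
    by (metis cis_multiple_2pi Ints_of_int mult.commute)
  ultimately have "integral {0..2*pi} (\<lambda>t. cis t powi p) = 0" by (simp add: integral_unique)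
  with False show ?thesis by (simp add: circle_avg_def)
qed simp

lemma continuous_on_powi_circ [continuous_intros]: "continuous_on circ (\<lambda>w. w powi p)"
  by (intro continuous_intros) auto

section \<open>A trigonometric approximate identity\<close>

text \<open>
  Powers of \<open>\<bar>1 + z w\<^sup>*\<bar>\<^sup>2\<close> are trigonometric polynomials concentrating at \<open>w = z\<close>; the central
  binomial coefficient is their mean.
\<close>

definition kernel :: "nat \<Rightarrow> complex \<Rightarrow> complex \<Rightarrow> real" where
  "kernel N z w = cmod (1 + z * cnj w) ^ (2 * N) / real ((2 * N) choose N)"

definition kernel_coeff :: "nat \<Rightarrow> int \<Rightarrow> real" where
  "kernel_coeff N p = real ((2 * N) choose nat (p + int N)) / real ((2 * N) choose N)"

lemma kernel_nonneg [simp]: "0 \<le> kernel N z w"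
  by (simp add: kernel_def)

lemma circ_cnj: "w \<in> circ \<Longrightarrow> cnj w = inverse w"
proof -
  assume w: "w \<in> circ"
  hence "w * cnj w = 1" by (simp flip: complex_norm_square)
  moreover have "w \<noteq> 0" using w by auto
  ultimately show ?thesis by (simp add: field_simps)
qed

lemma kernel_expand:
  assumes "z \<in> circ" "w \<in> circ"
  shows "of_real (kernel N z w) = (\<Sum>p\<in>{-int N..int N}. of_real (kernel_coeff N p) * z powi p * w powi (- p))"
proof -
  define x where "x = z * cnj w"
  have x: "x \<noteq> 0" "cmod x = 1" using assms by (auto simp: x_def norm_mult)
  have "of_real ((cmod (1 + x))\<^sup>2) = (1 + x) * cnj (1 + x)" by (rule complex_norm_square)
  also have "\<dots> = (1 + x)\<^sup>2 / x"
    using x circ_cnj[of x] by (simp add: field_simps power2_eq_square)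
  finally have "of_real (cmod (1 + x) ^ (2 * N)) = ((1 + x)\<^sup>2 / x) ^ N"
    by (metis power_mult of_real_power)
  also have "\<dots> = (x + 1) ^ (2 * N) / x ^ N"
    by (simp add: power_divide power_mult add.commute)
  also have "\<dots> = (\<Sum>k\<le>2*N. of_nat ((2 * N) choose k) * x ^ k / x ^ N)"
    unfolding binomial_ring by (simp add: sum_divide_distrib)
  also have "\<dots> = (\<Sum>p\<in>{-int N..int N}. of_nat ((2 * N) choose nat (p + int N)) * x powi p)"
  proof (rule sum.reindex_bij_witness[where i = "\<lambda>p. nat (p + int N)" and j = "\<lambda>k. int k - int N"])
    fix k assume "k \<in> {..2*N}"
    show "of_nat ((2 * N) choose nat (int k - int N + int N)) * x powi (int k - int N) = of_nat ((2 * N) choose k) * x ^ k / x ^ N"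
      using x by (simp add: power_int_diff)
  qed auto
  finally have *: "of_real (cmod (1 + x) ^ (2 * N)) = (\<Sum>p\<in>{-int N..int N}. of_nat ((2 * N) choose nat (p + int N)) * x powi p)" .
  have xp: "x powi p = z powi p * w powi (- p)" for p
    using assms by (simp add: x_def power_int_mult_distrib circ_cnj power_int_inverse power_int_minus)
  have "complex_of_real (kernel N z w) = of_real (cmod (1 + x) ^ (2 * N)) / of_nat ((2 * N) choose N)"
    by (simp only: kernel_def x_def of_real_divide of_real_of_nat_eq)
  also have "\<dots> = (\<Sum>p\<in>{-int N..int N}. of_real (kernel_coeff N p) * z powi p * w powi (- p))"
    unfolding * xp by (simp add: kernel_coeff_def sum_divide_distrib mult_ac)
  finally show ?thesis .
qed

lemma continuous_on_kernel [continuous_intros]: "continuous_on S (kernel N z)"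
  unfolding kernel_def by (intro continuous_intros) (auto simp: )

lemma kernel_coeff_0 [simp]: "kernel_coeff N 0 = 1"
  by (simp add: kernel_coeff_def)

lemma circle_avg_kernel: 
  assumes "z \<in> circ"
  shows "circle_avg (kernel N z) = 1"
proof -
  have "of_real (circle_avg (kernel N z)) = circle_avg (\<lambda>w. of_real (kernel N z w) :: complex)"
    by (rule circle_avg_linear[symmetric]) (auto intro!: linearI continuous_intros simp: scaleR_conv_of_real)
  also have "\<dots> = circle_avg (\<lambda>w. \<Sum>p\<in>{-int N..int N}. of_real (kernel_coeff N p) * z powi p * w powi (- p))"
    by (intro circle_avg_cong kernel_expand assms)
  also have "\<dots> = (\<Sum>p\<in>{-int N..int N}. of_real (kernel_coeff N p) * z powi p * (if p = 0 then 1 else 0))"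
    by (subst circle_avg_sum) (auto simp: circle_avg_mult_left circle_avg_powi continuous_intros)
  also have "\<dots> = 1" by (simp add: if_distrib cong: if_cong)
  finally show ?thesis using of_real_eq_1_iff by blast
qed

text \<open>
  On the circle \<open>\<bar>1 + z w\<^sup>*\<bar>\<^sup>2 = 4 - \<bar>z - w\<bar>\<^sup>2\<close>, and the central binomial coefficient is at least
  \<open>4\<^sup>N / 2 N\<close>.
\<close>

lemma kernel_le:
  assumes "z \<in> circ" "w \<in> circ" "0 \<le> d" "d \<le> cmod (z - w)" "0 < N"
  shows "kernel N z w \<le> 2 * real N * (1 - d\<^sup>2 / 4) ^ N"
proof -
  have "(cmod (1 + z * cnj w))\<^sup>2 + (cmod (z - w))\<^sup>2 = 4"
  proof -
    have "z - w = w * (z * cnj w - 1)"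
    proof -
      have "w * cnj w = 1" using assms by (simp add: complex_norm_square[symmetric])
      thus ?thesis by (simp add: algebra_simps)
    qed
    hence "cmod (z - w) = cmod (1 - z * cnj w)" using assms by (simp add: norm_mult norm_minus_commute)
    moreover have "(cmod (1 + x))\<^sup>2 + (cmod (1 - x))\<^sup>2 = 2 + 2 * (cmod x)\<^sup>2" for x
      unfolding cmod_power2 by (simp add: power2_eq_square algebra_simps)
    ultimately show ?thesis using assms by (simp add: norm_mult)
  qed
  moreover have "d\<^sup>2 \<le> (cmod (z - w))\<^sup>2" using assms by (intro power_mono) auto
  ultimately have "(cmod (1 + z * cnj w))\<^sup>2 \<le> 4 * (1 - d\<^sup>2 / 4)" by simp
  hence "((cmod (1 + z * cnj w))\<^sup>2) ^ N \<le> (4 * (1 - d\<^sup>2 / 4)) ^ N" by (intro power_mono) auto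
  hence 1: "cmod (1 + z * cnj w) ^ (2 * N) \<le> 4 ^ N * (1 - d\<^sup>2 / 4) ^ N"
    by (simp only: power_mult power_mult_distrib)
  have 2: "4 ^ N / (2 * real N) \<le> real ((2 * N) choose N)"
    using central_binomial_lower_bound[OF assms(5)] by simp
  have "0 \<le> 4 * (1 - d\<^sup>2 / 4)" using \<open>(cmod (1 + z * cnj w))\<^sup>2 \<le> 4 * (1 - d\<^sup>2 / 4)\<close> zero_le_power2 order.trans by blast
  hence "0 \<le> (1 - d\<^sup>2 / 4) ^ N" by (intro zero_le_power) simp
  with 1 2 assms(5) have "kernel N z w \<le> (4 ^ N * (1 - d\<^sup>2 / 4) ^ N) / (4 ^ N / (2 * real N))"
    unfolding kernel_def by (intro frac_le) auto
  thus ?thesis by (simp add: mult_ac)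
qed

lemma kernel_bound:
  assumes "z \<in> circ" "w \<in> circ" "0 < N"
  shows "kernel N z w \<le> 2 * real N"
  using kernel_le[OF assms(1,2) order_refl _ assms(3)] by simp

lemma kernel_small:
  assumes "0 < d" "0 < e"
  shows "\<forall>\<^sub>F N in sequentially. \<forall>z\<in>circ. \<forall>w\<in>circ. d \<le> cmod (z - w) \<longrightarrow> kernel N z w \<le> e"
proof -
  define d' where "d' = min d 1"
  define q where "q = 1 - d'\<^sup>2 / 4"
  have d': "0 < d'" "d' \<le> 1" "d' \<le> d" using assms by (auto simp: d'_def)
  have "d'\<^sup>2 \<le> 1" using d' by (simp add: power_le_one)
  hence q: "0 < q" "q < 1" using d' by (auto simp: q_def)
  have "(\<lambda>N. real N * q ^ N) \<longlonglongrightarrow> 0"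
    using q by (intro powser_times_n_limit_0) auto
  hence "(\<lambda>N. 2 * (real N * q ^ N)) \<longlonglongrightarrow> 2 * 0" by (intro tendsto_intros)
  hence "\<forall>\<^sub>F N in sequentially. 2 * (real N * q ^ N) < e"
    using assms(2) by (intro order_tendstoD(2)) auto
  thus ?thesis
    using eventually_gt_at_top[of 0]
  proof eventually_elim
    case (elim N)
    show ?case
    proof (intro ballI impI)
      fix z w assume "z \<in> circ" "w \<in> circ" "d \<le> cmod (z - w)"
      hence "kernel N z w \<le> 2 * real N * (1 - d'\<^sup>2 / 4) ^ N"
        using d' elim by (intro kernel_le) auto
      with elim show "kernel N z w \<le> e" by (simp add: q_def mult.assoc)
    qed
  qed
qed

definition smooth :: "nat \<Rightarrow> (complex \<Rightarrow> 'b::euclidean_space) \<Rightarrow> complex \<Rightarrow> 'b" where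
  "smooth N f z = circle_avg (\<lambda>w. kernel N z w *\<^sub>R f w)"

lemma smooth_converges:
  assumes f: "continuous_on circ f" and "0 < e"
  shows "\<forall>\<^sub>F N in sequentially. \<forall>z\<in>circ. norm (smooth N f z - f z) \<le> e"
proof -
  have "uniformly_continuous_on circ f"
    using f by (rule compact_uniformly_continuous) simp
  then obtain d where d: "0 < d" "\<And>z w. z \<in> circ \<Longrightarrow> w \<in> circ \<Longrightarrow> dist w z < d \<Longrightarrow> dist (f w) (f z) < e / 2"
    using \<open>0 < e\<close> unfolding uniformly_continuous_on_def by (metis half_gt_zero)
  have "bounded (f ` circ)"
    using compact_continuous_image[OF f] by (simp add: compact_imp_bounded)
  then obtain B where B: "0 < B" "\<And>z. z \<in> circ \<Longrightarrow> norm (f z) \<le> B"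
    by (metis bounded_pos imageI)
  have "\<forall>\<^sub>F N in sequentially. \<forall>z\<in>circ. \<forall>w\<in>circ. d \<le> cmod (z - w) \<longrightarrow> kernel N z w \<le> e / (4 * B)"
    using d B assms by (intro kernel_small) auto
  thus ?thesis
  proof eventually_elim
    case (elim N)
    show ?case
    proof
      fix z assume z: "z \<in> circ"
      have "smooth N f z - f z = circle_avg (\<lambda>w. kernel N z w *\<^sub>R (f w - f z))"
      proof -
        have "circle_avg (\<lambda>w. kernel N z w *\<^sub>R f z) = f z"
          using circle_avg_linear[of "\<lambda>r. r *\<^sub>R f z" "kernel N z"] circle_avg_kernel[OF z, of N]
          by (simp add: linear_scale_left continuous_on_kernel linearI algebra_simps)
        thus ?thesis
          unfolding smooth_def by (simp add: scaleR_diff_right circle_avg_diff continuous_intros f)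
      qed
      also have "norm \<dots> \<le> circle_avg (\<lambda>w. kernel N z w * (e / 2) + e / 2)"
      proof (rule norm_avg_bound)
        fix w assume w: "w \<in> circ"
        show "norm (kernel N z w *\<^sub>R (f w - f z)) \<le> kernel N z w * (e / 2) + e / 2"
        proof (cases "d \<le> cmod (z - w)")
          case True
          have "norm (f w - f z) \<le> 2 * B" using B(2)[OF z] B(2)[OF w] norm_triangle_ineq4[of "f w" "f z"] by linarith
          hence "kernel N z w * norm (f w - f z) \<le> e / (4 * B) * (2 * B)"
            using elim z w True B \<open>0 < e\<close> by (intro mult_mono) auto
          also have "\<dots> = e / 2" using B by simp
          finally show ?thesis using \<open>0 < e\<close> by (simp add: add_increasing)
        next
          case False
          hence "norm (f w - f z) \<le> e / 2"
            using d(2)[OF z w] by (simp add: dist_norm norm_minus_commute)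
          hence "kernel N z w * norm (f w - f z) \<le> kernel N z w * (e / 2)" by (intro mult_left_mono) auto
          thus ?thesis using \<open>0 < e\<close> by simp
        qed
      qed (intro continuous_intros f)+
      also have "\<dots> = circle_avg (kernel N z) * (e / 2) + e / 2"
        using circle_avg_mult_left[of "kernel N z" "e / 2"] 
        by (simp add: circle_avg_add continuous_intros mult.commute)
      also have "\<dots> = e" using circle_avg_kernel[OF z] by simp
      finally show "norm (smooth N f z - f z) \<le> e" .
    qed
  qed
qed

lemma smooth_fourier:
  fixes f :: "complex \<Rightarrow> complex"
  assumes "continuous_on circ f" "z \<in> circ"
  shows "smooth N f z = (\<Sum>p\<in>{-int N..int N}. of_real (kernel_coeff N p) * z powi p * circle_avg (\<lambda>w. w powi (- p) * f w))"
proof -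
  have "smooth N f z = circle_avg (\<lambda>w. \<Sum>p\<in>{-int N..int N}. (of_real (kernel_coeff N p) * z powi p) * (w powi (- p) * f w))"
    unfolding smooth_def
    by (intro circle_avg_cong) (simp only: scaleR_conv_of_real kernel_expand[OF assms(2)] sum_distrib_right mult.assoc)
  also have "\<dots> = (\<Sum>p\<in>{-int N..int N}. (of_real (kernel_coeff N p) * z powi p) * circle_avg (\<lambda>w. w powi (- p) * f w))"
  proof (subst circle_avg_sum)
    have "continuous_on circ (\<lambda>w. w powi (- p) * f w)" for p
      by (intro continuous_on_mult continuous_on_powi_circ assms)
    thus "(\<Sum>p\<in>{-int N..int N}. circle_avg (\<lambda>w. (of_real (kernel_coeff N p) * z powi p) * (w powi (- p) * f w)))
        = (\<Sum>p\<in>{-int N..int N}. (of_real (kernel_coeff N p) * z powi p) * circle_avg (\<lambda>w. w powi (- p) * f w))"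
      by (intro sum.cong refl circle_avg_mult_left)
  qed (intro continuous_on_mult continuous_on_const continuous_on_powi_circ assms finite_atLeastAtMost_int)+
  finally show ?thesis .
qed

section \<open>Matrix functions in the Hardy class\<close>

lemma mm_diff_left: "(A - B) ** C = A ** C - B ** C" for C :: "complex^'n^'m"
  by (simp add: vec_eq_iff mm_nth left_diff_distrib sum_subtractf)

lemma mm_diff_right: "C ** (A - B) = C ** A - C ** B" for C :: "complex^'n^'m"
  by (simp add: vec_eq_iff mm_nth right_diff_distrib sum_subtractf)

lemma mm_add_left: "(A + B) ** C = A ** C + B ** C" for C :: "complex^'n^'m"
  by (simp add: vec_eq_iff mm_nth distrib_right sum.distrib)

lemma mm_add_right: "C ** (A + B) = C ** A + C ** B" for C :: "complex^'n^'m"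
  by (simp add: vec_eq_iff mm_nth distrib_left sum.distrib)

lemma mm_scaleR_left: "(r *\<^sub>R A) ** C = r *\<^sub>R (A ** C)" for C :: "complex^'n^'m"
  by (simp add: vec_eq_iff mm_nth scaleR_sum_right)

lemma mm_scaleR_right: "C ** (r *\<^sub>R A) = r *\<^sub>R (C ** A)" for C :: "complex^'n^'m"
  by (simp add: vec_eq_iff mm_nth scaleR_sum_right)

lemma linear_mm_left: "linear (\<lambda>X. E ** X)" for E :: "complex^'n^'m"
  by (rule linearI) (simp_all add: mm_add_right mm_scaleR_right)

lemma linear_mm_right: "linear (\<lambda>X. X ** E)" for E :: "complex^'n^'m"
  by (rule linearI) (simp_all add: mm_add_left mm_scaleR_left)

lemma linear_adj: "linear adj"
  by (rule linearI) (simp_all add: vec_eq_iff)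

lemma linear_mv_left: "linear (\<lambda>M. M *v u)" for u :: "complex^'n"
  by (rule linearI) (simp_all add: matrix_vector_mult_add_rdistrib scaleR_mv)

lemma linear_entry: "linear (\<lambda>M. M $ i $ j)"
  by (rule linearI) simp_all

lemma adj_diff: "adj (A - B) = adj A - adj B"
  by (simp add: vec_eq_iff)

lemma cscale_diff: "cscale c (A - B) = cscale c A - cscale c B"
  by (simp add: vec_eq_iff algebra_simps)

lemma cscale_add: "cscale c (A + B) = cscale c A + cscale c B"
  by (simp add: vec_eq_iff algebra_simps)

lemma cscale_0 [simp]: "cscale c 0 = 0" "cscale 0 A = 0"
  by (simp_all add: vec_eq_iff)

lemma cscale_scaleR: "cscale c (r *\<^sub>R A) = r *\<^sub>R cscale c A"
  by (simp add: vec_eq_iff)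

lemma continuous_on_mm [continuous_intros]:
  fixes f :: "'a::topological_space \<Rightarrow> complex^'n^'m" and g :: "'a \<Rightarrow> complex^'k^'n"
  assumes "continuous_on S f" "continuous_on S g"
  shows "continuous_on S (\<lambda>x. f x ** g x)"
  unfolding matrix_matrix_mult_def by (intro continuous_intros assms)

lemma continuous_on_adj [continuous_intros]:
  assumes "continuous_on S f"
  shows "continuous_on S (\<lambda>x. adj (f x))"
  unfolding adj_def by (intro continuous_intros assms)

lemma continuous_on_cscale [continuous_intros]:
  assumes "continuous_on S c" "continuous_on S f"
  shows "continuous_on S (\<lambda>x. cscale (c x) (f x))"
  unfolding cscale_def by (intro continuous_intros assms)

lemma continuous_on_mv [continuous_intros]:
  fixes f :: "'a::topological_space \<Rightarrow> complex^'n^'m"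
  assumes "continuous_on S f" "continuous_on S g"
  shows "continuous_on S (\<lambda>x. f x *v g x)"
  unfolding matrix_vector_mult_def by (intro continuous_intros assms)

lemma continuous_on_det [continuous_intros]:
  fixes f :: "'a::topological_space \<Rightarrow> complex^'n^'n"
  assumes "continuous_on S f"
  shows "continuous_on S (\<lambda>x. det (f x))"
  unfolding det_def by (intro continuous_intros assms)

lemma circle_avg_entry:
  fixes f :: "complex \<Rightarrow> complex^'n^'m"
  assumes "continuous_on circ f"
  shows "circle_avg f $ i $ j = circle_avg (\<lambda>w. f w $ i $ j)"
  using circle_avg_linear[OF linear_entry assms, of i j] by simp

lemma sum_entry: "(\<Sum>i\<in>I. f i) $ k $ l = (\<Sum>i\<in>I. f i $ k $ l)"
  by (simp add: sum_component)

lemma smooth_fourier_matrix: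
  fixes F :: "complex \<Rightarrow> complex^'n^'m"
  assumes F: "continuous_on circ F" and z: "z \<in> circ"
  shows "smooth N F z = (\<Sum>p\<in>{-int N..int N}. cscale (of_real (kernel_coeff N p) * z powi p) (circle_avg (\<lambda>w. cscale (w powi (- p)) (F w))))"
proof -
  have "smooth N F z $ i $ j = (\<Sum>p\<in>{-int N..int N}. cscale (of_real (kernel_coeff N p) * z powi p) (circle_avg (\<lambda>w. cscale (w powi (- p)) (F w)))) $ i $ j" for i j
  proof -
    have "smooth N F z $ i $ j = smooth N (\<lambda>w. F w $ i $ j) z"
      unfolding smooth_def by (subst circle_avg_entry) (auto intro!: continuous_intros F)
    also have "\<dots> = (\<Sum>p\<in>{-int N..int N}. of_real (kernel_coeff N p) * z powi p * circle_avg (\<lambda>w. w powi (- p) * F w $ i $ j))"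
      by (intro smooth_fourier z continuous_intros F)
    also have "\<dots> = (\<Sum>p\<in>{-int N..int N}. cscale (of_real (kernel_coeff N p) * z powi p) (circle_avg (\<lambda>w. cscale (w powi (- p)) (F w))) $ i $ j)"
      by (intro sum.cong refl) (subst cscale_nth, subst circle_avg_entry, auto intro!: continuous_on_cscale continuous_on_powi_circ F)
    finally show ?thesis by (simp only: sum_entry)
  qed
  thus ?thesis by (simp add: vec_eq_iff)
qed

text \<open>
  Boundary values of holomorphic functions, recognised by the vanishing of their negative Fourier
  coefficients; the value at \<open>0\<close> is then the mean.
\<close>

definition hardy :: "(complex \<Rightarrow> complex^'n^'n) \<Rightarrow> bool" where
  "hardy F \<longleftrightarrow> continuous_on circ F \<and> (\<forall>m>0. circle_avg (\<lambda>w. cscale (w powi m) (F w)) = 0)"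

lemma hardy_cont: "hardy F \<Longrightarrow> continuous_on circ F"
  by (simp add: hardy_def)

lemma hardy_linear:
  assumes F: "hardy F" and L: "linear L" "\<And>c M. L (cscale c M) = cscale c (L M)"
  shows "hardy (\<lambda>w. L (F w))"
proof -
  have "circle_avg (\<lambda>w. cscale (w powi m) (L (F w))) = L (circle_avg (\<lambda>w. cscale (w powi m) (F w)))" for m
    unfolding L(2)[symmetric] by (intro circle_avg_linear L continuous_intros hardy_cont F)
  moreover have "continuous_on circ (\<lambda>w. L (F w))"
    by (rule linear_continuous_on_compose[OF hardy_cont[OF F] L(1)])
  ultimately show ?thesis
    using F L(1) by (simp add: hardy_def linear_0)
qed

lemma hardy_const: "hardy (\<lambda>w. M)"
proof -
  have "circle_avg (\<lambda>w. cscale (w powi m) M) = cscale (circle_avg (\<lambda>w. w powi m)) M" for m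
    by (rule circle_avg_linear) (auto intro!: linearI continuous_intros simp: vec_eq_iff algebra_simps)
  thus ?thesis by (auto simp: hardy_def circle_avg_powi)
qed

lemma hardy_add:
  assumes "hardy F" "hardy G"
  shows "hardy (\<lambda>w. F w + G w)"
  using assms by (auto simp: hardy_def cscale_add circle_avg_add continuous_on_cscale continuous_on_powi_circ continuous_on_add)

lemma hardy_shift:
  assumes F: "hardy F" and "0 \<le> m"
  shows "hardy (\<lambda>w. cscale (w powi m) (F w))"
proof -
  have "circle_avg (\<lambda>w. cscale (w powi k) (cscale (w powi m) (F w))) = circle_avg (\<lambda>w. cscale (w powi (k + m)) (F w))" for k
  proof (rule circle_avg_cong)
    fix w :: complex assume "w \<in> circ"
    hence "w \<noteq> 0" by auto
    thus "cscale (w powi k) (cscale (w powi m) (F w)) = cscale (w powi (k + m)) (F w)"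
      by (simp add: cscale_cscale power_int_add)
  qed
  thus ?thesis
    using assms by (auto simp: hardy_def continuous_on_cscale continuous_on_powi_circ)
qed

lemma hardy_shift_circle_avg:
  assumes "hardy F" "0 < m"
  shows "circle_avg (\<lambda>w. cscale (w powi m) (F w)) = 0"
  using assms by (simp add: hardy_def)

lemma hardy_mult_left: "hardy F \<Longrightarrow> hardy (\<lambda>w. E ** F w)"
  by (rule hardy_linear) (auto simp: linear_mm_left cscale_mult_right)

lemma hardy_scaleR: "hardy F \<Longrightarrow> hardy (\<lambda>w. r *\<^sub>R F w)"
  by (rule hardy_linear) (auto simp: cscale_scaleR linearI algebra_simps)

lemma hardy_diff: "hardy F \<Longrightarrow> hardy G \<Longrightarrow> hardy (\<lambda>w. F w - G w)"
  using hardy_add[of F "\<lambda>w. (- 1) *\<^sub>R G w"] hardy_scaleR[of G "-1"] by simp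

text \<open>
  Cramer's rule shows that the inverse depends continuously on the matrix.
\<close>

lemma inverse_family:
  fixes A :: "complex \<Rightarrow> complex^'n^'n"
  assumes A: "continuous_on S A" and d: "\<And>w. w \<in> S \<Longrightarrow> det (A w) \<noteq> 0"
  obtains B where "continuous_on S B" "\<And>w. w \<in> S \<Longrightarrow> A w ** B w = mat 1" "\<And>w. w \<in> S \<Longrightarrow> B w ** A w = mat 1"
proof
  define B :: "complex \<Rightarrow> complex^'n^'n" where
    "B w = (\<chi> k l. det (\<chi> i j. if j = k then axis l 1 $ i else A w $ i $ j) / det (A w))" for w
  show "continuous_on S B"
  proof -
    have "continuous_on S (\<lambda>w. if j = k then axis l 1 $ i else A w $ i $ j)" for i j k l
      by (cases "j = k") (simp_all add: continuous_on_component A)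
    hence "continuous_on S (\<lambda>w. det ((\<chi> i j. if j = k then axis l 1 $ i else A w $ i $ j) :: complex^'n^'n))" for k l
      by (intro continuous_on_det continuous_on_vec_lambda)
    hence "continuous_on S (\<lambda>w. det ((\<chi> i j. if j = k then axis l 1 $ i else A w $ i $ j) :: complex^'n^'n) / det (A w))" for k l
      using d by (intro continuous_on_divide continuous_on_det[OF A]) auto
    thus ?thesis unfolding B_def by (intro continuous_on_vec_lambda)
  qed
  show 1: "A w ** B w = mat 1" if "w \<in> S" for w
  proof -
    have "A w *v (\<chi> k. B w $ k $ l) = axis l 1" for l
      using cramer[OF d[OF that], of "\<chi> k. B w $ k $ l" "axis l 1"] by (simp add: B_def vec_eq_iff)
    hence "(A w *v (\<chi> k. B w $ k $ l)) $ i = axis l 1 $ i" for i l by simp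
    thus ?thesis
      by (auto simp: vec_eq_iff mm_nth matrix_vector_mult_def mat_def axis_def)
  qed
  show "B w ** A w = mat 1" if "w \<in> S" for w
    using 1[OF that] by (simp add: matrix_left_right_inverse)
qed

lemma norm_diff_sq_parallelogram:
  "(norm (x - y))\<^sup>2 = 2 * (norm x)\<^sup>2 + 2 * (norm y)\<^sup>2 - 4 * (norm ((1/2) *\<^sub>R (x + y)))\<^sup>2"
  for x y :: "'a::real_inner"
  by (simp add: power2_norm_eq_inner inner_simps inner_commute algebra_simps)

lemma circle_avg_linear_combination:
  fixes f g h :: "complex \<Rightarrow> real"
  assumes "continuous_on circ f" "continuous_on circ g" "continuous_on circ h"
  shows "circle_avg (\<lambda>w. a * f w + b * g w + c * h w) = a * circle_avg f + b * circle_avg g + c * circle_avg h"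
  using assms by (simp add: circle_avg_add circle_avg_mult_left continuous_on_mult_left continuous_on_add)

locale circle_frame =
  fixes A :: "complex \<Rightarrow> complex^'n^'n"
  assumes cont: "continuous_on circ A"
    and det_nz: "\<And>w. w \<in> circ \<Longrightarrow> det (A w) \<noteq> 0"
begin

definition energy :: "(complex \<Rightarrow> complex^'n^'n) \<Rightarrow> real" where
  "energy F = circle_avg (\<lambda>w. (norm (F w ** A w))\<^sup>2)"

definition min_energy :: real where
  "min_energy = Inf (energy ` {F. hardy F \<and> circle_avg F = mat 1})"

definition near :: "real \<Rightarrow> (complex \<Rightarrow> complex^'n^'n) \<Rightarrow> bool" where
  "near d F \<longleftrightarrow> hardy F \<and> circle_avg F = mat 1 \<and> energy F \<le> min_energy + d"

lemma energy_nonneg: "continuous_on circ F \<Longrightarrow> 0 \<le> energy F"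
  unfolding energy_def by (intro circle_avg_nonneg continuous_intros cont) auto

lemma min_energy_le: "hardy F \<Longrightarrow> circle_avg F = mat 1 \<Longrightarrow> min_energy \<le> energy F"
  unfolding min_energy_def
  by (intro cINF_lower bdd_belowI2[where m = 0]) (auto intro: energy_nonneg hardy_cont)

lemma near_exists:
  assumes "0 < d"
  shows "\<exists>F. near d F"
proof -
  have "energy ` {F. hardy F \<and> circle_avg F = mat 1} \<noteq> {}"
    using hardy_const[of "mat 1"] by force
  moreover have "min_energy < min_energy + d" using assms by simp
  ultimately have "\<exists>x\<in>energy ` {F. hardy F \<and> circle_avg F = mat 1}. x < min_energy + d"
    unfolding min_energy_def by (intro cInf_lessD)
  thus ?thesis by (force simp: near_def)
qed

lemma min_energy_nonneg: "0 \<le> min_energy"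
  unfolding min_energy_def 
  by (rule cINF_greatest) (use hardy_const[of "mat 1"] in \<open>auto intro: energy_nonneg hardy_cont\<close>)

text \<open>
  The midpoint of two near-minimisers is admissible, so the parallelogram law bounds their
  distance.
\<close>

lemma near_close:
  assumes "near d F" "near d G"
  shows "energy (\<lambda>w. F w - G w) \<le> 4 * d"
proof -
  have c: "continuous_on circ F" "continuous_on circ G" using assms by (auto simp: near_def hardy_def)
  let ?H = "\<lambda>w. (1/2) *\<^sub>R (F w + G w)"
  have "circle_avg ?H = mat 1"
    using assms c by (subst circle_avg_scaleR) (auto simp: circle_avg_add near_def continuous_on_add simp flip: scaleR_2)
  moreover have "hardy ?H" using assms by (intro hardy_scaleR hardy_add) (auto simp: near_def)
  ultimately have H: "min_energy \<le> energy ?H" by (intro min_energy_le)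
  have "energy (\<lambda>w. F w - G w) = circle_avg (\<lambda>w. 2 * (norm (F w ** A w))\<^sup>2 + 2 * (norm (G w ** A w))\<^sup>2 + (- 4) * (norm (?H w ** A w))\<^sup>2)"
    unfolding energy_def
    by (intro circle_avg_cong) (simp add: mm_diff_left mm_scaleR_left mm_add_left norm_diff_sq_parallelogram del: norm_scaleR)
  also have "\<dots> = 2 * energy F + 2 * energy G - 4 * energy ?H"
    unfolding energy_def by (subst circle_avg_linear_combination) (auto intro!: continuous_intros c cont)
  also have "\<dots> \<le> 4 * d" using assms H by (simp add: near_def)
  finally show ?thesis .
qed

text \<open>
  The energy of \<open>F + t Q\<close> is a quadratic polynomial in \<open>t\<close> that stays above \<open>energy F - d\<close>.
\<close>

lemma first_variation_real:
  assumes F: "near d F" and Q: "hardy Q" "circle_avg Q = 0"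
  shows "(circle_avg (\<lambda>w. inner (Q w ** A w) (F w ** A w)))\<^sup>2 \<le> d * energy Q"
proof (rule quadratic_nonneg_imp)
  fix t :: real
  have c: "continuous_on circ F" "continuous_on circ Q" using F Q by (auto simp: near_def hardy_def)
  let ?H = "\<lambda>w. F w + t *\<^sub>R Q w"
  have "circle_avg ?H = mat 1"
    using F Q c by (simp add: circle_avg_add circle_avg_scaleR near_def continuous_intros)
  moreover have "hardy ?H" using F Q by (intro hardy_scaleR hardy_add) (auto simp: near_def)
  ultimately have H: "min_energy \<le> energy ?H" by (intro min_energy_le)
  have "energy ?H = circle_avg (\<lambda>w. 1 * (norm (F w ** A w))\<^sup>2 + (2 * t) * inner (Q w ** A w) (F w ** A w) + t\<^sup>2 * (norm (Q w ** A w))\<^sup>2)"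
    unfolding energy_def
    by (intro circle_avg_cong) (simp add: mm_scaleR_left mm_add_left power2_norm_eq_inner inner_simps inner_commute del: norm_scaleR,
        simp add: power2_eq_square algebra_simps)
  also have "\<dots> = energy F + 2 * t * circle_avg (\<lambda>w. inner (Q w ** A w) (F w ** A w)) + t\<^sup>2 * energy Q"
    unfolding energy_def by (subst circle_avg_linear_combination) (auto intro!: continuous_intros c cont)
  finally show "0 \<le> d + 2 * t * circle_avg (\<lambda>w. inner (Q w ** A w) (F w ** A w)) + t\<^sup>2 * energy Q"
    using H F by (simp add: near_def)
qed

text \<open>
  The matrix form follows by testing with \<open>M Q\<close>, where \<open>M\<close> is the matrix to be estimated.
\<close>

lemma first_variation:
  assumes F: "near d F" and Q: "hardy Q" "circle_avg Q = 0"
  shows "norm (circle_avg (\<lambda>w. (F w ** A w) ** adj (Q w ** A w))) \<le> sqrt (d * energy Q)"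
proof -
  define M where "M = circle_avg (\<lambda>w. (F w ** A w) ** adj (Q w ** A w))"
  have c: "continuous_on circ F" "continuous_on circ Q" using F Q by (auto simp: near_def hardy_def)
  have "circle_avg (\<lambda>w. inner ((M ** Q w) ** A w) (F w ** A w)) = circle_avg (\<lambda>w. inner M ((F w ** A w) ** adj (Q w ** A w)))"
    by (intro circle_avg_cong) (simp add: inner_mult_left adj_mult matrix_mul_assoc)
  also have "\<dots> = inner M M"
    unfolding M_def by (rule circle_avg_linear) (auto intro!: linearI continuous_intros c cont simp: inner_simps)
  finally have "(inner M M)\<^sup>2 \<le> d * energy (\<lambda>w. M ** Q w)"
    using first_variation_real[OF F hardy_mult_left[OF Q(1), of M]] circle_avg_linear[OF linear_mm_left c(2), of M] Q(2)
    by (simp add: linear_0[OF linear_mm_left])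
  also have "\<dots> \<le> d * ((norm M)\<^sup>2 * energy Q)"
  proof -
    have "0 \<le> d" using min_energy_le[of F] F by (simp add: near_def)
    moreover have "energy (\<lambda>w. M ** Q w) \<le> circle_avg (\<lambda>w. (norm M)\<^sup>2 * (norm (Q w ** A w))\<^sup>2)"
      unfolding energy_def
    proof (rule circle_avg_mono)
      fix w show "(norm (M ** Q w ** A w))\<^sup>2 \<le> (norm M)\<^sup>2 * (norm (Q w ** A w))\<^sup>2"
        unfolding matrix_mul_assoc[symmetric] power_mult_distrib[symmetric] by (intro power_mono norm_mm) auto
    qed (intro continuous_intros c cont)+
    moreover have "circle_avg (\<lambda>w. (norm M)\<^sup>2 * (norm (Q w ** A w))\<^sup>2) = (norm M)\<^sup>2 * energy Q"
      unfolding energy_def by (intro circle_avg_mult_left continuous_intros c cont)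
    ultimately show ?thesis by (intro mult_left_mono) auto
  qed
  finally have *: "(norm M)\<^sup>2 * (norm M)\<^sup>2 \<le> (norm M)\<^sup>2 * (d * energy Q)"
    by (simp add: power2_norm_eq_inner[symmetric] mult_ac) (simp add: power2_eq_square mult_ac)?
  have "(norm M)\<^sup>2 \<le> d * energy Q"
  proof (cases "M = 0")
    case True
    have "0 \<le> d" using min_energy_le[of F] F by (simp add: near_def)
    with True show ?thesis by (simp add: energy_nonneg c)
  next
    case False
    hence "0 < (norm M)\<^sup>2" by simp
    with * show ?thesis by (rule mult_left_le_imp_le)
  qed
  thus ?thesis unfolding M_def[symmetric] by (rule real_le_rsqrt)
qed

end

section \<open>Convergence in the mean from Fourier coefficients\<close>

lemma cnj_powi_circ: "w \<in> circ \<Longrightarrow> cnj w powi p = w powi (- p)"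
  by (simp only: circ_cnj power_int_minus power_int_inverse)

lemma circle_avg_square_le: "continuous_on circ f \<Longrightarrow> (circle_avg f)\<^sup>2 \<le> circle_avg (\<lambda>w. (f w)\<^sup>2)" for f :: "complex \<Rightarrow> real"
proof -
  assume f: "continuous_on circ f"
  have "0 \<le> circle_avg (\<lambda>w. (f w - circle_avg f)\<^sup>2)"
    by (intro circle_avg_nonneg continuous_intros f) auto
  also have "\<dots> = circle_avg (\<lambda>w. 1 * (f w)\<^sup>2 + (- 2 * circle_avg f) * f w + (circle_avg f)\<^sup>2 * 1)"
    by (intro circle_avg_cong) (simp add: power2_eq_square algebra_simps)
  also have "\<dots> = 1 * circle_avg (\<lambda>w. (f w)\<^sup>2) + (- 2 * circle_avg f) * circle_avg f + (circle_avg f)\<^sup>2 * circle_avg (\<lambda>w. 1)"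
    by (intro circle_avg_linear_combination continuous_intros f)
  finally show ?thesis by (simp add: power2_eq_square)
qed

lemma continuous_on_smooth:
  fixes g :: "complex \<Rightarrow> complex^'n^'m"
  assumes g: "continuous_on circ g"
  shows "continuous_on circ (smooth N g)"
proof -
  have "continuous_on circ (\<lambda>z. \<Sum>p\<in>{-int N..int N}. cscale (of_real (kernel_coeff N p) * z powi p) (circle_avg (\<lambda>w. cscale (w powi (- p)) (g w))))"
    by (intro continuous_on_sum continuous_on_cscale continuous_on_mult_left continuous_on_powi_circ continuous_on_const)
  thus ?thesis by (subst continuous_on_cong[OF refl smooth_fourier_matrix[OF g]])
qed

lemma circle_avg_inner_smooth_tendsto:
  fixes D :: "nat \<Rightarrow> complex \<Rightarrow> complex^'n^'n"
  assumes g: "continuous_on circ g" and D: "\<And>k. continuous_on circ (D k)"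
    and lim: "\<And>p. (\<lambda>k. circle_avg (\<lambda>w. cscale (w powi p) (D k w))) \<longlonglongrightarrow> 0"
  shows "(\<lambda>k. circle_avg (\<lambda>w. inner (smooth N g w) (D k w))) \<longlonglongrightarrow> 0"
proof -
  define M where "M p = circle_avg (\<lambda>w. cscale (w powi (- p)) (g w))" for p
  have "circle_avg (\<lambda>w. inner (smooth N g w) (D k w)) =
      (\<Sum>p\<in>{-int N..int N}. kernel_coeff N p * inner (M p) (circle_avg (\<lambda>w. cscale (w powi (- p)) (D k w))))" for k
  proof -
    have "circle_avg (\<lambda>w. inner (smooth N g w) (D k w)) =
        circle_avg (\<lambda>w. \<Sum>p\<in>{-int N..int N}. kernel_coeff N p * inner (M p) (cscale (w powi (- p)) (D k w)))"
    proof (rule circle_avg_cong)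
      fix w assume w: "w \<in> circ"
      have "inner (cscale (of_real (kernel_coeff N p) * w powi p) (M p)) (D k w) = kernel_coeff N p * inner (M p) (cscale (w powi (- p)) (D k w))" for p
        using w by (simp add: inner_cscale cnj_powi_circ cscale_cscale[symmetric] cscale_of_real)
      thus "inner (smooth N g w) (D k w) = (\<Sum>p\<in>{-int N..int N}. kernel_coeff N p * inner (M p) (cscale (w powi (- p)) (D k w)))"
        by (simp add: smooth_fourier_matrix[OF g w] inner_sum_left M_def)
    qed
    also have "\<dots> = (\<Sum>p\<in>{-int N..int N}. circle_avg (\<lambda>w. kernel_coeff N p * inner (M p) (cscale (w powi (- p)) (D k w))))"
      by (rule circle_avg_sum) (auto intro!: continuous_on_mult_left continuous_on_inner continuous_on_const continuous_on_cscale continuous_on_powi_circ D)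
    also have "\<dots> = (\<Sum>p\<in>{-int N..int N}. kernel_coeff N p * inner (M p) (circle_avg (\<lambda>w. cscale (w powi (- p)) (D k w))))"
    proof (rule sum.cong)
      fix p
      show "circle_avg (\<lambda>w. kernel_coeff N p * inner (M p) (cscale (w powi (- p)) (D k w))) = kernel_coeff N p * inner (M p) (circle_avg (\<lambda>w. cscale (w powi (- p)) (D k w)))"
        by (rule circle_avg_linear[of "\<lambda>X. kernel_coeff N p * inner (M p) X"])
           (auto intro!: linearI continuous_on_cscale continuous_on_powi_circ D simp: inner_simps algebra_simps)
    qed simp
    finally show ?thesis .
  qed
  moreover have "(\<lambda>k. \<Sum>p\<in>{-int N..int N}. kernel_coeff N p * inner (M p) (circle_avg (\<lambda>w. cscale (w powi (- p)) (D k w)))) \<longlonglongrightarrow>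
      (\<Sum>p\<in>{-int N..int N}. kernel_coeff N p * inner (M p) 0)"
    by (intro tendsto_intros lim)
  ultimately show ?thesis by simp
qed

lemma circle_avg_cscale_const: "circle_avg (\<lambda>w. cscale (w powi p) M) = (if p = 0 then M else 0)"
proof -
  have "circle_avg (\<lambda>w. cscale (w powi p) M) = cscale (circle_avg (\<lambda>w. w powi p)) M"
    by (rule circle_avg_linear) (auto intro!: linearI continuous_intros simp: vec_eq_iff algebra_simps)
  thus ?thesis by (simp add: circle_avg_powi)
qed

text \<open>
  Fourier coefficients alone only give weak convergence. Strong convergence follows because the
  sequence is Cauchy in the mean: the distance to the limit \<open>C\<close> is measured by a bounded continuous
  function, essentially the sign of the difference, and by the Cauchy property it may be tested at
  a much later index, where the weak convergence takes effect.
\<close>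

lemma L1_limit_of_fourier:
  fixes \<Phi> :: "nat \<Rightarrow> complex \<Rightarrow> complex^'n^'n"
  assumes cont: "\<And>k. continuous_on circ (\<Phi> k)"
    and cauchy: "\<And>e. 0 < e \<Longrightarrow> \<exists>K. \<forall>k\<ge>K. \<forall>l\<ge>K. circle_avg (\<lambda>w. norm (\<Phi> k w - \<Phi> l w)) \<le> e"
    and bnd: "\<And>k. circle_avg (\<lambda>w. norm (\<Phi> k w)) \<le> R"
    and lim0: "(\<lambda>k. circle_avg (\<Phi> k)) \<longlonglongrightarrow> C"
    and lim: "\<And>p. p \<noteq> 0 \<Longrightarrow> (\<lambda>k. circle_avg (\<lambda>w. cscale (w powi p) (\<Phi> k w))) \<longlonglongrightarrow> 0"
  shows "(\<lambda>k. circle_avg (\<lambda>w. norm (\<Phi> k w - C))) \<longlonglongrightarrow> 0"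
proof (rule LIMSEQ_I)
  fix r :: real assume "0 < r"
  define e where "e = r / 5"
  have e: "0 < e" using \<open>0 < r\<close> by (simp add: e_def)
  define D where "D k w = \<Phi> k w - C" for k w
  have cD [continuous_intros]: "continuous_on circ (D k)" for k
    unfolding D_def by (intro continuous_intros cont)
  have limD: "(\<lambda>k. circle_avg (\<lambda>w. cscale (w powi p) (D k w))) \<longlonglongrightarrow> 0" for p
  proof -
    have eq: "circle_avg (\<lambda>w. cscale (w powi p) (D k w)) = circle_avg (\<lambda>w. cscale (w powi p) (\<Phi> k w)) - (if p = 0 then C else 0)" for k
      unfolding D_def cscale_diff
      by (subst circle_avg_diff) (auto intro!: continuous_on_cscale continuous_on_powi_circ continuous_on_const cont simp: circle_avg_cscale_const)
    show ?thesis
    proof (cases "p = 0")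
      case True
      have "(\<lambda>k. circle_avg (\<Phi> k) - C) \<longlonglongrightarrow> C - C" by (intro tendsto_intros lim0)
      thus ?thesis unfolding eq using True by simp
    qed (use lim eq in simp)
  qed
  define B where "B = \<bar>R\<bar> + norm C + 1"
  have B: "0 < B" by (simp add: B_def add_nonneg_pos)
  have bD: "circle_avg (\<lambda>w. norm (D k w)) \<le> B" for k
  proof -
    have "circle_avg (\<lambda>w. norm (D k w)) \<le> circle_avg (\<lambda>w. norm (\<Phi> k w) + norm C)"
      unfolding D_def by (intro circle_avg_mono continuous_intros cont norm_triangle_ineq4)
    also have "\<dots> = circle_avg (\<lambda>w. norm (\<Phi> k w)) + norm C"
      by (simp add: circle_avg_add continuous_on_norm cont)
    finally show ?thesis using bnd[of k] by (simp add: B_def)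
  qed
  obtain K where K: "\<And>k l. K \<le> k \<Longrightarrow> K \<le> l \<Longrightarrow> circle_avg (\<lambda>w. norm (\<Phi> k w - \<Phi> l w)) \<le> e"
    using cauchy[OF e] by blast
  have bound: "circle_avg (\<lambda>w. norm (D j w)) \<le> 4 * e" if j: "K \<le> j" for j
  proof -
    \<comment> \<open>A continuous substitute for the sign of \<open>D j\<close>.\<close>
    define g where "g w = (1 / (e + norm (D j w))) *\<^sub>R D j w" for w
    have ne: "0 < e + norm (D j w)" for w using e by (simp add: add_pos_nonneg)
    have g [continuous_intros]: "continuous_on circ g"
      unfolding g_def using ne by (intro continuous_intros) (metis less_irrefl)
    have gn: "norm (g w) \<le> 1" for w
      using ne[of w] e by (simp add: g_def divide_simps)
    have gD: "norm (D j w) - e \<le> inner (g w) (D j w)" for w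
    proof -
      have "inner (g w) (D j w) = (norm (D j w))\<^sup>2 / (e + norm (D j w))"
        by (simp add: g_def power2_norm_eq_inner)
      moreover have "(norm (D j w) - e) * (e + norm (D j w)) \<le> (norm (D j w))\<^sup>2"
        by (simp add: power2_eq_square algebra_simps)
      ultimately show ?thesis using ne[of w] by (simp add: pos_le_divide_eq)
    qed
    have "\<forall>\<^sub>F N in sequentially. \<forall>z\<in>circ. norm (smooth N g z - g z) \<le> e / B"
      using e B by (intro smooth_converges g) simp
    then obtain N where "\<forall>n\<ge>N. \<forall>z\<in>circ. norm (smooth n g z - g z) \<le> e / B"
      unfolding eventually_sequentially by blast
    hence N: "norm (smooth N g z - g z) \<le> e / B" if "z \<in> circ" for z using that by blast
    note cs [continuous_intros] = continuous_on_smooth[OF g]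
    have "(\<lambda>k. circle_avg (\<lambda>w. inner (smooth N g w) (D k w))) \<longlonglongrightarrow> 0"
      by (rule circle_avg_inner_smooth_tendsto[OF g cD limD])
    hence "\<forall>\<^sub>F k in sequentially. circle_avg (\<lambda>w. inner (smooth N g w) (D k w)) < e"
      using e by (rule order_tendstoD(2))
    then obtain k0 where "\<forall>k\<ge>k0. circle_avg (\<lambda>w. inner (smooth N g w) (D k w)) < e"
      unfolding eventually_sequentially by blast
    hence k: "K \<le> max k0 K" "circle_avg (\<lambda>w. inner (smooth N g w) (D (max k0 K) w)) < e" by auto
    define k where "k = max k0 K"
    note k = k[folded k_def]
    have "circle_avg (\<lambda>w. norm (D j w)) - e = circle_avg (\<lambda>w. norm (D j w) - e)"
      by (simp add: circle_avg_diff continuous_on_norm cD)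
    also have "\<dots> \<le> circle_avg (\<lambda>w. inner (g w) (D j w))"
      by (intro circle_avg_mono continuous_intros gD)
    also have "\<dots> \<le> circle_avg (\<lambda>w. 1 * inner (smooth N g w) (D k w) + e / B * norm (D k w) + 1 * norm (\<Phi> j w - \<Phi> k w))"
    proof (rule circle_avg_mono)
      fix w assume w: "w \<in> circ"
      have "inner (g w) (D j w) = inner (smooth N g w) (D k w) + inner (g w - smooth N g w) (D k w) + inner (g w) (\<Phi> j w - \<Phi> k w)"
        by (simp add: D_def inner_simps)
      moreover have "inner (g w - smooth N g w) (D k w) \<le> e / B * norm (D k w)"
        using N[OF w]
        by (intro order.trans[OF norm_cauchy_schwarz] mult_right_mono) (auto simp: norm_minus_commute)
      moreover have "inner (g w) (\<Phi> j w - \<Phi> k w) \<le> 1 * norm (\<Phi> j w - \<Phi> k w)"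
        using gn by (intro order.trans[OF norm_cauchy_schwarz] mult_right_mono) auto
      ultimately show "inner (g w) (D j w) \<le> 1 * inner (smooth N g w) (D k w) + e / B * norm (D k w) + 1 * norm (\<Phi> j w - \<Phi> k w)"
        by linarith
    qed (intro continuous_intros cont)+
    also have "\<dots> = 1 * circle_avg (\<lambda>w. inner (smooth N g w) (D k w)) + e / B * circle_avg (\<lambda>w. norm (D k w)) + 1 * circle_avg (\<lambda>w. norm (\<Phi> j w - \<Phi> k w))"
      by (intro circle_avg_linear_combination continuous_intros cont)
    finally have "circle_avg (\<lambda>w. norm (D j w)) - e \<le> circle_avg (\<lambda>w. inner (smooth N g w) (D k w)) + e / B * circle_avg (\<lambda>w. norm (D k w)) + circle_avg (\<lambda>w. norm (\<Phi> j w - \<Phi> k w))"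
      by simp
    moreover have "e / B * circle_avg (\<lambda>w. norm (D k w)) \<le> e"
      using mult_left_mono[OF bD[of k], of "e / B"] e B by simp
    ultimately have "circle_avg (\<lambda>w. norm (D j w)) - e \<le> circle_avg (\<lambda>w. inner (smooth N g w) (D k w)) + e + circle_avg (\<lambda>w. norm (\<Phi> j w - \<Phi> k w))"
      by (meson add_mono order.refl order.trans)
    thus ?thesis using k(2) K[OF j k(1)] by linarith
  qed
  have nonneg: "0 \<le> circle_avg (\<lambda>w. norm (D k w))" for k by (intro circle_avg_nonneg continuous_intros) auto
  show "\<exists>no. \<forall>n\<ge>no. norm (circle_avg (\<lambda>w. norm (\<Phi> n w - C)) - 0) < r"
  proof (intro exI[of _ K] allI impI)
    fix n assume n: "K \<le> n"
    have "circle_avg (\<lambda>w. norm (D n w)) \<le> 4 * e" by (rule bound[OF n])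
    also have "4 * e < r" using e by (simp add: e_def)
    finally show "norm (circle_avg (\<lambda>w. norm (\<Phi> n w - C)) - 0) < r"
      using nonneg[of n] by (simp add: D_def)
  qed
qed

section \<open>Minimising sequences\<close>

lemma tendsto_linear:
  fixes L :: "'a::euclidean_space \<Rightarrow> 'b::euclidean_space"
  assumes "linear L" "(f \<longlongrightarrow> l) F"
  shows "((\<lambda>x. L (f x)) \<longlongrightarrow> L l) F"
  using bounded_linear.tendsto[of L f l F] assms by (simp add: linear_conv_bounded_linear)

lemma circle_avg_adj: "continuous_on circ f \<Longrightarrow> circle_avg (\<lambda>w. adj (f w)) = adj (circle_avg f)"
  for f :: "complex \<Rightarrow> complex^'n^'n"
  by (rule circle_avg_linear[OF linear_adj])

lemma norm_gram_diff:
  "norm (X ** adj X - Y ** adj Y) \<le> norm (X - Y) * (norm X + norm Y)" for X Y :: "complex^'n^'n"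
proof -
  have "X ** adj X - Y ** adj Y = (X - Y) ** adj X + Y ** adj (X - Y)"
    by (simp add: mm_diff_left mm_diff_right adj_diff)
  also have "norm \<dots> \<le> norm (X - Y) * norm X + norm Y * norm (X - Y)"
    using norm_mm[of "X - Y" "adj X"] norm_mm[of Y "adj (X - Y)"]
    by (intro order.trans[OF norm_triangle_ineq] add_mono) auto
  finally show ?thesis by (simp add: algebra_simps)
qed

lemma sum_power2_le: "(a + b)\<^sup>2 \<le> 2 * a\<^sup>2 + 2 * b\<^sup>2" for a b :: real
  using sum_squares_bound[of a b] by (simp add: power2_sum)

lemma circle_avg_double:
  fixes f g :: "complex \<Rightarrow> real"
  assumes "continuous_on circ f" "continuous_on circ g"
  shows "circle_avg (\<lambda>w. 2 * f w + 2 * g w) = 2 * circle_avg f + 2 * circle_avg g"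
  using circle_avg_linear_combination[OF assms continuous_on_const[of _ 0], of 2 2 0] by simp

context circle_frame
begin

lemma inverse_ex:
  "\<exists>B. continuous_on circ B \<and> (\<forall>w\<in>circ. A w ** B w = mat 1) \<and> (\<forall>w\<in>circ. B w ** A w = mat 1)"
proof (rule inverse_family[OF cont det_nz])
  fix B assume B: "continuous_on circ B" "\<And>w. w \<in> circ \<Longrightarrow> A w ** B w = mat 1"
    "\<And>w. w \<in> circ \<Longrightarrow> B w ** A w = mat 1"
  show ?thesis by (intro exI[of _ B] conjI ballI B)
qed

lemma near_mono: "near d F \<Longrightarrow> d \<le> d' \<Longrightarrow> near d' F"
  by (auto simp: near_def)

lemma energy_shift: "energy (\<lambda>w. cscale (w powi m) (F w)) = energy F"
  unfolding energy_def by (intro circle_avg_cong) (simp add: cscale_mult_left norm_power_int)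

text \<open>
  With \<open>X\<^sub>k = F\<^sub>k A\<close> for near-minimisers \<open>F\<^sub>k\<close>, the first variation with \<open>Q = z\<^sup>m F\<^sub>k\<close> kills the
  nonconstant Fourier coefficients of \<open>X\<^sub>k X\<^sub>k\<^sup>*\<close> in the limit. The same with \<open>Q = z\<^sup>m\<close> and
  \<open>Q = F\<^sub>k - 1\<close> shows that \<open>A X\<^sub>k\<^sup>*\<close> is asymptotically in the Hardy class with mean \<open>C\<close>. The limit \<open>C\<close> is
  positive definite since \<open>A\<close> is bounded below and \<open>F\<^sub>k\<close> has mean \<open>1\<close>.
\<close>

lemma extremal_sequence:
  "\<exists>F C. (\<forall>k::nat. hardy (F k) \<and> circle_avg (F k) = mat 1) \<and> posdef C \<and>
    (\<lambda>k. circle_avg (\<lambda>w. norm ((F k w ** A w) ** adj (F k w ** A w) - C))) \<longlonglongrightarrow> 0 \<and>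
    (\<forall>m>0. (\<lambda>k. circle_avg (\<lambda>w. cscale (w powi m) (A w ** adj (F k w ** A w)))) \<longlonglongrightarrow> 0) \<and>
    (\<lambda>k. circle_avg (\<lambda>w. A w ** adj (F k w ** A w))) \<longlonglongrightarrow> C"
proof -
  define d where "d k = inverse (real (Suc k))" for k
  have d: "0 < d k" "d k \<le> 1" for k by (auto simp: d_def divide_simps)
  have d_mono: "d k \<le> d l" if kl: "l \<le> k" for k l using kl by (auto simp: d_def divide_simps)
  have dlim: "d \<longlonglongrightarrow> 0" unfolding d_def by (rule LIMSEQ_inverse_real_of_nat)
  have "\<forall>k. \<exists>F. near (d k) F" using near_exists d by blast
  then obtain F where F: "\<And>k. near (d k) (F k)" by metis
  have hF: "hardy (F k)" and aF: "circle_avg (F k) = mat 1" for k using F[of k] by (auto simp: near_def)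
  note cF [continuous_intros] = hardy_cont[OF hF]
  note cA [continuous_intros] = cont
  define X where "X k w = F k w ** A w" for k w
  have cX [continuous_intros]: "continuous_on circ (X k)" for k unfolding X_def by (intro continuous_intros)
  define R where "R = min_energy + 1"
  have eF: "energy (F k) \<le> R" for k using F[of k] d[of k] by (simp add: near_def R_def)
  have eX: "energy (F k) = circle_avg (\<lambda>w. (norm (X k w))\<^sup>2)" for k by (simp add: energy_def X_def)
  have R: "0 \<le> R" using min_energy_nonneg by (simp add: R_def)
  define \<Phi> where "\<Phi> k w = X k w ** adj (X k w)" for k w
  have c\<Phi> [continuous_intros]: "continuous_on circ (\<Phi> k)" for k unfolding \<Phi>_def by (intro continuous_intros)
  have sqrt_lim: "(\<lambda>k. sqrt (d k * e)) \<longlonglongrightarrow> 0" for e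
    using tendsto_real_sqrt[OF tendsto_mult_left_zero[OF dlim, of e]] by simp
  \<comment> \<open>By the Cauchy-Schwarz inequality, as near-minimisers are close to each other.\<close>
  have diff: "circle_avg (\<lambda>w. norm (\<Phi> k w - \<Phi> l w)) \<le> sqrt (d K * (16 * R))" if kl: "K \<le> k" "K \<le> l" for k l K
  proof -
    have nk: "near (d K) (F k)" "near (d K) (F l)" using near_mono[OF F d_mono] kl by auto
    have "circle_avg (\<lambda>w. norm (\<Phi> k w - \<Phi> l w)) \<le> circle_avg (\<lambda>w. norm (X k w - X l w) * (norm (X k w) + norm (X l w)))"
      unfolding \<Phi>_def by (intro circle_avg_mono continuous_intros norm_gram_diff)
    also have "\<dots> \<le> sqrt (circle_avg (\<lambda>w. (norm (X k w - X l w))\<^sup>2)) * sqrt (circle_avg (\<lambda>w. (norm (X k w) + norm (X l w))\<^sup>2))"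
      by (intro circle_avg_cauchy_schwarz continuous_intros)
    also have "circle_avg (\<lambda>w. (norm (X k w - X l w))\<^sup>2) = energy (\<lambda>w. F k w - F l w)"
      by (simp add: energy_def X_def mm_diff_left)
    also have "sqrt (energy (\<lambda>w. F k w - F l w)) * sqrt (circle_avg (\<lambda>w. (norm (X k w) + norm (X l w))\<^sup>2)) \<le> sqrt (4 * d K) * sqrt (4 * R)"
    proof (intro mult_mono real_sqrt_le_mono)
      show "energy (\<lambda>w. F k w - F l w) \<le> 4 * d K" by (rule near_close[OF nk])
      have "circle_avg (\<lambda>w. (norm (X k w) + norm (X l w))\<^sup>2) \<le> circle_avg (\<lambda>w. 2 * (norm (X k w))\<^sup>2 + 2 * (norm (X l w))\<^sup>2)"
        by (intro circle_avg_mono continuous_intros sum_power2_le)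
      also have "\<dots> = 2 * energy (F k) + 2 * energy (F l)"
        unfolding eX by (intro circle_avg_double continuous_intros)
      finally show "circle_avg (\<lambda>w. (norm (X k w) + norm (X l w))\<^sup>2) \<le> 4 * R" using eF[of k] eF[of l] by linarith
      show "0 \<le> sqrt (4 * d K)" using d[of K] by simp
      show "0 \<le> sqrt (circle_avg (\<lambda>w. (norm (X k w) + norm (X l w))\<^sup>2))"
        by (intro real_sqrt_ge_zero circle_avg_nonneg continuous_intros zero_le_power2)
    qed
    also have "\<dots> = sqrt (d K * (16 * R))" by (simp add: real_sqrt_mult[symmetric])
    finally show ?thesis .
  qed
  have cauchy: "\<exists>K. \<forall>k\<ge>K. \<forall>l\<ge>K. circle_avg (\<lambda>w. norm (\<Phi> k w - \<Phi> l w)) \<le> e" if e: "0 < e" for e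
  proof -
    obtain K where "\<forall>k\<ge>K. sqrt (d k * (16 * R)) < e"
      using order_tendstoD(2)[OF sqrt_lim[of "16 * R"] e] unfolding eventually_sequentially by blast
    hence "sqrt (d K * (16 * R)) \<le> e" by (simp add: less_imp_le)
    thus ?thesis using diff[of K] by (meson order.trans)
  qed
  have "Cauchy (\<lambda>k. circle_avg (\<Phi> k))"
  proof (rule CauchyI)
    fix e :: real assume "0 < e"
    then obtain K where K: "\<forall>k\<ge>K. \<forall>l\<ge>K. circle_avg (\<lambda>w. norm (\<Phi> k w - \<Phi> l w)) \<le> e / 2" using cauchy[of "e/2"] by auto
    have "norm (circle_avg (\<Phi> k) - circle_avg (\<Phi> l)) < e" if kl: "K \<le> k" "K \<le> l" for k l
    proof -
      have "norm (circle_avg (\<Phi> k) - circle_avg (\<Phi> l)) \<le> circle_avg (\<lambda>w. norm (\<Phi> k w - \<Phi> l w))"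
        unfolding circle_avg_diff[OF c\<Phi> c\<Phi>, symmetric] by (intro norm_avg_le continuous_intros)
      also have "\<dots> \<le> e / 2" using K kl by blast
      finally show ?thesis using \<open>0 < e\<close> by simp
    qed
    thus "\<exists>M. \<forall>m\<ge>M. \<forall>n\<ge>M. norm (circle_avg (\<Phi> m) - circle_avg (\<Phi> n)) < e" by blast
  qed
  then obtain C where C: "(\<lambda>k. circle_avg (\<Phi> k)) \<longlonglongrightarrow> C"
    using Cauchy_convergent convergent_def by blast
  \<comment> \<open>First variation in the direction \<open>z\<^sup>m F\<^sub>k\<close>; the coefficients of opposite sign are adjoint to these.\<close>
  have neg: "norm (circle_avg (\<lambda>w. cscale (w powi (- m)) (\<Phi> k w))) \<le> sqrt (d k * R)" if m: "0 < m" for m k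
  proof -
    let ?Q = "\<lambda>w. cscale (w powi m) (F k w)"
    have "circle_avg (\<lambda>w. cscale (w powi (- m)) (\<Phi> k w)) = circle_avg (\<lambda>w. (F k w ** A w) ** adj (?Q w ** A w))"
      by (intro circle_avg_cong) (simp add: \<Phi>_def X_def cscale_mult_left cscale_mult_right adj_cscale cnj_powi_circ)
    also have "norm \<dots> \<le> sqrt (d k * energy ?Q)"
      by (rule first_variation[OF F hardy_shift[OF hF] hardy_shift_circle_avg[OF hF m]]) (use m in simp)
    also have "\<dots> \<le> sqrt (d k * R)"
      unfolding energy_shift using eF d by (intro real_sqrt_le_mono mult_left_mono) (auto simp: less_imp_le)
    finally show ?thesis .
  qed
  have self: "adj (\<Phi> k w) = \<Phi> k w" for k w by (simp add: \<Phi>_def adj_mult)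
  have pos: "norm (circle_avg (\<lambda>w. cscale (w powi m) (\<Phi> k w))) \<le> sqrt (d k * R)" if m: "0 < m" for m k
  proof -
    have "circle_avg (\<lambda>w. cscale (w powi m) (\<Phi> k w)) = circle_avg (\<lambda>w. adj (cscale (w powi (- m)) (\<Phi> k w)))"
      by (intro circle_avg_cong) (simp add: adj_cscale self cnj_powi_circ)
    also have "\<dots> = adj (circle_avg (\<lambda>w. cscale (w powi (- m)) (\<Phi> k w)))"
      by (intro circle_avg_adj continuous_intros)
    finally show ?thesis using neg[OF m] by simp
  qed
  have flim: "(\<lambda>k. circle_avg (\<lambda>w. cscale (w powi p) (\<Phi> k w))) \<longlonglongrightarrow> 0" if p: "p \<noteq> 0" for p
  proof (rule Lim_null_comparison[OF _ sqrt_lim[of R]])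
    show "\<forall>\<^sub>F k in sequentially. norm (circle_avg (\<lambda>w. cscale (w powi p) (\<Phi> k w))) \<le> sqrt (d k * R)"
      using pos[of p] neg[of "- p"] p by (intro always_eventually) (cases "0 < p", auto)
  qed
  have bnd: "circle_avg (\<lambda>w. norm (\<Phi> k w)) \<le> R" for k
  proof -
    have "circle_avg (\<lambda>w. norm (\<Phi> k w)) \<le> circle_avg (\<lambda>w. (norm (X k w))\<^sup>2)"
    proof (rule circle_avg_mono)
      fix w show "norm (\<Phi> k w) \<le> (norm (X k w))\<^sup>2"
        using norm_mm[of "X k w" "adj (X k w)"] by (simp add: \<Phi>_def power2_eq_square)
    qed (intro continuous_intros)+
    thus ?thesis using eF[of k] eX by simp
  qed
  have L1: "(\<lambda>k. circle_avg (\<lambda>w. norm (\<Phi> k w - C))) \<longlonglongrightarrow> 0"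
    by (rule L1_limit_of_fourier[OF c\<Phi> cauchy bnd C flim])
  have adjC: "adj C = C"
  proof (rule LIMSEQ_unique)
    show "(\<lambda>k. circle_avg (\<Phi> k)) \<longlonglongrightarrow> adj C"
      using tendsto_linear[OF linear_adj C] by (simp add: circle_avg_adj[OF c\<Phi>, symmetric] self)
  qed (rule C)
  obtain B where B: "continuous_on circ B" "\<And>w. w \<in> circ \<Longrightarrow> A w ** B w = mat 1" "\<And>w. w \<in> circ \<Longrightarrow> B w ** A w = mat 1"
    using inverse_ex by blast
  have "bounded (B ` circ)"
    using compact_continuous_image[OF B(1)] by (simp add: compact_imp_bounded)
  then obtain b where b: "0 < b" "\<And>w. w \<in> circ \<Longrightarrow> norm (B w) \<le> b"
    by (metis bounded_pos imageI)
  \<comment> \<open>Since \<open>F\<^sub>k\<close> has mean \<open>1\<close>, \<open>x\<close> is the mean of \<open>F\<^sub>k\<^sup>* x = B\<^sup>* X\<^sub>k\<^sup>* x\<close>, and \<open>\<bar>X\<^sub>k\<^sup>* x\<bar>\<^sup>2 = \<langle>x, \<Phi>\<^sub>k x\<rangle>\<close>.\<close>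
  have lower: "(norm x)\<^sup>2 \<le> b\<^sup>2 * inner x (circle_avg (\<Phi> k) *v x)" for x k
  proof -
    have FX: "norm (adj (F k w) *v x) \<le> b * norm (adj (X k w) *v x)" if w: "w \<in> circ" for w
    proof -
      have "F k w = X k w ** B w" using B(2)[OF w] by (simp add: X_def matrix_mul_assoc[symmetric])
      hence "adj (F k w) *v x = adj (B w) *v (adj (X k w) *v x)" by (simp add: adj_mult matrix_vector_mul_assoc)
      also have "norm \<dots> \<le> norm (adj (B w)) * norm (adj (X k w) *v x)" by (rule norm_mv)
      also have "\<dots> \<le> b * norm (adj (X k w) *v x)" using b(2)[OF w] by (intro mult_right_mono) auto
      finally show ?thesis .
    qed
    have "circle_avg (\<lambda>w. adj (F k w) *v x) = adj (circle_avg (F k)) *v x"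
      using circle_avg_linear[OF linear_mv_left continuous_on_adj[OF cF[of k]], of x] circle_avg_adj[OF cF[of k]] by simp
    hence "x = circle_avg (\<lambda>w. adj (F k w) *v x)" by (simp add: aF)
    hence "norm x \<le> circle_avg (\<lambda>w. norm (adj (F k w) *v x))"
      using norm_avg_le[OF continuous_on_mv[OF continuous_on_adj[OF cF[of k]] continuous_on_const[of _ x]]] by simp
    hence "(norm x)\<^sup>2 \<le> (circle_avg (\<lambda>w. norm (adj (F k w) *v x)))\<^sup>2" by (intro power_mono) auto
    also have "\<dots> \<le> circle_avg (\<lambda>w. (norm (adj (F k w) *v x))\<^sup>2)" by (intro circle_avg_square_le continuous_intros)
    also have "\<dots> \<le> circle_avg (\<lambda>w. b\<^sup>2 * inner x (\<Phi> k w *v x))"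
    proof (rule circle_avg_mono)
      fix w assume w: "w \<in> circ"
      have "(norm (adj (F k w) *v x))\<^sup>2 \<le> (b * norm (adj (X k w) *v x))\<^sup>2"
        using FX[OF w] by (intro power_mono) auto
      also have "\<dots> = b\<^sup>2 * inner x (\<Phi> k w *v x)"
        using inner_mv_left[of "adj (X k w)" x "adj (X k w) *v x"]
        by (simp add: power_mult_distrib power2_norm_eq_inner \<Phi>_def matrix_vector_mul_assoc)
      finally show "(norm (adj (F k w) *v x))\<^sup>2 \<le> b\<^sup>2 * inner x (\<Phi> k w *v x)" .
    qed (intro continuous_intros)+
    also have "\<dots> = b\<^sup>2 * inner x (circle_avg (\<Phi> k) *v x)"
    proof (rule circle_avg_linear[OF _ c\<Phi>])
      show "linear (\<lambda>M. b\<^sup>2 * inner x (M *v x))"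
        by (rule linearI) (simp_all add: matrix_vector_mult_add_rdistrib scaleR_mv inner_add_right distrib_left)
    qed
    finally show ?thesis .
  qed
  have posC: "posdef C"
    unfolding posdef_def
  proof (intro conjI allI impI adjC)
    fix x :: "complex^'n" assume x: "x \<noteq> 0"
    have "(\<lambda>k. b\<^sup>2 * inner x (circle_avg (\<Phi> k) *v x)) \<longlonglongrightarrow> b\<^sup>2 * inner x (C *v x)"
      by (intro tendsto_intros tendsto_linear[OF linear_mv_left C])
    hence "(norm x)\<^sup>2 \<le> b\<^sup>2 * inner x (C *v x)"
      by (rule LIMSEQ_le_const) (use lower in blast)
    moreover have "0 < (norm x)\<^sup>2" using x by simp
    ultimately have "0 < b\<^sup>2 * inner x (C *v x)" by linarith
    thus "0 < inner x (C *v x)" using b(1) by (simp add: zero_less_mult_iff)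
  qed
  have coeff: "(\<lambda>k. circle_avg (\<lambda>w. cscale (w powi m) (A w ** adj (X k w)))) \<longlonglongrightarrow> 0" if m: "0 < m" for m
  proof (rule Lim_null_comparison[OF _ sqrt_lim[of "energy (\<lambda>w. mat 1)"]])
    have "norm (circle_avg (\<lambda>w. cscale (w powi m) (A w ** adj (X k w)))) \<le> sqrt (d k * energy (\<lambda>w. mat 1))" for k
    proof -
      let ?Q = "\<lambda>w. cscale (w powi m) (mat 1 :: complex^'n^'n)"
      have "circle_avg (\<lambda>w. cscale (w powi m) (A w ** adj (X k w))) = circle_avg (\<lambda>w. adj ((F k w ** A w) ** adj (?Q w ** A w)))"
        by (intro circle_avg_cong) (simp add: X_def cscale_mult_left cscale_mult_right adj_cscale adj_mult cnj_powi_circ)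
      also have "\<dots> = adj (circle_avg (\<lambda>w. (F k w ** A w) ** adj (?Q w ** A w)))"
        by (intro circle_avg_adj continuous_intros)
      also have "norm \<dots> \<le> sqrt (d k * energy ?Q)"
        unfolding norm_adj
        by (rule first_variation[OF F hardy_shift[OF hardy_const] hardy_shift_circle_avg[OF hardy_const m]]) (use m in simp)
      finally show ?thesis by (simp add: energy_shift)
    qed
    thus "\<forall>\<^sub>F k in sequentially. norm (circle_avg (\<lambda>w. cscale (w powi m) (A w ** adj (X k w)))) \<le> sqrt (d k * energy (\<lambda>w. mat 1))"
      by simp
  qed
  \<comment> \<open>First variation in the direction \<open>F\<^sub>k - 1\<close>.\<close>
  have "(\<lambda>k. circle_avg (\<Phi> k) - circle_avg (\<lambda>w. X k w ** adj (A w))) \<longlonglongrightarrow> 0"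
  proof (rule Lim_null_comparison[OF _ sqrt_lim[of "2 * R + 2 * energy (\<lambda>w. mat 1)"]])
    have "norm (circle_avg (\<Phi> k) - circle_avg (\<lambda>w. X k w ** adj (A w))) \<le> sqrt (d k * (2 * R + 2 * energy (\<lambda>w. mat 1)))" for k
    proof -
      let ?Q = "\<lambda>w. F k w - mat 1"
      have Q: "hardy ?Q" "circle_avg ?Q = 0"
        using hardy_diff[OF hF hardy_const] by (auto simp: circle_avg_diff cF aF)
      have "circle_avg (\<Phi> k) - circle_avg (\<lambda>w. X k w ** adj (A w)) = circle_avg (\<lambda>w. \<Phi> k w - X k w ** adj (A w))"
        by (intro circle_avg_diff[symmetric] continuous_intros)
      also have "\<dots> = circle_avg (\<lambda>w. (F k w ** A w) ** adj (?Q w ** A w))"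
        by (intro circle_avg_cong) (simp add: \<Phi>_def X_def mm_diff_left mm_diff_right adj_diff)
      also have "norm \<dots> \<le> sqrt (d k * energy ?Q)" by (rule first_variation[OF F Q])
      also have "\<dots> \<le> sqrt (d k * (2 * R + 2 * energy (\<lambda>w. mat 1)))"
      proof (intro real_sqrt_le_mono mult_left_mono)
        have "energy ?Q \<le> circle_avg (\<lambda>w. 2 * (norm (X k w))\<^sup>2 + 2 * (norm (A w))\<^sup>2)"
          unfolding energy_def
        proof (rule circle_avg_mono)
          fix w
          have "(norm ((F k w - mat 1) ** A w))\<^sup>2 \<le> (norm (X k w) + norm (A w))\<^sup>2"
            unfolding mm_diff_left X_def by (intro power_mono order.trans[OF norm_triangle_ineq4]) auto
          also have "\<dots> \<le> 2 * (norm (X k w))\<^sup>2 + 2 * (norm (A w))\<^sup>2" by (rule sum_power2_le)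
          finally show "(norm ((F k w - mat 1) ** A w))\<^sup>2 \<le> 2 * (norm (X k w))\<^sup>2 + 2 * (norm (A w))\<^sup>2" .
        qed (intro continuous_intros)+
        also have "\<dots> = 2 * energy (F k) + 2 * energy (\<lambda>w. mat 1)"
          unfolding eX unfolding energy_def matrix_mul_lid by (intro circle_avg_double continuous_intros)
        finally show "energy ?Q \<le> 2 * R + 2 * energy (\<lambda>w. mat 1)" using eF[of k] by linarith
      qed (use d[of k] in auto)
      finally show ?thesis .
    qed
    thus "\<forall>\<^sub>F k in sequentially. norm (circle_avg (\<Phi> k) - circle_avg (\<lambda>w. X k w ** adj (A w))) \<le> sqrt (d k * (2 * R + 2 * energy (\<lambda>w. mat 1)))"
      by simp
  qed
  from tendsto_diff[OF C this] have "(\<lambda>k. circle_avg (\<lambda>w. X k w ** adj (A w))) \<longlonglongrightarrow> C" by simp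
  from tendsto_linear[OF linear_adj this]
  have "(\<lambda>k. adj (circle_avg (\<lambda>w. X k w ** adj (A w)))) \<longlonglongrightarrow> C" by (simp add: adjC)
  moreover have "adj (circle_avg (\<lambda>w. X k w ** adj (A w))) = circle_avg (\<lambda>w. A w ** adj (X k w))" for k
    using circle_avg_adj[OF continuous_on_mm[OF cX[of k] continuous_on_adj[OF cA]]] by (simp add: adj_mult)
  ultimately have c0: "(\<lambda>k. circle_avg (\<lambda>w. A w ** adj (X k w))) \<longlonglongrightarrow> C" by simp
  note facts = L1[unfolded \<Phi>_def X_def] c0[unfolded X_def]
  have coeff': "\<forall>m>0. (\<lambda>k. circle_avg (\<lambda>w. cscale (w powi m) (A w ** adj (F k w ** A w)))) \<longlonglongrightarrow> 0"
    by (intro allI impI) (rule coeff[unfolded X_def])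
  show ?thesis
  proof (rule exI[of _ F], rule exI[of _ C], intro conjI)
    show "\<forall>k. hardy (F k) \<and> circle_avg (F k) = mat 1" using hF aF by blast
  qed (rule posC facts coeff')+
qed

end

section \<open>Smoothed products and analytic parts\<close>

text \<open>
  Here \<open>Z\<^sub>k\<close> is nearly a contraction in the mean only, and \<open>P(z,w)\<close> is nearly the identity for \<open>w\<close>
  close to \<open>z\<close>. The kernel average of \<open>P Z\<^sub>k\<close> is nearly a contraction at every point: first \<open>N\<close>
  is chosen so that the kernel hides the points \<open>w\<close> far from \<open>z\<close>, then \<open>k\<close> so large that the
  bounded kernel cannot see the error of \<open>Z\<^sub>k\<close>.
\<close>

lemma smoothing_bound:
  fixes P :: "complex \<Rightarrow> complex \<Rightarrow> complex^'n^'n" and Z :: "nat \<Rightarrow> complex \<Rightarrow> complex^'n^'n"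
    and s :: "nat \<Rightarrow> complex \<Rightarrow> real"
  assumes e: "0 < e"
    and cP: "\<And>z. z \<in> circ \<Longrightarrow> continuous_on circ (P z)"
    and cZ: "\<And>k. continuous_on circ (Z k)"
    and cs: "\<And>k. continuous_on circ (s k)"
    and s0: "\<And>k w. 0 \<le> s k w"
    and Z: "\<And>k w u. w \<in> circ \<Longrightarrow> norm (Z k w *v u) \<le> (1 + s k w) * norm u"
    and slim: "(\<lambda>k. circle_avg (s k)) \<longlonglongrightarrow> 0"
    and d: "0 < d" "\<And>z w. z \<in> circ \<Longrightarrow> w \<in> circ \<Longrightarrow> cmod (z - w) < d \<Longrightarrow> norm (P z w - mat 1) \<le> e"
    and B: "\<And>z w. z \<in> circ \<Longrightarrow> w \<in> circ \<Longrightarrow> norm (P z w - mat 1) \<le> B"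
  shows "\<forall>\<^sub>F N in sequentially. \<forall>\<^sub>F k in sequentially. \<forall>z\<in>circ. \<forall>u.
    norm (circle_avg (\<lambda>w. kernel N z w *\<^sub>R (P z w ** Z k w)) *v u) \<le> (1 + 3 * e) * norm u"
proof -
  have B0: "0 \<le> B" using B[of 1 1] norm_ge_zero order.trans by (metis cis_circ cis_zero)
  have "\<forall>\<^sub>F N in sequentially. \<forall>z\<in>circ. \<forall>w\<in>circ. d \<le> cmod (z - w) \<longrightarrow> kernel N z w \<le> e / (B + 1)"
    using d e B0 by (intro kernel_small) auto
  thus ?thesis using eventually_gt_at_top[of 0]
  proof eventually_elim
    case (elim N)
    \<comment> \<open>Bounds the kernel times the norm of \<open>P z w\<close>; the kernel is at most \<open>2 N\<close>.\<close>
    define c where "c = 2 * real N * (1 + e) + e"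
    have "(\<lambda>k. c * circle_avg (s k)) \<longlonglongrightarrow> c * 0" by (intro tendsto_intros slim)
    hence "\<forall>\<^sub>F k in sequentially. c * circle_avg (s k) < e" using e by (intro order_tendstoD(2)) auto
    thus ?case
    proof eventually_elim
      case k: (elim k)
      show ?case
      proof (intro ballI allI)
        fix z u assume z: "z \<in> circ"
        have cK: "continuous_on circ (\<lambda>w. kernel N z w *\<^sub>R (P z w ** Z k w))"
          by (intro continuous_intros cP cZ z)
        have "circle_avg (\<lambda>w. kernel N z w *\<^sub>R (P z w ** Z k w)) *v u = circle_avg (\<lambda>w. (kernel N z w *\<^sub>R (P z w ** Z k w)) *v u)"
          by (rule circle_avg_linear[OF linear_mv_left cK, symmetric])
        also have "norm \<dots> \<le> circle_avg (\<lambda>w. ((1 + e) * norm u) * kernel N z w + (e * norm u) * 1 + (c * norm u) * s k w)"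
        proof (rule norm_avg_bound)
          fix w assume w: "w \<in> circ"
          let ?D = "norm (P z w - mat 1)" and ?K = "kernel N z w"
          have PD: "norm (P z w *v y) \<le> (1 + ?D) * norm y" for y
          proof -
            have "P z w *v y = y + (P z w - mat 1) *v y" by (simp add: matrix_vector_mult_diff_rdistrib)
            also have "norm \<dots> \<le> norm y + ?D * norm y"
              by (intro order.trans[OF norm_triangle_ineq] add_mono norm_mv order.refl)
            finally show ?thesis by (simp add: algebra_simps)
          qed
          have KD: "?K * (1 + ?D) \<le> ?K * (1 + e) + e"
          proof (cases "cmod (z - w) < d")
            case True
            have "?K * (1 + ?D) \<le> ?K * (1 + e)" using d(2)[OF z w True] by (intro mult_left_mono) auto
            thus ?thesis using e by linarith
          next
            case False
            hence "?K \<le> e / (B + 1)" using elim(1) z w by force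
            hence "?K * ?D \<le> e / (B + 1) * B" using B[OF z w] B0 e by (intro mult_mono) auto
            also have "\<dots> \<le> e" using B0 e by (simp add: divide_simps)
            finally have "?K * (1 + ?D) \<le> ?K + e" by (simp add: algebra_simps)
            also have "?K \<le> ?K * (1 + e)" using e by (simp add: algebra_simps)
            finally show ?thesis by simp
          qed
          have "norm ((?K *\<^sub>R (P z w ** Z k w)) *v u) = ?K * norm (P z w *v (Z k w *v u))"
            by (simp add: scaleR_mv matrix_vector_mul_assoc)
          also have "\<dots> \<le> ?K * ((1 + ?D) * ((1 + s k w) * norm u))"
            by (intro mult_left_mono order.trans[OF PD] Z w) auto
          also have "\<dots> = (?K * (1 + ?D)) * ((1 + s k w) * norm u)" by (simp add: mult.assoc)
          also have "\<dots> \<le> (?K * (1 + e) + e) * ((1 + s k w) * norm u)"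
            using s0[of k w] by (intro mult_right_mono KD) auto
          also have "\<dots> = (?K * (1 + e) + e) * norm u + (?K * (1 + e) + e) * (s k w * norm u)"
            by (simp add: algebra_simps)
          also have "\<dots> \<le> (?K * (1 + e) + e) * norm u + c * (s k w * norm u)"
          proof -
            have "?K * (1 + e) \<le> 2 * real N * (1 + e)"
              using kernel_bound[OF z w] elim(2) e by (intro mult_right_mono) auto
            hence "?K * (1 + e) + e \<le> c" by (simp add: c_def)
            thus ?thesis using s0[of k w] by (intro add_left_mono mult_right_mono) auto
          qed
          finally show "norm ((?K *\<^sub>R (P z w ** Z k w)) *v u) \<le> ((1 + e) * norm u) * ?K + (e * norm u) * 1 + (c * norm u) * s k w"
            by (simp add: algebra_simps)
        qed (intro continuous_intros cK cP cZ cs z)+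
        also have "\<dots> = ((1 + e) * norm u) * circle_avg (kernel N z) + (e * norm u) * circle_avg (\<lambda>w. 1) + (c * norm u) * circle_avg (s k)"
          by (intro circle_avg_linear_combination continuous_intros cs)
        also have "\<dots> = (1 + 2 * e + c * circle_avg (s k)) * norm u"
          by (simp add: circle_avg_kernel[OF z] algebra_simps)
        also have "\<dots> \<le> (1 + 3 * e) * norm u" using k by (intro mult_right_mono) auto
        finally show "norm (circle_avg (\<lambda>w. kernel N z w *\<^sub>R (P z w ** Z k w)) *v u) \<le> (1 + 3 * e) * norm u" .
      qed
    qed
  qed
qed

lemma sum_symmetric_int:
  fixes f :: "int \<Rightarrow> 'a::comm_monoid_add"
  shows "(\<Sum>p\<in>{-int N..int N}. f p) = (\<Sum>p\<le>N. f (int p)) + (\<Sum>p\<in>{1..N}. f (- int p))"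
proof -
  have "{-int N..int N} = int ` {..N} \<union> (\<lambda>p. - int p) ` {1..N}"
  proof (intro equalityI subsetI)
    fix p assume p: "p \<in> {-int N..int N}"
    show "p \<in> int ` {..N} \<union> (\<lambda>p. - int p) ` {1..N}"
    proof (cases "0 \<le> p")
      case True
      hence "p = int (nat p)" "nat p \<in> {..N}" using p by auto
      thus ?thesis by blast
    next
      case False
      hence "p = - int (nat (- p))" "nat (- p) \<in> {1..N}" using p by auto
      thus ?thesis by blast
    qed
  qed auto
  moreover have "int ` {..N} \<inter> (\<lambda>p. - int p) ` {1..N} = {}" by auto
  moreover have "sum f (int ` {..N}) = (\<Sum>p\<le>N. f (int p))"
    by (subst sum.reindex) (auto simp: inj_on_def)
  moreover have "sum f ((\<lambda>p. - int p) ` {1..N}) = (\<Sum>p\<in>{1..N}. f (- int p))"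
    by (subst sum.reindex) (auto simp: inj_on_def)
  ultimately show ?thesis by (simp add: sum.union_disjoint)
qed

text \<open>
  The coefficients of the polynomial that remains of a smoothed function when its negative Fourier
  coefficients are dropped.
\<close>

definition analytic_coeff :: "nat \<Rightarrow> (complex \<Rightarrow> complex^'n^'n) \<Rightarrow> nat \<Rightarrow> complex^'n^'n" where
  "analytic_coeff N G p = cscale (of_real (kernel_coeff N (int p))) (circle_avg (\<lambda>w. cscale (w powi (- int p)) (G w)))"

lemma analytic_coeff_0: "analytic_coeff N G 0 = circle_avg G"
  by (simp add: analytic_coeff_def)

lemma smooth_split:
  fixes G :: "complex \<Rightarrow> complex^'n^'n"
  assumes "continuous_on circ G" "z \<in> circ"
  shows "smooth N G z = (\<Sum>p\<le>N. cscale (z ^ p) (analytic_coeff N G p))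
    + (\<Sum>p\<in>{1..N}. cscale (of_real (kernel_coeff N (- int p)) * z powi (- int p)) (circle_avg (\<lambda>w. cscale (w powi int p) (G w))))"
  unfolding smooth_fourier_matrix[OF assms] sum_symmetric_int analytic_coeff_def
  by (simp add: cscale_cscale mult.commute)

text \<open>
  The coefficients at \<open>p\<close> and \<open>-p\<close> of a real function are conjugate, so its smoothing is the
  real part of a polynomial.
\<close>

lemma smooth_real_eq_Re:
  fixes h :: "complex \<Rightarrow> real"
  assumes h: "continuous_on circ h"
  obtains q where "q holomorphic_on UNIV" "q 0 = of_real (circle_avg h)" "\<And>z. z \<in> circ \<Longrightarrow> Re (q z) = smooth N h z"
proof
  define c where "c p = circle_avg (\<lambda>w. w powi (- int p) * of_real (h w))" for p :: nat
  define a where "a p = kernel_coeff N (int p) + (if p = 0 then 0 else kernel_coeff N (- int p))" for p :: nat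
  define q where "q z = (\<Sum>p\<le>N. of_real (a p) * z ^ p * c p)" for z
  have ch: "continuous_on circ (\<lambda>w. complex_of_real (h w))" by (intro continuous_intros h)
  show "q holomorphic_on UNIV" unfolding q_def by (intro holomorphic_intros)
  have c0: "c 0 = of_real (circle_avg h)"
    using circle_avg_linear[of complex_of_real h] h by (simp add: c_def linearI scaleR_conv_of_real)
  have "q 0 = (\<Sum>p\<le>N. if p = 0 then of_real (a p) * c p else 0)"
    unfolding q_def by (intro sum.cong) auto
  thus "q 0 = of_real (circle_avg h)" by (simp add: a_def c0)
  show "Re (q z) = smooth N h z" if z: "z \<in> circ" for z
  proof -
    have "complex_of_real (smooth N h z) = smooth N (\<lambda>w. complex_of_real (h w)) z"
      unfolding smooth_def
      by (subst circle_avg_linear[of complex_of_real "\<lambda>w. kernel N z w *\<^sub>R h w", symmetric])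
         (auto intro!: linearI continuous_intros h simp: scaleR_conv_of_real)
    also have "\<dots> = (\<Sum>p\<le>N. of_real (kernel_coeff N (int p)) * z ^ p * c p)
        + (\<Sum>p\<in>{1..N}. of_real (kernel_coeff N (- int p)) * z powi (- int p) * circle_avg (\<lambda>w. w powi int p * of_real (h w)))"
      unfolding smooth_fourier[OF ch z] sum_symmetric_int c_def by simp
    also have "(\<Sum>p\<in>{1..N}. of_real (kernel_coeff N (- int p)) * z powi (- int p) * circle_avg (\<lambda>w. w powi int p * of_real (h w)))
        = (\<Sum>p\<in>{1..N}. cnj (of_real (kernel_coeff N (- int p)) * z ^ p * c p))"
    proof (intro sum.cong refl)
      fix p
      have "cnj (c p) = circle_avg (\<lambda>w. cnj (w powi (- int p) * of_real (h w)))"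
        unfolding c_def by (rule circle_avg_linear[symmetric]) (auto intro!: linearI continuous_intros h)
      also have "\<dots> = circle_avg (\<lambda>w. w powi int p * of_real (h w))"
        by (intro circle_avg_cong) (simp add: cnj_powi_circ del: power_int_of_nat)
      finally have 1: "cnj (c p) = circle_avg (\<lambda>w. w powi int p * of_real (h w))" .
      have "cnj (z powi int p) = z powi (- int p)" using z by (simp add: cnj_powi_circ del: power_int_of_nat)
      hence "cnj (z ^ p) = z powi (- int p)" by simp
      thus "of_real (kernel_coeff N (- int p)) * z powi (- int p) * circle_avg (\<lambda>w. w powi int p * of_real (h w)) =
          cnj (of_real (kernel_coeff N (- int p)) * z ^ p * c p)"
        unfolding 1[symmetric] by simp
    qed
    finally have "Re (complex_of_real (smooth N h z)) = Re ((\<Sum>p\<le>N. of_real (kernel_coeff N (int p)) * z ^ p * c p)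
        + (\<Sum>p\<in>{1..N}. cnj (of_real (kernel_coeff N (- int p)) * z ^ p * c p)))" by simp
    also have "\<dots> = Re ((\<Sum>p\<le>N. of_real (kernel_coeff N (int p)) * z ^ p * c p)
        + (\<Sum>p\<in>{1..N}. of_real (kernel_coeff N (- int p)) * z ^ p * c p))"
      by (simp only: plus_complex.simps Re_sum cnj.simps)
    also have "(\<Sum>p\<in>{1..N}. of_real (kernel_coeff N (- int p)) * z ^ p * c p) =
        (\<Sum>p\<le>N. of_real (if p = 0 then 0 else kernel_coeff N (- int p)) * z ^ p * c p)"
      by (rule sum.mono_neutral_cong_left) auto
    also have "(\<Sum>p\<le>N. of_real (kernel_coeff N (int p)) * z ^ p * c p) + \<dots> = q z"
      unfolding q_def a_def by (simp only: sum.distrib[symmetric] of_real_add distrib_right)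
    finally show ?thesis by simp
  qed
qed

section \<open>Approximate spectral factors\<close>

lemma matrix_poly_holomorphic:
  "(\<lambda>z. det (\<Sum>p\<le>N. cscale (z ^ p) (M p))) holomorphic_on S" for M :: "nat \<Rightarrow> complex^'n^'n"
  unfolding det_def sum_entry cscale_nth by (intro holomorphic_intros)

lemma matrix_poly_0: "(\<Sum>p\<le>N. cscale (0 ^ p) (M p)) = M 0" for M :: "nat \<Rightarrow> complex^'n^'n"
proof -
  have "(\<Sum>p\<le>N. cscale (0 ^ p) (M p)) = (\<Sum>p\<le>N. if p = 0 then M p else 0)"
    by (intro sum.cong) (auto simp: power_0_left)
  thus ?thesis by simp
qed

context circle_frame
begin

definition log_det_mean :: real where
  "log_det_mean = circle_avg (\<lambda>w. ln (cmod (det (A w))))"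

lemma close_frames:
  assumes "0 < (e :: real)"
  shows "\<exists>d>0. \<forall>z\<in>circ. \<forall>w\<in>circ. cmod (z - w) < d \<longrightarrow> norm (A z - A w) \<le> e"
proof -
  have "uniformly_continuous_on circ A"
    using cont by (rule compact_uniformly_continuous) simp
  then obtain d where "0 < d" "\<And>z w. z \<in> circ \<Longrightarrow> w \<in> circ \<Longrightarrow> dist w z < d \<Longrightarrow> dist (A w) (A z) < e"
    using assms unfolding uniformly_continuous_on_def by metis
  thus ?thesis
    by (intro exI[of _ d]) (force simp: dist_norm norm_minus_commute)
qed

text \<open>
  Specialises the smoothing bound to \<open>Z\<^sub>k = X\<^sub>k\<^sup>*\<close>; the factor \<open>P\<close> will be \<open>A(z)\<^sup>-\<^sup>1 A(w)\<close> or the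
  adjoint of \<open>A(w)\<^sup>-\<^sup>1 A(z)\<close>.
\<close>

lemma smooth_frame_bound:
  fixes P :: "complex \<Rightarrow> complex \<Rightarrow> complex^'n^'n" and X :: "nat \<Rightarrow> complex \<Rightarrow> complex^'n^'n"
  assumes e: "0 < e" and cX: "\<And>k. continuous_on circ (X k)"
    and lim: "(\<lambda>k. circle_avg (\<lambda>w. norm (X k w ** adj (X k w) - mat 1))) \<longlonglongrightarrow> 0"
    and cP: "\<And>z. z \<in> circ \<Longrightarrow> continuous_on circ (P z)"
    and P: "\<And>z w. z \<in> circ \<Longrightarrow> w \<in> circ \<Longrightarrow> norm (P z w - mat 1) \<le> b * norm (A z - A w)"
    and b: "0 < b"
  shows "\<forall>\<^sub>F N in sequentially. \<forall>\<^sub>F k in sequentially. \<forall>z\<in>circ. \<forall>u.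
    norm (circle_avg (\<lambda>w. kernel N z w *\<^sub>R (P z w ** adj (X k w))) *v u) \<le> (1 + 3 * e) * norm u"
proof -
  obtain d where d: "0 < d" "\<forall>z\<in>circ. \<forall>w\<in>circ. cmod (z - w) < d \<longrightarrow> norm (A z - A w) \<le> e / b"
    using close_frames[of "e / b"] e b by auto
  have "bounded (A ` circ)"
    using compact_continuous_image[OF cont] by (simp add: compact_imp_bounded)
  then obtain a where a: "0 < a" "\<And>w. w \<in> circ \<Longrightarrow> norm (A w) \<le> a"
    by (metis bounded_pos imageI)
  show ?thesis
  proof (rule smoothing_bound[OF e cP _ _ _ _ lim d(1)])
    fix z w :: complex assume zw: "z \<in> circ" "w \<in> circ"
    show "norm (P z w - mat 1) \<le> b * (2 * a)"
    proof (rule order.trans[OF P[OF zw] mult_left_mono])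
      show "norm (A z - A w) \<le> 2 * a"
        using norm_triangle_ineq4[of "A z" "A w"] a(2)[OF zw(1)] a(2)[OF zw(2)] by linarith
    qed (use b in simp)
    assume "cmod (z - w) < d"
    hence "norm (A z - A w) \<le> e / b" using d(2) zw by blast
    hence "b * norm (A z - A w) \<le> b * (e / b)" using b by (intro mult_left_mono) auto
    with P[OF zw] b show "norm (P z w - mat 1) \<le> e" by simp
  qed (auto intro!: norm_adj_mv_le continuous_on_adj continuous_on_norm continuous_on_diff continuous_on_const continuous_on_mm cX)
qed

text \<open>
  If the \<open>F\<^sub>k A\<close> become unitary, then smoothing \<open>F\<^sub>k\<close> gives polynomials \<open>T\<close> with \<open>T(0) = E\<close> and
  \<open>\<bar>det T\<bar> \<bar>det A\<bar>\<close> almost at most \<open>1\<close> on the circle. With a polynomial \<open>q\<close> whose real part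
  approximates \<open>log \<bar>det A\<bar>\<close> there, the maximum principle for \<open>det T exp q\<close> gives the claim.
\<close>

lemma det_E_bound:
  fixes E :: "complex^'n^'n"
  assumes F: "\<And>k::nat. hardy (F k)" "\<And>k. circle_avg (F k) = E"
    and lim: "(\<lambda>k. circle_avg (\<lambda>w. norm ((F k w ** A w) ** adj (F k w ** A w) - mat 1))) \<longlonglongrightarrow> 0"
  shows "cmod (det E) * exp log_det_mean \<le> 1"
proof -
  note cF = hardy_cont[OF F(1)]
  obtain B where B: "continuous_on circ B" "\<forall>w\<in>circ. A w ** B w = mat 1"
    using inverse_ex by blast
  have "bounded (B ` circ)"
    using compact_continuous_image[OF B(1)] by (simp add: compact_imp_bounded)
  then obtain b where b: "0 < b" "\<And>w. w \<in> circ \<Longrightarrow> norm (B w) \<le> b"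
    by (metis bounded_pos imageI)
  define h where "h w = ln (cmod (det (A w)))" for w
  have ch: "continuous_on circ h"
    unfolding h_def using det_nz by (intro continuous_on_ln continuous_on_norm continuous_on_det cont) auto
  \<comment> \<open>Exchanges \<open>A(w)\<close> for \<open>A(z)\<close>: \<open>P(z,w) (F\<^sub>k(w) A(w))\<^sup>* = (F\<^sub>k(w) A(z))\<^sup>*\<close>, whose smoothing is \<open>(T(z) A(z))\<^sup>*\<close>.\<close>
  define P where "P z w = adj (A z) ** adj (B w)" for z w
  have main: "cmod (det E) * exp log_det_mean \<le> (1 + 3 * e) ^ CARD('n) * exp e" if e: "0 < e" for e
  proof -
    have "\<forall>\<^sub>F N in sequentially. \<forall>\<^sub>F k in sequentially. \<forall>z\<in>circ. \<forall>u.
        norm (circle_avg (\<lambda>w. kernel N z w *\<^sub>R (P z w ** adj (F k w ** A w))) *v u) \<le> (1 + 3 * e) * norm u"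
    proof (rule smooth_frame_bound[OF e _ lim _ _ b(1)])
      show "continuous_on circ (\<lambda>w. F k w ** A w)" for k by (intro continuous_intros cF cont)
      show "continuous_on circ (P z)" for z unfolding P_def by (intro continuous_intros B)
      fix z w :: complex assume zw: "z \<in> circ" "w \<in> circ"
      have "adj (A w) ** adj (B w) = adj (B w ** A w)" by (simp add: adj_mult)
      also have "B w ** A w = mat 1" using B(2) zw by (simp add: matrix_left_right_inverse)
      finally have "P z w - mat 1 = (adj (A z) - adj (A w)) ** adj (B w)"
        by (simp add: P_def mm_diff_left)
      also have "norm \<dots> \<le> norm (adj (A z - A w)) * norm (adj (B w))"
        unfolding adj_diff[symmetric] by (rule norm_mm)
      also have "\<dots> \<le> b * norm (A z - A w)"
        using mult_right_mono[OF b(2)[OF zw(2)], of "norm (A z - A w)"] by (simp add: mult.commute)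
      finally show "norm (P z w - mat 1) \<le> b * norm (A z - A w)" .
    qed
    from eventually_conj[OF this smooth_converges[OF ch e]] obtain N where
      N: "\<forall>\<^sub>F k in sequentially. \<forall>z\<in>circ. \<forall>u.
        norm (circle_avg (\<lambda>w. kernel N z w *\<^sub>R (P z w ** adj (F k w ** A w))) *v u) \<le> (1 + 3 * e) * norm u"
      "\<forall>z\<in>circ. norm (smooth N h z - h z) \<le> e"
      unfolding eventually_sequentially by blast
    then obtain k where k: "\<forall>z\<in>circ. \<forall>u.
        norm (circle_avg (\<lambda>w. kernel N z w *\<^sub>R (P z w ** adj (F k w ** A w))) *v u) \<le> (1 + 3 * e) * norm u"
      unfolding eventually_sequentially by blast
    define T where "T z = (\<Sum>p\<le>N. cscale (z ^ p) (analytic_coeff N (F k) p))" for z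
    have Ts: "T z = smooth N (F k) z" if "z \<in> circ" for z
      unfolding smooth_split[OF cF that] T_def
      using F(1)[of k] by (simp add: hardy_def del: power_int_of_nat)
    have Tbound: "cmod (det (T z)) * cmod (det (A z)) \<le> (1 + 3 * e) ^ CARD('n)" if z: "z \<in> circ" for z
    proof -
      have cK: "continuous_on circ (\<lambda>w. kernel N z w *\<^sub>R F k w)" by (intro continuous_intros cF)
      have "T z ** A z = circle_avg (\<lambda>w. (kernel N z w *\<^sub>R F k w) ** A z)"
        unfolding Ts[OF z] smooth_def by (rule circle_avg_linear[OF linear_mm_right cK, symmetric])
      hence "adj (T z ** A z) = circle_avg (\<lambda>w. adj ((kernel N z w *\<^sub>R F k w) ** A z))"
        by (simp add: circle_avg_adj[symmetric] continuous_on_mm cK)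
      also have "\<dots> = circle_avg (\<lambda>w. kernel N z w *\<^sub>R (P z w ** adj (F k w ** A w)))"
      proof (rule circle_avg_cong)
        fix w assume w: "w \<in> circ"
        have "adj (B w) ** (adj (A w) ** adj (F k w)) = adj (F k w ** (A w ** B w))"
          by (simp add: adj_mult matrix_mul_assoc)
        also have "\<dots> = adj (F k w)" using B(2) w by simp
        finally have "P z w ** adj (F k w ** A w) = adj (A z) ** adj (F k w)"
          by (simp add: P_def adj_mult matrix_mul_assoc[symmetric])
        thus "adj ((kernel N z w *\<^sub>R F k w) ** A z) = kernel N z w *\<^sub>R (P z w ** adj (F k w ** A w))"
          by (simp add: mm_scaleR_left adj_mult linear_scale[OF linear_adj])
      qed
      finally have "cmod (det (adj (T z ** A z))) \<le> (1 + 3 * e) ^ CARD('n)"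
        using k z e by (intro det_le_of_contraction) auto
      thus ?thesis by (simp add: det_adj det_mul norm_mult)
    qed
    obtain q where q: "q holomorphic_on UNIV" "q 0 = of_real (circle_avg h)" "\<And>z. z \<in> circ \<Longrightarrow> Re (q z) = smooth N h z"
      using smooth_real_eq_Re[OF ch, of N] by metis
    let ?f = "\<lambda>z. det (T z) * exp (q z)"
    have hol: "?f holomorphic_on UNIV"
      unfolding T_def by (intro holomorphic_intros matrix_poly_holomorphic q)
    have "cmod (?f 0) \<le> (1 + 3 * e) ^ CARD('n) * exp e"
    proof (rule maximum_modulus_frontier[where S = "cball 0 1" and f = ?f and \<xi> = 0])
      show "?f holomorphic_on interior (cball 0 1)" by (rule holomorphic_on_subset[OF hol]) simp
      show "continuous_on (closure (cball 0 1)) ?f"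
        by (rule holomorphic_on_imp_continuous_on[OF holomorphic_on_subset[OF hol]]) simp
      fix z :: complex assume "z \<in> frontier (cball 0 1)"
      hence z: "z \<in> circ" by (simp add: frontier_cball)
      have "Re (q z) \<le> h z + e" using N(2) z by (simp add: q(3) abs_le_iff) (smt (verit) z)
      hence "exp (Re (q z)) \<le> cmod (det (A z)) * exp e"
        using det_nz[OF z] by (simp add: h_def flip: exp_add) (metis exp_add exp_le_cancel_iff exp_ln zero_less_norm_iff)
      hence "cmod (det (T z)) * exp (Re (q z)) \<le> cmod (det (T z)) * (cmod (det (A z)) * exp e)"
        by (intro mult_left_mono) auto
      also have "\<dots> \<le> (1 + 3 * e) ^ CARD('n) * exp e"
        using Tbound[OF z] by (simp add: mult.assoc[symmetric])
      finally show "cmod (det (T z) * exp (q z)) \<le> (1 + 3 * e) ^ CARD('n) * exp e"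
        by (simp add: norm_mult)
    qed auto
    moreover have "T 0 = E" by (simp add: T_def matrix_poly_0 analytic_coeff_0 F(2))
    ultimately show ?thesis
      by (simp add: q(2) norm_mult log_det_mean_def h_def[abs_def])
  qed
  have "((\<lambda>e. (1 + 3 * e) ^ CARD('n) * exp e) \<longlongrightarrow> (1 + 3 * 0) ^ CARD('n) * exp (0::real)) (at_right 0)"
    by (intro tendsto_intros)
  hence "((\<lambda>e. (1 + 3 * e) ^ CARD('n) * exp e) \<longlongrightarrow> (1::real)) (at_right 0)" by simp
  moreover have "\<forall>\<^sub>F e in at_right 0. cmod (det E) * exp log_det_mean \<le> (1 + 3 * e) ^ CARD('n) * exp e"
    using eventually_at_right_less[of 0] by eventually_elim (rule main)
  ultimately show ?thesis by (rule tendsto_lowerbound) simp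
qed

text \<open>
  Let \<open>E C E\<^sup>* = 1\<close>. Then \<open>X\<^sub>k = E F\<^sub>k A\<close> becomes unitary and \<open>G\<^sub>k = A X\<^sub>k\<^sup>*\<close> becomes holomorphic with
  \<open>G\<^sub>k(0)\<close> tending to \<open>C E\<^sup>* = E\<^sup>-\<^sup>1\<close>. Smoothing \<open>G\<^sub>k\<close> and dropping the small negative coefficients gives
  the polynomial, and the lower bound for its determinant at \<open>0\<close> is the upper bound for \<open>\<bar>det E\<bar>\<close>
  from \<open>det_E_bound\<close>.
\<close>

theorem approximate_spectral_factor:
  assumes e: "0 < e"
  shows "\<exists>N M. (\<forall>z\<in>circ. \<forall>u. \<exists>v. (\<Sum>p\<le>N. cscale (z ^ p) (M p)) *v u = A z *v v \<and> norm v \<le> (1 + e) * norm u)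
    \<and> exp log_det_mean \<le> (1 + e) * cmod (det (M 0))"
proof -
  obtain F C where F: "\<forall>k::nat. hardy (F k) \<and> circle_avg (F k) = mat 1" and C: "posdef C"
    and L1: "(\<lambda>k. circle_avg (\<lambda>w. norm ((F k w ** A w) ** adj (F k w ** A w) - C))) \<longlonglongrightarrow> 0"
    and neg: "\<forall>m>0. (\<lambda>k. circle_avg (\<lambda>w. cscale (w powi m) (A w ** adj (F k w ** A w)))) \<longlonglongrightarrow> 0"
    and c0: "(\<lambda>k. circle_avg (\<lambda>w. A w ** adj (F k w ** A w))) \<longlonglongrightarrow> C"
    using extremal_sequence by blast
  obtain E where E: "elem_prod E" "E ** C ** adj E = mat 1"
    using elem_orthonormalise[OF C] by blast
  have cF: "continuous_on circ (F k)" for k using F hardy_cont by blast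
  define F' where "F' k w = E ** F k w" for k w
  have cF': "continuous_on circ (F' k)" for k unfolding F'_def by (intro continuous_intros cF)
  have hF': "hardy (F' k)" for k unfolding F'_def using F by (intro hardy_mult_left) blast
  have aF': "circle_avg (F' k) = E" for k
    unfolding F'_def using circle_avg_linear[OF linear_mm_left cF] F by simp
  define X where "X k w = F' k w ** A w" for k w
  have cX: "continuous_on circ (X k)" for k unfolding X_def by (intro continuous_intros cF' cont)
  have L1': "(\<lambda>k. circle_avg (\<lambda>w. norm (X k w ** adj (X k w) - mat 1))) \<longlonglongrightarrow> 0"
  proof (rule Lim_null_comparison)
    have "norm (circle_avg (\<lambda>w. norm (X k w ** adj (X k w) - mat 1))) \<le>
        norm E * norm E * circle_avg (\<lambda>w. norm ((F k w ** A w) ** adj (F k w ** A w) - C))" for k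
    proof -
      let ?D = "\<lambda>w. (F k w ** A w) ** adj (F k w ** A w) - C"
      have cD: "continuous_on circ ?D" by (intro continuous_intros cF cont)
      have "norm (circle_avg (\<lambda>w. norm (X k w ** adj (X k w) - mat 1))) \<le> circle_avg (\<lambda>w. norm E * norm E * norm (?D w))"
      proof (rule norm_avg_bound)
        fix w
        have "X k w ** adj (X k w) - mat 1 = E ** ?D w ** adj E"
          unfolding E(2)[symmetric] by (simp add: X_def F'_def adj_mult matrix_mul_assoc mm_diff_left mm_diff_right)
        also have "norm \<dots> \<le> norm (E ** ?D w) * norm (adj E)" by (rule norm_mm)
        also have "\<dots> \<le> (norm E * norm (?D w)) * norm E" by (intro mult_mono norm_mm) auto
        finally show "norm (norm (X k w ** adj (X k w) - mat 1)) \<le> norm E * norm E * norm (?D w)"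
          by (simp add: mult_ac)
      qed (intro continuous_intros cX cD)+
      also have "\<dots> = norm E * norm E * circle_avg (\<lambda>w. norm (?D w))"
        by (intro circle_avg_mult_left continuous_on_norm cD)
      finally show ?thesis .
    qed
    thus "\<forall>\<^sub>F k in sequentially. norm (circle_avg (\<lambda>w. norm (X k w ** adj (X k w) - mat 1))) \<le>
        norm E * norm E * circle_avg (\<lambda>w. norm ((F k w ** A w) ** adj (F k w ** A w) - C))" by simp
    show "(\<lambda>k. norm E * norm E * circle_avg (\<lambda>w. norm ((F k w ** A w) ** adj (F k w ** A w) - C))) \<longlonglongrightarrow> 0"
      using tendsto_mult_right_zero[OF L1] by simp
  qed
  have dE: "cmod (det E) * exp log_det_mean \<le> 1"
    by (rule det_E_bound[OF hF' aF' L1'[unfolded X_def]])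
  define G where "G k w = A w ** adj (X k w)" for k w
  have cG: "continuous_on circ (G k)" for k unfolding G_def by (intro continuous_intros cX cont)
  have G: "G k w = (A w ** adj (F k w ** A w)) ** adj E" for k w
    by (simp add: G_def X_def F'_def adj_mult matrix_mul_assoc)
  have cAF: "continuous_on circ (\<lambda>w. A w ** adj (F k w ** A w))" for k by (intro continuous_intros cF cont)
  have Gneg: "(\<lambda>k. circle_avg (\<lambda>w. cscale (w powi m) (G k w))) \<longlonglongrightarrow> 0" if "0 < m" for m
  proof -
    have "circle_avg (\<lambda>w. cscale (w powi m) (G k w)) = circle_avg (\<lambda>w. cscale (w powi m) (A w ** adj (F k w ** A w))) ** adj E" for k
    proof -
      have "circle_avg (\<lambda>w. cscale (w powi m) (G k w)) = circle_avg (\<lambda>w. cscale (w powi m) (A w ** adj (F k w ** A w)) ** adj E)"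
        by (simp only: G cscale_mult_left)
      also have "\<dots> = circle_avg (\<lambda>w. cscale (w powi m) (A w ** adj (F k w ** A w))) ** adj E"
        by (rule circle_avg_linear[OF linear_mm_right]) (intro continuous_on_cscale continuous_on_powi_circ cAF)
      finally show ?thesis .
    qed
    moreover have "(\<lambda>k. circle_avg (\<lambda>w. cscale (w powi m) (A w ** adj (F k w ** A w))) ** adj E) \<longlonglongrightarrow> 0 ** adj E"
      using neg that by (intro tendsto_linear[OF linear_mm_right]) blast
    ultimately show ?thesis by (simp add: linear_0[OF linear_mm_right])
  qed
  have G0: "(\<lambda>k. circle_avg (G k)) \<longlonglongrightarrow> C ** adj E"
    unfolding G using circle_avg_linear[OF linear_mm_right[of "adj E"] cAF] tendsto_linear[OF linear_mm_right[of "adj E"] c0] by simp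
  have "det E * det (C ** adj E) = 1"
    using arg_cong[OF E(2), of det] by (simp add: det_mul mult.assoc)
  hence dCE: "cmod (det E) * cmod (det (C ** adj E)) = 1" by (metis norm_mult norm_one)
  have ld: "exp log_det_mean \<le> cmod (det (C ** adj E))"
  proof -
    have "exp log_det_mean = (cmod (det E) * exp log_det_mean) * cmod (det (C ** adj E))" using dCE by (simp add: mult_ac)
    also have "\<dots> \<le> 1 * cmod (det (C ** adj E))" by (intro mult_right_mono dE) auto
    finally show ?thesis by simp
  qed
  have "0 < cmod (det (C ** adj E))" using ld exp_gt_zero[of log_det_mean] by linarith
  hence "cmod (det (C ** adj E)) < (1 + e) * cmod (det (C ** adj E))" using e by (simp add: distrib_right)
  with ld have "exp log_det_mean < (1 + e) * cmod (det (C ** adj E))" by linarith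
  moreover have "(\<lambda>k. (1 + e) * cmod (det (circle_avg (G k)))) \<longlonglongrightarrow> (1 + e) * cmod (det (C ** adj E))"
  proof -
    have "continuous_on UNIV (\<lambda>M::complex^'n^'n. det M)"
      by (intro continuous_on_det continuous_on_id)
    hence "isCont det (C ** adj E)" by (simp add: continuous_on_eq_continuous_at)
    from isCont_tendsto_compose[OF this G0]
    show ?thesis by (intro tendsto_mult_left tendsto_norm)
  qed
  ultimately have ev1: "\<forall>\<^sub>F k in sequentially. exp log_det_mean < (1 + e) * cmod (det (circle_avg (G k)))"
    by (intro order_tendstoD(1))
  obtain B where B: "continuous_on circ B" "\<forall>w\<in>circ. A w ** B w = mat 1" "\<forall>w\<in>circ. B w ** A w = mat 1"
    using inverse_ex by blast
  have "bounded (B ` circ)"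
    using compact_continuous_image[OF B(1)] by (simp add: compact_imp_bounded)
  then obtain b where b: "0 < b" "\<And>w. w \<in> circ \<Longrightarrow> norm (B w) \<le> b"
    by (metis bounded_pos imageI)
  have "\<forall>\<^sub>F N in sequentially. \<forall>\<^sub>F k in sequentially. \<forall>z\<in>circ. \<forall>u.
      norm (circle_avg (\<lambda>w. kernel N z w *\<^sub>R ((B z ** A w) ** adj (X k w))) *v u) \<le> (1 + 3 * (e / 4)) * norm u"
  proof (rule smooth_frame_bound[OF _ cX L1' _ _ b(1)])
    show "continuous_on circ (\<lambda>w. B z ** A w)" for z by (intro continuous_intros cont)
    fix z w :: complex assume zw: "z \<in> circ" "w \<in> circ"
    have "B z ** A w - mat 1 = B z ** (A w - A z)" using B(3) zw by (simp add: mm_diff_right)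
    also have "norm \<dots> \<le> norm (B z) * norm (A w - A z)" by (rule norm_mm)
    also have "\<dots> \<le> b * norm (A z - A w)"
      using mult_right_mono[OF b(2)[OF zw(1)], of "norm (A z - A w)"] by (simp add: norm_minus_commute)
    finally show "norm (B z ** A w - mat 1) \<le> b * norm (A z - A w)" .
  qed (use e in simp)
  then obtain N where ev2: "\<forall>\<^sub>F k in sequentially. \<forall>z\<in>circ. \<forall>u.
      norm (circle_avg (\<lambda>w. kernel N z w *\<^sub>R ((B z ** A w) ** adj (X k w))) *v u) \<le> (1 + 3 * (e / 4)) * norm u"
    unfolding eventually_sequentially by blast
  \<comment> \<open>A bound for the negative frequencies of the smoothed \<open>G k\<close>, which are dropped.\<close>
  define r where "r k = (\<Sum>p\<in>{1..N}. \<bar>kernel_coeff N (- int p)\<bar> * norm (circle_avg (\<lambda>w. cscale (w powi int p) (G k w))))" for k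
  have "(\<lambda>k. b * r k) \<longlonglongrightarrow> b * (\<Sum>p\<in>{1..N}. \<bar>kernel_coeff N (- int p)\<bar> * norm (0 :: complex^'n^'n))"
    unfolding r_def by (intro tendsto_intros Gneg) auto
  hence "(\<lambda>k. b * r k) \<longlonglongrightarrow> 0" by simp
  hence ev3: "\<forall>\<^sub>F k in sequentially. b * r k < e / 4" using e by (intro order_tendstoD(2)) auto
  from eventually_conj[OF ev1 eventually_conj[OF ev2 ev3]] obtain k where
    k1: "exp log_det_mean < (1 + e) * cmod (det (circle_avg (G k)))"
    and k2: "\<forall>z\<in>circ. \<forall>u. norm (circle_avg (\<lambda>w. kernel N z w *\<^sub>R ((B z ** A w) ** adj (X k w))) *v u) \<le> (1 + 3 * (e / 4)) * norm u"
    and k3: "b * r k < e / 4"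
    unfolding eventually_sequentially by blast
  let ?M = "analytic_coeff N (G k)"
  have "\<exists>v. (\<Sum>p\<le>N. cscale (z ^ p) (?M p)) *v u = A z *v v \<and> norm v \<le> (1 + e) * norm u" if z: "z \<in> circ" for z u
  proof -
    define R where "R = (\<Sum>p\<in>{1..N}. cscale (of_real (kernel_coeff N (- int p)) * z powi (- int p)) (circle_avg (\<lambda>w. cscale (w powi int p) (G k w))))"
    define T where "T = (\<Sum>p\<le>N. cscale (z ^ p) (?M p))"
    have T: "T = smooth N (G k) z - R" unfolding smooth_split[OF cG z] T_def R_def by simp
    have "norm R \<le> r k"
      unfolding R_def r_def
      by (rule sum_norm_le) (use z in \<open>simp add: norm_mult norm_power_int\<close>)
    have BS: "B z ** smooth N (G k) z = circle_avg (\<lambda>w. kernel N z w *\<^sub>R ((B z ** A w) ** adj (X k w)))"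
    proof -
      have cK: "continuous_on circ (\<lambda>w. kernel N z w *\<^sub>R G k w)" by (intro continuous_intros cG)
      have "B z ** smooth N (G k) z = circle_avg (\<lambda>w. B z ** (kernel N z w *\<^sub>R G k w))"
        unfolding smooth_def by (rule circle_avg_linear[OF linear_mm_left cK, symmetric])
      thus ?thesis by (simp add: mm_scaleR_right G_def matrix_mul_assoc)
    qed
    have "B z *v (T *v u) = (B z ** smooth N (G k) z) *v u - B z *v (R *v u)"
      by (simp add: T matrix_vector_mult_diff_rdistrib matrix_vector_mult_diff_distrib matrix_vector_mul_assoc mm_diff_right)
    also have "norm \<dots> \<le> (1 + 3 * (e / 4)) * norm u + (b * r k) * norm u"
    proof (rule order.trans[OF norm_triangle_ineq4 add_mono])
      show "norm ((B z ** smooth N (G k) z) *v u) \<le> (1 + 3 * (e / 4)) * norm u"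
        unfolding BS using k2 z by blast
      have "norm (B z *v (R *v u)) \<le> norm (B z) * (norm R * norm u)"
        by (intro order.trans[OF norm_mv] mult_left_mono norm_mv) auto
      also have "\<dots> \<le> b * (r k * norm u)"
        using b(2)[OF z] \<open>norm R \<le> r k\<close> b(1) order.trans[OF norm_ge_zero \<open>norm R \<le> r k\<close>]
        by (intro mult_mono) auto
      finally show "norm (B z *v (R *v u)) \<le> (b * r k) * norm u" by (simp add: mult.assoc)
    qed
    also have "\<dots> = (1 + 3 * (e / 4) + b * r k) * norm u" by (simp add: algebra_simps)
    also have "\<dots> \<le> (1 + e) * norm u" using k3 by (intro mult_right_mono) auto
    finally have "norm (B z *v (T *v u)) \<le> (1 + e) * norm u" .
    moreover have "T *v u = A z *v (B z *v (T *v u))"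
      using B(2) z by (simp add: matrix_vector_mul_assoc matrix_mul_assoc)
    ultimately show ?thesis unfolding T_def by blast
  qed
  moreover have "exp log_det_mean \<le> (1 + e) * cmod (det (?M 0))"
    using k1 by (simp add: analytic_coeff_0)
  ultimately show ?thesis by blast
qed

end

section \<open>Plurisubharmonic functions on polynomial discs\<close>

lemma nn_integral_continuous:
  fixes g :: "real \<Rightarrow> real"
  assumes g: "continuous_on {a..b} g" and nn: "\<And>t. t \<in> {a..b} \<Longrightarrow> 0 \<le> g t"
  shows "(\<integral>\<^sup>+t\<in>{a..b}. ennreal (g t) \<partial>lborel) = ennreal (integral {a..b} g)"
proof -
  have si: "set_integrable lborel {a..b} g" by (rule borel_integrable_atLeastAtMost'[OF g])
  have "(\<integral>\<^sup>+t\<in>{a..b}. ennreal (g t) \<partial>lborel) = (\<integral>\<^sup>+t. ennreal (indicator {a..b} t *\<^sub>R g t) \<partial>lborel)"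
    by (intro nn_integral_cong) (auto simp: indicator_def)
  also have "\<dots> = ennreal (\<integral>t. indicator {a..b} t *\<^sub>R g t \<partial>lborel)"
    by (rule nn_integral_eq_integral) (use si nn in \<open>auto simp: set_integrable_def indicator_def\<close>)
  also have "(\<integral>t. indicator {a..b} t *\<^sub>R g t \<partial>lborel) = integral {a..b} g"
    using set_borel_integral_eq_integral(2)[OF si] by (simp add: set_lebesgue_integral_def)
  finally show ?thesis .
qed

lemma circle_mean_continuous:
  fixes g :: "complex \<Rightarrow> real"
  assumes g: "continuous_on circ (\<lambda>w. g (a + of_real r * w))"
  shows "circle_mean (\<lambda>z. ereal (g z)) a r = ereal (circle_avg (\<lambda>w. g (a + of_real r * w)))"
proof -
  define G where "G t = g (a + of_real r * cis t)" for t
  have "continuous_on {0..2*pi} ((\<lambda>w. g (a + of_real r * w)) \<circ> cis)"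
    by (rule continuous_on_compose) (auto intro!: continuous_intros continuous_on_subset[OF g])
  hence cG: "continuous_on {0..2*pi} G" by (simp add: o_def G_def)
  define P where "P = integral {0..2*pi} (\<lambda>t. max 0 (G t))"
  define Q where "Q = integral {0..2*pi} (\<lambda>t. max 0 (- G t))"
  have cP: "continuous_on {0..2*pi} (\<lambda>t. max 0 (G t))" and cQ: "continuous_on {0..2*pi} (\<lambda>t. max 0 (- G t))"
    by (intro continuous_on_max continuous_on_const continuous_on_minus cG)+
  have e: "e2ennreal (ereal x) = ennreal (max 0 x)" for x
    by (simp add: max_def ennreal_neg)
  have P: "(\<integral>\<^sup>+t\<in>{0..2*pi}. e2ennreal (ereal (G t)) \<partial>lborel) = ennreal P"
    unfolding P_def e by (rule nn_integral_continuous[OF cP]) simp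
  have Q: "(\<integral>\<^sup>+t\<in>{0..2*pi}. e2ennreal (- ereal (G t)) \<partial>lborel) = ennreal Q"
    unfolding Q_def uminus_ereal.simps e by (rule nn_integral_continuous[OF cQ]) simp
  have "0 \<le> P" "0 \<le> Q"
    unfolding P_def Q_def by (auto intro!: integral_nonneg integrable_continuous_real cP cQ)
  moreover have "P - Q = integral {0..2*pi} G"
  proof -
    have "P - Q = integral {0..2*pi} (\<lambda>t. max 0 (G t) - max 0 (- G t))"
      unfolding P_def Q_def by (intro integral_diff[symmetric] integrable_continuous_real cP cQ)
    also have "(\<lambda>t. max 0 (G t) - max 0 (- G t)) = G" by (auto simp: max_def)
    finally show ?thesis .
  qed
  ultimately show ?thesis
    unfolding circle_mean_def rcis_def
    using P Q by (simp add: G_def[abs_def] circle_avg_def enn2ereal_ennreal)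
qed

lemma plurisubharmonic_submean:
  fixes \<phi> :: "complex^'n \<Rightarrow> real"
  assumes psh: "plurisubharmonic_on Y (\<lambda>y. ereal (\<phi> y))" and c: "continuous_on Y \<phi>" and "0 < r"
    and disc: "\<And>h. cmod h \<le> r \<Longrightarrow> x + h *s d \<in> Y"
  shows "\<phi> x \<le> circle_avg (\<lambda>w. \<phi> (x + (of_real r * w) *s d))"
proof -
  have "subharmonic_on {z. x + z *s d \<in> Y} (\<lambda>z. ereal (\<phi> (x + z *s d)))"
    using psh by (simp add: plurisubharmonic_on_def)
  moreover have "cball 0 r \<subseteq> {z. x + z *s d \<in> Y}" using disc by auto
  ultimately have "ereal (\<phi> (x + 0 *s d)) \<le> circle_mean (\<lambda>z. ereal (\<phi> (x + z *s d))) 0 r"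
    using \<open>0 < r\<close> unfolding subharmonic_on_def by blast
  also have "\<dots> = ereal (circle_avg (\<lambda>w. \<phi> (x + (0 + of_real r * w) *s d)))"
  proof (rule circle_mean_continuous)
    have "continuous_on circ (\<lambda>w. x + (0 + of_real r * w) *s d)"
      unfolding vector_scalar_mult_def by (intro continuous_intros)
    thus "continuous_on circ (\<lambda>w. \<phi> (x + (0 + of_real r * w) *s d))"
      using disc \<open>0 < r\<close> by (intro continuous_on_compose2[OF c]) (auto simp: norm_mult)
  qed
  finally show ?thesis by simp
qed

definition poly_vec :: "('n \<Rightarrow> complex poly) \<Rightarrow> complex \<Rightarrow> complex^'n" where
  "poly_vec p z = (\<chi> i. poly (p i) z)"

lemma continuous_on_poly_vec [continuous_intros]:
  "continuous_on S f \<Longrightarrow> continuous_on S (\<lambda>x. poly_vec p (f x))"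
  unfolding poly_vec_def by (intro continuous_on_vec_lambda continuous_on_poly)

lemma norm_smult_vec: "norm (c *s v) = cmod c * norm v" for v :: "complex^'n"
proof -
  have "(norm (c *s v))\<^sup>2 = (cmod c * norm v)\<^sup>2"
    by (simp add: norm_sq_vec power_mult_distrib norm_mult sum_distrib_left)
  thus ?thesis by (metis norm_ge_zero mult_nonneg_nonneg power2_eq_imp_eq)
qed

text \<open>
  The second-order remainder is again a polynomial disc, so its circle means vanish.
\<close>

lemma poly_vec_taylor:
  "\<exists>d t. \<forall>h. poly_vec p (z + h) = poly_vec p z + h *s d + (h\<^sup>2) *s poly_vec t h"
proof -
  have "\<exists>b t. \<forall>h. poly q (z + h) = poly q z + h * b + h\<^sup>2 * poly t h" for q :: "complex poly"
  proof -
    obtain a b t where abt: "pcompose q [:z, 1:] = pCons a (pCons b t)"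
      by (metis pCons_cases)
    have *: "poly q (z + h) = a + h * b + h\<^sup>2 * poly t h" for h
    proof -
      have "poly q (z + h) = poly (pcompose q [:z, 1:]) h" by (simp add: poly_pcompose)
      thus ?thesis unfolding abt by (simp add: power2_eq_square algebra_simps)
    qed
    from *[of 0] have "a = poly q z" by simp
    with * show ?thesis by blast
  qed
  hence "\<forall>i. \<exists>b t. \<forall>h. poly (p i) (z + h) = poly (p i) z + h * b + h\<^sup>2 * poly t h" by blast
  then obtain b t where "\<forall>i h. poly (p i) (z + h) = poly (p i) z + h * b i + h\<^sup>2 * poly (t i) h" by metis
  thus ?thesis
    by (intro exI[of _ "\<chi> i. b i"] exI[of _ t]) (simp add: poly_vec_def vec_eq_iff)
qed

lemma circle_avg_poly_vec_shift:
  assumes "0 < k"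
  shows "circle_avg (\<lambda>w. (w ^ k) *s poly_vec t (of_real r * w)) = 0"
proof -
  have c: "continuous_on circ (\<lambda>w. (w ^ k) *s poly_vec t (of_real r * w))"
    unfolding vector_scalar_mult_def by (intro continuous_intros)
  have "circle_avg (\<lambda>w. w ^ k * poly q (of_real r * w)) = 0" for q
  proof -
    have "circle_avg (\<lambda>w. w ^ k * poly q (of_real r * w)) = circle_avg (\<lambda>w. \<Sum>j\<le>degree q. (coeff q j * of_real r ^ j) * w powi (int (k + j)))"
      by (intro circle_avg_cong) (simp only: poly_altdef sum_distrib_left power_int_of_nat, simp add: power_mult_distrib power_add mult_ac)
    also have "\<dots> = (\<Sum>j\<le>degree q. circle_avg (\<lambda>w. (coeff q j * of_real r ^ j) * w powi (int (k + j))))"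
      by (intro circle_avg_sum finite_atMost continuous_on_mult_left continuous_on_powi_circ)
    also have "\<dots> = (\<Sum>j\<le>degree q. (coeff q j * of_real r ^ j) * circle_avg (\<lambda>w. w powi (int (k + j))))"
      by (intro sum.cong refl circle_avg_mult_left continuous_on_powi_circ)
    also have "\<dots> = 0" using assms by (simp add: circle_avg_powi del: power_int_of_nat of_nat_add)
    finally show ?thesis .
  qed
  moreover have "circle_avg (\<lambda>w. (w ^ k) *s poly_vec t (of_real r * w)) $ i = circle_avg (\<lambda>w. w ^ k * poly (t i) (of_real r * w))" for i
  proof -
    have "linear (\<lambda>v::complex^'a. v $ i)" by (rule linearI) simp_all
    from circle_avg_linear[OF this c] show ?thesis by (simp add: poly_vec_def)
  qed
  ultimately show ?thesis by (simp add: vec_eq_iff)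
qed

lemma small_radius:
  fixes a b c C1 C2 :: real
  assumes "0 < a" "0 < b" "0 < c" "0 \<le> C1" "0 \<le> C2"
  shows "\<exists>r>0. r \<le> 1 \<and> r \<le> a \<and> C1 * r \<le> b \<and> C2 * r < c"
proof -
  define r where "r = min (min 1 a) (min (b / (C1 + 1)) (c / (C2 + 1)))"
  have r: "0 < r" "r \<le> 1" "r \<le> a" "r \<le> b / (C1 + 1)" "r \<le> c / (C2 + 1)"
    using assms by (auto simp: r_def)
  have "(C1 + 1) * r \<le> b" "(C2 + 1) * r \<le> c"
    using r assms by (simp_all add: pos_le_divide_eq mult.commute)
  with r show ?thesis by (intro exI[of _ r]) (simp add: algebra_simps)
qed

text \<open>
  Let \<open>f\<close> be the disc and suppose that \<open>\<phi> \<circ> f\<close> is larger inside than on the boundary. Maximise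
  \<open>\<phi>(f(z) + s) + \<eta> \<bar>z\<bar>\<^sup>2 - \<kappa> \<bar>s\<bar>\<^sup>2\<close> over \<open>\<bar>z\<bar> \<le> 1\<close> and small \<open>s\<close>; for large \<open>\<kappa>\<close> the maximum is at an
  interior point \<open>(z\<^sub>0, s\<^sub>0)\<close>. The complex line through \<open>f(z\<^sub>0) + s\<^sub>0\<close> tangent to the disc consists of
  the points \<open>f(z\<^sub>0 + h) + (s\<^sub>0 - g(h))\<close> with \<open>g(h) = O(h\<^sup>2)\<close> holomorphic. In the mean over \<open>\<bar>h\<bar> = r\<close>
  the term \<open>\<eta> \<bar>z\<bar>\<^sup>2\<close> gains \<open>\<eta> r\<^sup>2\<close>, whereas \<open>\<kappa> \<bar>s\<bar>\<^sup>2\<close> changes by \<open>O(r\<^sup>4)\<close> only because the term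
  linear in \<open>g\<close> averages out. For small \<open>r\<close> this contradicts maximality.
\<close>

theorem poly_disc_maximum_principle:
  fixes \<phi> :: "complex^'n \<Rightarrow> real"
  assumes Y: "open Y" and c: "continuous_on Y \<phi>" and psh: "plurisubharmonic_on Y (\<lambda>y. ereal (\<phi> y))"
    and fY: "\<And>z. cmod z \<le> 1 \<Longrightarrow> poly_vec p z \<in> Y"
    and bd: "\<And>z. cmod z = 1 \<Longrightarrow> \<phi> (poly_vec p z) \<le> m"
    and z1: "cmod z1 \<le> 1"
  shows "\<phi> (poly_vec p z1) \<le> m"
proof (rule ccontr)
  assume "\<not> \<phi> (poly_vec p z1) \<le> m"
  define \<eta> where "\<eta> = (\<phi> (poly_vec p z1) - m) / 4"
  have \<eta>: "0 < \<eta>" "\<phi> (poly_vec p z1) - m = 4 * \<eta>"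
    using \<open>\<not> \<phi> (poly_vec p z1) \<le> m\<close> by (simp_all add: \<eta>_def)
  let ?f = "poly_vec p"
  let ?K = "?f ` cball 0 1"
  have K: "compact ?K" "?K \<subseteq> Y"
    using fY by (auto intro!: compact_continuous_image continuous_intros)
  obtain \<sigma>0 where \<sigma>0: "0 < \<sigma>0" "(\<Union>x\<in>?K. cball x \<sigma>0) \<subseteq> Y"
    using compact_subset_open_imp_cball_epsilon_subset[OF K(1) Y K(2)] by blast
  define L where "L = {x + y | x y. x \<in> ?K \<and> y \<in> cball 0 \<sigma>0}"
  have L: "compact L" unfolding L_def by (intro compact_sums K compact_cball)
  have LY: "L \<subseteq> Y" using \<sigma>0 unfolding L_def by (force simp: dist_norm)
  have "uniformly_continuous_on L \<phi>"
    by (rule compact_uniformly_continuous[OF continuous_on_subset[OF c LY] L])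
  then obtain \<delta> where \<delta>: "0 < \<delta>" "\<And>x x'. x \<in> L \<Longrightarrow> x' \<in> L \<Longrightarrow> dist x' x < \<delta> \<Longrightarrow> dist (\<phi> x') (\<phi> x) < \<eta>"
    using \<eta>(1) unfolding uniformly_continuous_on_def by metis
  have "bounded (\<phi> ` L)"
    by (intro compact_imp_bounded compact_continuous_image continuous_on_subset[OF c LY] L)
  then obtain B where B: "0 < B" "\<And>x. x \<in> L \<Longrightarrow> \<bar>\<phi> x\<bar> \<le> B"
    by (metis bounded_pos imageI real_norm_def)
  define \<sigma> where "\<sigma> = min \<sigma>0 (\<delta> / 2)"
  have \<sigma>: "0 < \<sigma>" "\<sigma> \<le> \<sigma>0" "\<sigma> < \<delta>" using \<sigma>0 \<delta> by (auto simp: \<sigma>_def)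
  have inL: "?f z + s \<in> L" if "cmod z \<le> 1" "norm s \<le> \<sigma>" for z s
    unfolding L_def using that \<sigma>(2) by force
  \<comment> \<open>Large enough to keep the maximum away from \<open>\<bar>s\<bar> = \<sigma>\<close>.\<close>
  define \<kappa> where "\<kappa> = (2 * B + 2 * \<eta>) / \<sigma>\<^sup>2"
  have \<kappa>: "0 < \<kappa>" "\<kappa> * \<sigma>\<^sup>2 = 2 * B + 2 * \<eta>" using B \<eta> \<sigma> by (auto simp: \<kappa>_def divide_simps)
  define \<Psi> where "\<Psi> x = \<phi> (?f (fst x) + snd x) + \<eta> * (cmod (fst x))\<^sup>2 - \<kappa> * (norm (snd x))\<^sup>2" for x
  have "continuous_on (cball 0 1 \<times> cball 0 \<sigma>) \<Psi>"
  proof -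
    have "continuous_on (cball 0 1 \<times> cball 0 \<sigma>) (\<lambda>x. ?f (fst x) + snd x)" by (intro continuous_intros)
    hence "continuous_on (cball 0 1 \<times> cball 0 \<sigma>) (\<lambda>x. \<phi> (?f (fst x) + snd x))"
      using inL LY by (intro continuous_on_compose2[OF c]) auto
    thus ?thesis unfolding \<Psi>_def by (intro continuous_intros)
  qed
  moreover have "compact (cball (0::complex) 1 \<times> cball (0::complex^'n) \<sigma>)" by (intro compact_Times compact_cball)
  moreover have "(0, 0) \<in> cball (0::complex) 1 \<times> cball (0::complex^'n) \<sigma>" using \<sigma> by auto
  ultimately obtain x0 where x0: "x0 \<in> cball 0 1 \<times> cball 0 \<sigma>" "\<forall>x\<in>cball 0 1 \<times> cball 0 \<sigma>. \<Psi> x \<le> \<Psi> x0"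
    using continuous_attains_sup[of "cball (0::complex) 1 \<times> cball (0::complex^'n) \<sigma>" \<Psi>] by blast
  obtain z0 s0 where zs: "x0 = (z0, s0)" by (cases x0)
  have zs0: "cmod z0 \<le> 1" "norm s0 \<le> \<sigma>" using x0(1) by (auto simp: zs)
  have max: "\<Psi> (z, s) \<le> \<Psi> (z0, s0)" if "cmod z \<le> 1" "norm s \<le> \<sigma>" for z s
    using x0(2) that by (auto simp: zs)
  have "\<phi> (?f z1) \<le> \<Psi> (z1, 0)" using \<eta> by (simp add: \<Psi>_def)
  also have "\<dots> \<le> \<Psi> (z0, s0)" using z1 \<sigma> by (intro max) auto
  finally have big: "m + 4 * \<eta> \<le> \<Psi> (z0, s0)" using \<eta>(2) by linarith
  \<comment> \<open>For \<open>\<bar>z0\<bar> = 1\<close> the value would be below \<open>m + 2 \<eta>\<close>, as \<open>\<phi>\<close> varies by less than \<open>\<eta>\<close> over the distance \<open>\<sigma>\<close>.\<close>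
  have z0: "cmod z0 < 1"
  proof (rule ccontr)
    assume "\<not> cmod z0 < 1"
    hence n: "cmod z0 = 1" using zs0 by simp
    have "dist (?f z0 + s0) (?f z0 + 0) < \<delta>" using zs0 \<sigma> by (simp add: dist_norm)
    hence "dist (\<phi> (?f z0 + s0)) (\<phi> (?f z0 + 0)) < \<eta>" using \<sigma> zs0 by (intro \<delta>(2) inL) auto
    hence "\<phi> (?f z0 + s0) < m + \<eta>" using bd[OF n] by (simp add: dist_real_def)
    moreover have "0 \<le> \<kappa> * (norm s0)\<^sup>2" using \<kappa> by simp
    ultimately show False using big \<eta> by (simp add: \<Psi>_def n)
  qed
  have s0: "norm s0 < \<sigma>"
  proof (rule ccontr)
    assume "\<not> norm s0 < \<sigma>"
    hence n: "norm s0 = \<sigma>" using zs0 by simp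
    have "\<phi> (?f z0 + s0) \<le> B" using B(2)[OF inL[OF zs0]] by simp
    moreover have "\<eta> * (cmod z0)\<^sup>2 \<le> \<eta> * 1" using \<eta> zs0 by (intro mult_left_mono) (auto simp: power_le_one)
    ultimately have "\<Psi> (z0, s0) \<le> B + \<eta> - (2 * B + 2 * \<eta>)" by (simp add: \<Psi>_def n \<kappa>(2))
    moreover have "- B \<le> \<phi> (?f z1)" using B(2)[OF inL[OF z1, of 0]] \<sigma> by simp
    ultimately show False using big \<eta> by linarith
  qed
  obtain d t where dt: "\<And>h. ?f (z0 + h) = ?f z0 + h *s d + (h\<^sup>2) *s poly_vec t h"
    using poly_vec_taylor[of p z0] by blast
  have "bounded (poly_vec t ` cball 0 1)"
    by (intro compact_imp_bounded compact_continuous_image continuous_intros compact_cball)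
  then obtain C where C: "0 < C" "\<And>h. cmod h \<le> 1 \<Longrightarrow> norm (poly_vec t h) \<le> C"
    by (metis bounded_pos imageI mem_cball_0)
  obtain r where r: "0 < r" "r \<le> 1" "r \<le> 1 - cmod z0" "C * r \<le> \<sigma> - norm s0" "(\<kappa> * C\<^sup>2) * r < \<eta>"
    using small_radius[of "1 - cmod z0" "\<sigma> - norm s0" \<eta> C "\<kappa> * C\<^sup>2"] z0 s0 \<eta> C \<kappa> by auto
  define g where "g h = (h\<^sup>2) *s poly_vec t h" for h
  have gn: "norm (g h) \<le> C * r\<^sup>2" if "cmod h \<le> r" for h
  proof -
    have "norm (g h) = (cmod h)\<^sup>2 * norm (poly_vec t h)" by (simp add: g_def norm_smult_vec norm_power)
    also have "\<dots> \<le> r\<^sup>2 * C" using that r C by (intro mult_mono power_mono) auto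
    finally show ?thesis by (simp add: mult.commute)
  qed
  have r2: "r\<^sup>2 \<le> r" using r by (simp add: power2_eq_square)
  have Cr: "C * r\<^sup>2 \<le> \<sigma> - norm s0" using mult_left_mono[OF r2, of C] C r by linarith
  \<comment> \<open>A point of the complex line is a point of the disc with another translation, where \<open>max\<close> applies.\<close>
  have line: "?f z0 + s0 + h *s d = ?f (z0 + h) + (s0 - g h)" for h
    unfolding dt g_def by (simp add: algebra_simps)
  have ok: "cmod (z0 + h) \<le> 1" "norm (s0 - g h) \<le> \<sigma>" if "cmod h \<le> r" for h
    using norm_triangle_ineq[of z0 h] norm_triangle_ineq4[of s0 "g h"] gn[OF that] that r Cr by linarith+
  have "\<phi> (?f z0 + s0) \<le> circle_avg (\<lambda>w. \<phi> (?f z0 + s0 + (of_real r * w) *s d))"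
  proof (rule plurisubharmonic_submean[OF psh c r(1)])
    fix h assume "cmod h \<le> r"
    thus "?f z0 + s0 + h *s d \<in> Y" unfolding line using inL ok LY by blast
  qed
  also have "\<dots> \<le> circle_avg (\<lambda>w. (\<Psi> (z0, s0) - \<eta> * ((cmod z0)\<^sup>2 + r\<^sup>2) + \<kappa> * ((norm s0)\<^sup>2 + (C * r\<^sup>2)\<^sup>2)) * 1
      + (- 2 * \<eta> * r) * inner z0 w + (- 2 * \<kappa> * r\<^sup>2) * inner s0 ((w\<^sup>2) *s poly_vec t (of_real r * w)))"
  proof (rule circle_avg_mono)
    show "continuous_on circ (\<lambda>w. \<phi> (?f z0 + s0 + (of_real r * w) *s d))"
    proof (rule continuous_on_compose2[OF c])
      show "continuous_on circ (\<lambda>w. ?f z0 + s0 + (of_real r * w) *s d)"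
        unfolding vector_scalar_mult_def by (intro continuous_intros)
      show "(\<lambda>w. ?f z0 + s0 + (of_real r * w) *s d) ` circ \<subseteq> Y"
      proof (rule image_subsetI)
        fix w :: complex assume "w \<in> circ"
        hence "cmod (of_real r * w) \<le> r" using r by (simp add: norm_mult)
        thus "?f z0 + s0 + (of_real r * w) *s d \<in> Y" unfolding line using inL ok LY by blast
      qed
    qed
    show "continuous_on circ (\<lambda>w. (\<Psi> (z0, s0) - \<eta> * ((cmod z0)\<^sup>2 + r\<^sup>2) + \<kappa> * ((norm s0)\<^sup>2 + (C * r\<^sup>2)\<^sup>2)) * 1
      + (- 2 * \<eta> * r) * inner z0 w + (- 2 * \<kappa> * r\<^sup>2) * inner s0 ((w\<^sup>2) *s poly_vec t (of_real r * w)))"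
      unfolding vector_scalar_mult_def by (intro continuous_intros)
    fix w :: complex assume w: "w \<in> circ"
    define h where "h = of_real r * w"
    have h: "cmod h = r" using w r by (simp add: h_def norm_mult)
    have "\<Psi> (z0 + h, s0 - g h) \<le> \<Psi> (z0, s0)" using ok[of h] h by (intro max) auto
    hence "\<phi> (?f z0 + s0 + h *s d) \<le> \<Psi> (z0, s0) - \<eta> * (cmod (z0 + h))\<^sup>2 + \<kappa> * (norm (s0 - g h))\<^sup>2"
      unfolding line by (simp add: \<Psi>_def)
    moreover have "(cmod (z0 + h))\<^sup>2 = (cmod z0)\<^sup>2 + r\<^sup>2 + 2 * r * inner z0 w"
    proof -
      have "(cmod (z0 + h))\<^sup>2 = (cmod z0)\<^sup>2 + (cmod h)\<^sup>2 + 2 * inner z0 h"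
        by (simp add: power2_norm_eq_inner inner_simps inner_commute)
      moreover have "inner z0 h = r * inner z0 w"
        unfolding h_def scaleR_conv_of_real[symmetric] by simp
      ultimately show ?thesis by (simp add: h)
    qed
    moreover have "(norm (s0 - g h))\<^sup>2 \<le> (norm s0)\<^sup>2 + (C * r\<^sup>2)\<^sup>2 - 2 * r\<^sup>2 * inner s0 ((w\<^sup>2) *s poly_vec t h)"
    proof -
      have "(norm (s0 - g h))\<^sup>2 = (norm s0)\<^sup>2 + (norm (g h))\<^sup>2 - 2 * inner s0 (g h)"
        by (simp add: power2_norm_eq_inner inner_simps inner_commute)
      moreover have "(norm (g h))\<^sup>2 \<le> (C * r\<^sup>2)\<^sup>2" using gn[of h] h by (intro power_mono) auto
      moreover have "g h = r\<^sup>2 *\<^sub>R ((w\<^sup>2) *s poly_vec t h)"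
        by (simp add: g_def h_def vec_eq_iff power_mult_distrib scaleR_conv_of_real[where 'a = complex])
      ultimately show ?thesis by simp
    qed
    hence "\<kappa> * (norm (s0 - g h))\<^sup>2 \<le> \<kappa> * ((norm s0)\<^sup>2 + (C * r\<^sup>2)\<^sup>2 - 2 * r\<^sup>2 * inner s0 ((w\<^sup>2) *s poly_vec t h))"
      using \<kappa> by (intro mult_left_mono) auto
    ultimately have "\<phi> (?f z0 + s0 + h *s d) \<le> \<Psi> (z0, s0) - \<eta> * ((cmod z0)\<^sup>2 + r\<^sup>2 + 2 * r * inner z0 w)
        + \<kappa> * ((norm s0)\<^sup>2 + (C * r\<^sup>2)\<^sup>2 - 2 * r\<^sup>2 * inner s0 ((w\<^sup>2) *s poly_vec t h))"
      by simp
    also have "\<dots> = (\<Psi> (z0, s0) - \<eta> * ((cmod z0)\<^sup>2 + r\<^sup>2) + \<kappa> * ((norm s0)\<^sup>2 + (C * r\<^sup>2)\<^sup>2)) * 1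
      + (- 2 * \<eta> * r) * inner z0 w + (- 2 * \<kappa> * r\<^sup>2) * inner s0 ((w\<^sup>2) *s poly_vec t h)"
      by (simp add: algebra_simps)
    finally show "\<phi> (?f z0 + s0 + (of_real r * w) *s d) \<le> (\<Psi> (z0, s0) - \<eta> * ((cmod z0)\<^sup>2 + r\<^sup>2) + \<kappa> * ((norm s0)\<^sup>2 + (C * r\<^sup>2)\<^sup>2)) * 1
      + (- 2 * \<eta> * r) * inner z0 w + (- 2 * \<kappa> * r\<^sup>2) * inner s0 ((w\<^sup>2) *s poly_vec t (of_real r * w))"
      unfolding h_def .
  qed
  also have "\<dots> = (\<Psi> (z0, s0) - \<eta> * ((cmod z0)\<^sup>2 + r\<^sup>2) + \<kappa> * ((norm s0)\<^sup>2 + (C * r\<^sup>2)\<^sup>2)) * circle_avg (\<lambda>w. 1)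
      + (- 2 * \<eta> * r) * circle_avg (\<lambda>w. inner z0 w) + (- 2 * \<kappa> * r\<^sup>2) * circle_avg (\<lambda>w. inner s0 ((w\<^sup>2) *s poly_vec t (of_real r * w)))"
    unfolding vector_scalar_mult_def by (intro circle_avg_linear_combination continuous_intros)
  also have "circle_avg (\<lambda>w. inner z0 w) = 0"
  proof -
    have "circle_avg (\<lambda>w. inner z0 w) = inner z0 (circle_avg (\<lambda>w. w))"
      by (rule circle_avg_linear) (auto intro!: linearI continuous_intros simp: inner_simps)
    thus ?thesis using circle_avg_powi[of 1] by simp
  qed
  also have "circle_avg (\<lambda>w. inner s0 ((w\<^sup>2) *s poly_vec t (of_real r * w))) = 0"
  proof -
    have "continuous_on circ (\<lambda>w. (w\<^sup>2) *s poly_vec t (of_real r * w))"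
      unfolding vector_scalar_mult_def by (intro continuous_intros)
    hence "circle_avg (\<lambda>w. inner s0 ((w\<^sup>2) *s poly_vec t (of_real r * w))) = inner s0 (circle_avg (\<lambda>w. (w\<^sup>2) *s poly_vec t (of_real r * w)))"
      by (intro circle_avg_linear) (auto intro!: linearI simp: inner_simps)
    thus ?thesis by (simp add: circle_avg_poly_vec_shift)
  qed
  finally have "\<phi> (?f z0 + s0) \<le> \<Psi> (z0, s0) - \<eta> * ((cmod z0)\<^sup>2 + r\<^sup>2) + \<kappa> * ((norm s0)\<^sup>2 + (C * r\<^sup>2)\<^sup>2)"
    by simp
  hence "\<eta> * r\<^sup>2 \<le> \<kappa> * (C * r\<^sup>2)\<^sup>2" by (simp add: \<Psi>_def distrib_left)
  also have "\<dots> = (\<kappa> * C\<^sup>2 * r\<^sup>2) * r\<^sup>2" by (simp add: power2_eq_square mult_ac)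
  finally have "\<eta> \<le> \<kappa> * C\<^sup>2 * r\<^sup>2" using r(1) by (simp add: mult_le_cancel_right)
  also have "\<dots> \<le> \<kappa> * C\<^sup>2 * r" using r2 \<kappa> by (intro mult_left_mono) auto
  finally show False using r(5) by simp
qed

text \<open>
  All discs of the family lying in \<open>Y\<close> lie in one compact sublevel set of the exhaustion function,
  by the maximum principle; hence the parameter can always be increased by a fixed amount.
\<close>

theorem disc_continuity_principle:
  fixes Y :: "(complex^'n) set" and c d :: "'n \<Rightarrow> complex poly"
  assumes pc: "pseudoconvex Y"
    and bd: "\<And>z t. cmod z = 1 \<Longrightarrow> 0 \<le> t \<Longrightarrow> t \<le> 1 \<Longrightarrow> poly_vec c z + t *\<^sub>R poly_vec d z \<in> Y"
    and init: "\<And>z. cmod z \<le> 1 \<Longrightarrow> poly_vec c z \<in> Y"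
    and z: "cmod z \<le> 1"
  shows "poly_vec c z + poly_vec d z \<in> Y"
proof -
  obtain \<phi> :: "complex^'n \<Rightarrow> real" where \<phi>: "continuous_on Y \<phi>" "plurisubharmonic_on Y (\<lambda>y. ereal (\<phi> y))"
    "\<And>c. compact {y \<in> Y. \<phi> y \<le> c}" and Y: "open Y"
    using pc unfolding pseudoconvex_def by blast
  let ?F = "\<lambda>x. poly_vec c (fst x) + snd x *\<^sub>R poly_vec d (fst x)"
  have cF: "compact (?F ` (circ \<times> {0..1}))"
    by (intro compact_continuous_image continuous_intros compact_Times) auto
  have FY: "?F ` (circ \<times> {0..1}) \<subseteq> Y" using bd by auto
  have "bounded (\<phi> ` ?F ` (circ \<times> {0..1}))"
    by (rule compact_imp_bounded[OF compact_continuous_image[OF continuous_on_subset[OF \<phi>(1) FY] cF]])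
  then obtain m where "\<forall>v\<in>\<phi> ` ?F ` (circ \<times> {0..1}). norm v \<le> m"
    unfolding bounded_iff by blast
  hence m: "\<bar>\<phi> (?F x)\<bar> \<le> m" if "x \<in> circ \<times> {0..1}" for x
    using that by (simp only: ball_simps(9) real_norm_def)
  define L where "L = {y \<in> Y. \<phi> y \<le> m}"
  have L: "compact L" "L \<subseteq> Y" using \<phi>(3) by (auto simp: L_def)
  obtain s where s: "0 < s" "(\<Union>x\<in>L. cball x s) \<subseteq> Y"
    using compact_subset_open_imp_cball_epsilon_subset[OF L(1) Y L(2)] by blast
  have "bounded (poly_vec d ` cball 0 1)"
    by (intro compact_imp_bounded compact_continuous_image continuous_intros compact_cball)
  then obtain b where b: "0 < b" "\<And>z. cmod z \<le> 1 \<Longrightarrow> norm (poly_vec d z) \<le> b"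
    by (metis bounded_pos imageI mem_cball_0)
  have inL: "poly_vec c z + t *\<^sub>R poly_vec d z \<in> L"
    if t: "0 \<le> t" "t \<le> 1" "\<And>z. cmod z \<le> 1 \<Longrightarrow> poly_vec c z + t *\<^sub>R poly_vec d z \<in> Y" and z: "cmod z \<le> 1" for t z
  proof -
    have eq: "poly_vec (\<lambda>i. c i + smult (of_real t) (d i)) z = poly_vec c z + t *\<^sub>R poly_vec d z" for z
      by (simp add: poly_vec_def vec_eq_iff scaleR_conv_of_real[where 'a = complex])
    have "\<phi> (poly_vec (\<lambda>i. c i + smult (of_real t) (d i)) z) \<le> m"
    proof (rule poly_disc_maximum_principle[OF Y \<phi>(1,2)])
      fix z :: complex
      show "poly_vec (\<lambda>i. c i + smult (of_real t) (d i)) z \<in> Y" if "cmod z \<le> 1"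
        unfolding eq using t that by blast
      show "\<phi> (poly_vec (\<lambda>i. c i + smult (of_real t) (d i)) z) \<le> m" if "cmod z = 1"
        unfolding eq using m[of "(z, t)"] t that by simp
    qed (rule z)
    thus ?thesis unfolding eq L_def using t z by blast
  qed
  \<comment> \<open>A step of \<open>1 / n\<close> in the parameter moves no point of the disc by more than \<open>s\<close>.\<close>
  obtain n :: nat where n: "b / s < n" using reals_Archimedean2 by blast
  have n0: "0 < real n" using n b s by (meson divide_pos_pos less_trans)
  have bn: "b / real n \<le> s" using n n0 s by (simp add: divide_simps mult.commute)
  have "\<forall>z. cmod z \<le> 1 \<longrightarrow> poly_vec c z + (real k / real n) *\<^sub>R poly_vec d z \<in> Y" if "k \<le> n" for k
    using that
  proof (induction k)
    case 0 thus ?case using init by simp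
  next
    case (Suc k)
    show ?case
    proof (intro allI impI)
      fix z :: complex assume z: "cmod z \<le> 1"
      have "poly_vec c z + (real k / real n) *\<^sub>R poly_vec d z \<in> L"
        using Suc n0 z by (intro inL) (auto simp: divide_simps)
      moreover have "dist (poly_vec c z + (real k / real n) *\<^sub>R poly_vec d z) (poly_vec c z + (real (Suc k) / real n) *\<^sub>R poly_vec d z) \<le> s"
      proof -
        have "(poly_vec c z + (real (Suc k) / real n) *\<^sub>R poly_vec d z) - (poly_vec c z + (real k / real n) *\<^sub>R poly_vec d z) = (1 / real n) *\<^sub>R poly_vec d z"
          by (simp add: add_divide_distrib scaleR_add_left)
        hence "dist (poly_vec c z + (real k / real n) *\<^sub>R poly_vec d z) (poly_vec c z + (real (Suc k) / real n) *\<^sub>R poly_vec d z) = norm (poly_vec d z) / real n"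
          by (metis dist_commute dist_norm norm_scaleR abs_of_nonneg divide_inverse mult.commute mult_1 of_nat_0_le_iff zero_le_divide_1_iff)
        also have "\<dots> \<le> b / real n" using b(2)[OF z] by (intro divide_right_mono) auto
        finally show ?thesis using bn by linarith
      qed
      ultimately show "poly_vec c z + (real (Suc k) / real n) *\<^sub>R poly_vec d z \<in> Y"
        using s(2) by (meson UN_I mem_cball subsetD)
    qed
  qed
  from this[of n] n0 z show ?thesis by auto
qed

section \<open>Inscribed ellipsoids\<close>

definition inscribed :: "(complex^'n) set \<Rightarrow> complex^'n \<Rightarrow> complex^'n^'n \<Rightarrow> bool" where
  "inscribed Y y A \<longleftrightarrow> det A \<noteq> 0 \<and> (\<forall>u. norm u < 1 \<longrightarrow> y + A *v u \<in> Y)"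

text \<open>
  Closed ellipsoids, unlike open ones, still fit after small changes.
\<close>

definition fits :: "(complex^'n) set \<Rightarrow> complex^'n \<Rightarrow> complex^'n^'n \<Rightarrow> bool" where
  "fits Y y A \<longleftrightarrow> (\<forall>u. norm u \<le> 1 \<longrightarrow> y + A *v u \<in> Y)"

definition log_vol :: "complex^'n^'n \<Rightarrow> real" where
  "log_vol A = ln ((cmod (det A))\<^sup>2 * unit_vol TYPE('n))"

definition log_max_vol :: "(complex^'n) set \<Rightarrow> complex^'n \<Rightarrow> ereal" where
  "log_max_vol Y y = ln_ennreal (max_ellipsoid_vol Y y)"

lemma fits_imp_inscribed: "fits Y y A \<Longrightarrow> det A \<noteq> 0 \<Longrightarrow> inscribed Y y A"
  by (auto simp: fits_def inscribed_def)

lemma hermitian_ellipsoids_eq: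
  "(hermitian_ellipsoids :: (complex^'n) set set) = {(*v) A ` ball 0 1 | A. det A \<noteq> 0}"
proof (intro equalityI subsetI)
  fix E :: "(complex^'n) set" assume "E \<in> hermitian_ellipsoids"
  then obtain f :: "complex^'n \<Rightarrow> complex^'n" where f: "E = f ` ball 0 1" "Vector_Spaces.linear (*s) (*s) f" "bij f"
    unfolding hermitian_ellipsoids_def by blast
  have fe: "f = (*v) (matrix f)" using f(2) by (simp add: fun_eq_iff matrix_works)
  have "\<forall>x. matrix f *v x = 0 \<longrightarrow> x = 0"
  proof (intro allI impI)
    fix x assume "matrix f *v x = 0"
    hence "f x = f 0" using fe by (metis matrix_vector_mult_0_right)
    thus "x = 0" using f(3) by (simp add: bij_def inj_eq)
  qed
  then obtain B where "B ** matrix f = mat 1"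
    using matrix_left_invertible_ker[of "matrix f"] by blast
  hence "det B * det (matrix f) = 1" by (metis det_mul det_I)
  hence "det (matrix f) \<noteq> 0" by auto
  moreover have "E = (*v) (matrix f) ` ball 0 1" by (subst fe[symmetric]) (rule f(1))
  ultimately show "E \<in> {(*v) A ` ball 0 1 | A. det A \<noteq> 0}" by blast
next
  fix E :: "(complex^'n) set" assume "E \<in> {(*v) A ` ball 0 1 | A. det A \<noteq> 0}"
  then obtain A :: "complex^'n^'n" where A: "E = (*v) A ` ball 0 1" "det A \<noteq> 0" by blast
  obtain B where B: "A ** B = mat 1" "B ** A = mat 1"
    using A(2) by (auto simp: invertible_det_nz[symmetric] invertible_def)
  have "bij ((*v) A)"
    by (rule o_bij[of "(*v) B"]) (simp_all add: fun_eq_iff matrix_vector_mul_assoc B)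
  moreover have "Vector_Spaces.linear (*s) (*s) ((*v) A)" by simp
  ultimately show "E \<in> hermitian_ellipsoids" unfolding hermitian_ellipsoids_def A(1) by blast
qed

lemma translate_subset_iff: "(\<lambda>z. z + y) ` (*v) A ` ball 0 1 \<subseteq> Y \<longleftrightarrow> (\<forall>u. norm u < 1 \<longrightarrow> y + A *v u \<in> Y)"
  by (auto simp: subset_iff add.commute)

lemma max_ellipsoid_vol_ge:
  fixes A :: "complex^'n^'n"
  assumes "inscribed Y y A"
  shows "ennreal ((cmod (det A))\<^sup>2 * unit_vol TYPE('n)) \<le> max_ellipsoid_vol Y y"
proof -
  have "(*v) A ` ball 0 1 \<in> {E \<in> hermitian_ellipsoids. (\<lambda>z. z + y) ` E \<subseteq> Y}"
    using assms unfolding hermitian_ellipsoids_eq inscribed_def mem_Collect_eq translate_subset_iff by blast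
  hence "emeasure lborel ((*v) A ` ball 0 1) \<le> max_ellipsoid_vol Y y"
    unfolding max_ellipsoid_vol_def by (rule SUP_upper)
  thus ?thesis using emeasure_ellipsoid[of A] assms by (simp add: inscribed_def)
qed

lemma less_max_ellipsoid_vol:
  assumes "c < max_ellipsoid_vol Y (y :: complex^'n)"
  shows "\<exists>A. inscribed Y y A \<and> c < ennreal ((cmod (det A))\<^sup>2 * unit_vol TYPE('n))"
proof -
  obtain E where E: "E \<in> hermitian_ellipsoids" "(\<lambda>z. z + y) ` E \<subseteq> Y" "c < emeasure lborel E"
    using assms unfolding max_ellipsoid_vol_def less_SUP_iff by blast
  then obtain A :: "complex^'n^'n" where A: "E = (*v) A ` ball 0 1" "det A \<noteq> 0"
    unfolding hermitian_ellipsoids_eq by blast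
  have "inscribed Y y A" using E(2) A(2) unfolding A(1) translate_subset_iff inscribed_def by blast
  moreover have "c < ennreal ((cmod (det A))\<^sup>2 * unit_vol TYPE('n))" using E(3) emeasure_ellipsoid[OF A(2)] A(1) by simp
  ultimately show ?thesis by blast
qed

lemma vol_pos: "det (A :: complex^'n^'n) \<noteq> 0 \<Longrightarrow> 0 < (cmod (det A))\<^sup>2 * unit_vol TYPE('n)"
  using unit_vol_pos[where 'n = 'n] by simp

lemma log_vol_le_log_max_vol:
  assumes "inscribed Y y A"
  shows "ereal (log_vol A) \<le> log_max_vol Y y"
proof -
  have v: "0 < (cmod (det A))\<^sup>2 * unit_vol TYPE('a)" using assms vol_pos by (auto simp: inscribed_def)
  have le: "ennreal ((cmod (det A))\<^sup>2 * unit_vol TYPE('a)) \<le> max_ellipsoid_vol Y y" by (rule max_ellipsoid_vol_ge[OF assms])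
  show ?thesis
  proof (cases "max_ellipsoid_vol Y y" rule: ennreal_cases)
    case (real x)
    hence "(cmod (det A))\<^sup>2 * unit_vol TYPE('a) \<le> x" using le by (simp add: ennreal_le_iff)
    moreover from this v have "0 < x" by linarith
    ultimately show ?thesis using v real
      by (simp add: log_max_vol_def log_vol_def ln_ennreal_def ennreal_eq_0_iff ln_mono)
  qed (simp add: log_max_vol_def ln_ennreal_def)
qed

lemma less_log_max_vol:
  fixes y :: "complex^'n"
  assumes "ereal c < log_max_vol Y y"
  shows "\<exists>A. inscribed Y y A \<and> c < log_vol A"
proof -
  have "ennreal (exp c) < max_ellipsoid_vol Y y"
  proof (cases "max_ellipsoid_vol Y y" rule: ennreal_cases)
    case (real x)
    with assms have "x \<noteq> 0" by (auto simp: log_max_vol_def ln_ennreal_def)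
    hence x: "0 < x" using real by simp
    hence "c < ln x" using assms real by (simp add: log_max_vol_def ln_ennreal_def ennreal_eq_0_iff)
    hence "exp c < x" using x by (metis exp_less_cancel_iff exp_ln)
    thus ?thesis using real by (simp add: ennreal_less_iff)
  qed simp
  then obtain A where A: "inscribed Y y A" "ennreal (exp c) < ennreal ((cmod (det A))\<^sup>2 * unit_vol TYPE('n))"
    using less_max_ellipsoid_vol by blast
  hence "exp c < (cmod (det A))\<^sup>2 * unit_vol TYPE('n)" by (simp add: ennreal_less_iff)
  hence "c < log_vol A" unfolding log_vol_def by (metis exp_gt_zero exp_less_cancel_iff exp_ln less_trans)
  with A(1) show ?thesis by blast
qed

lemma log_max_vol_gt_minf: "open Y \<Longrightarrow> y \<in> Y \<Longrightarrow> - \<infinity> < log_max_vol Y y"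
  using max_ellipsoid_vol_pos[of Y y] by (auto simp: log_max_vol_def ln_ennreal_def)

lemma det_scaleR: "det (r *\<^sub>R A) = of_real r ^ CARD('n) * det A" for A :: "complex^'n^'n"
proof -
  have "r *\<^sub>R A = (\<chi> i. of_real r *s A $ i)"
    by (simp add: vec_eq_iff scaleR_conv_of_real[where 'a = complex])
  thus ?thesis using det_rows_mul[of "\<lambda>i::'n. complex_of_real r" "\<lambda>i. A $ i"] by simp
qed

lemma log_vol_scaleR:
  fixes A :: "complex^'n^'n"
  assumes "0 < r" "det A \<noteq> 0"
  shows "log_vol (r *\<^sub>R A) = 2 * real CARD('n) * ln r + log_vol A"
  using assms unit_vol_pos[where 'n = 'n]
  by (simp add: log_vol_def det_scaleR norm_mult norm_power power_mult_distrib ln_mult ln_realpow)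

lemma log_vol_eq: "det (A :: complex^'n^'n) \<noteq> 0 \<Longrightarrow> log_vol A = 2 * ln (cmod (det A)) + ln (unit_vol TYPE('n))"
  using unit_vol_pos[where 'n = 'n] by (simp add: log_vol_def ln_mult ln_realpow)

text \<open>
  The ellipsoid with frame \<open>r A\<close>, \<open>r < 1\<close>, moved by a vector \<open>v\<close> with \<open>\<bar>A\<^sup>-\<^sup>1 v\<bar> < 1 - r\<close> stays inside
  the original one, and its logarithmic volume is nearly the same.
\<close>

lemma inscribed_robust:
  fixes A :: "complex^'n^'n"
  assumes A: "inscribed Y y A" "c < log_vol A"
  shows "\<exists>A' \<rho>. 0 < \<rho> \<and> det A' \<noteq> 0 \<and> c < log_vol A' \<and> (\<forall>y'. dist y' y < \<rho> \<longrightarrow> fits Y y' A')"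
proof -
  have d: "det A \<noteq> 0" using A by (simp add: inscribed_def)
  obtain B where B: "A ** B = mat 1" using d by (auto simp: invertible_det_nz[symmetric] invertible_def)
  define \<tau> where "\<tau> = (log_vol A - c) / (4 * real CARD('n))"
  have \<tau>: "0 < \<tau>" using A(2) by (simp add: \<tau>_def)
  define r where "r = exp (- \<tau>)"
  have r: "0 < r" "r < 1" using \<tau> by (auto simp: r_def)
  have "log_vol (r *\<^sub>R A) = log_vol A - (log_vol A - c) / 2"
    using log_vol_scaleR[OF r(1) d] by (simp add: r_def \<tau>_def)
  hence lv: "c < log_vol (r *\<^sub>R A)" using A(2) by (simp add: field_simps)
  define \<rho> where "\<rho> = (1 - r) / (norm B + 1)"
  have \<rho>: "0 < \<rho>" "norm B * \<rho> \<le> 1 - r"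
  proof -
    have nb: "0 < norm B + 1" by (simp add: add_nonneg_pos)
    thus "0 < \<rho>" using r by (simp add: \<rho>_def)
    have "norm B * \<rho> = (1 - r) * (norm B / (norm B + 1))" by (simp add: \<rho>_def)
    also have "\<dots> \<le> (1 - r) * 1" using nb r by (intro mult_left_mono) (auto simp: divide_le_eq)
    finally show "norm B * \<rho> \<le> 1 - r" by simp
  qed
  have "fits Y y' (r *\<^sub>R A)" if y': "dist y' y < \<rho>" for y'
    unfolding fits_def
  proof (intro allI impI)
    fix u :: "complex^'n" assume u: "norm u \<le> 1"
    define v where "v = r *\<^sub>R u + B *v (y' - y)"
    have "norm v < 1"
    proof (cases "norm B = 0")
      case True
      hence "B = 0" by simp
      hence "norm v = r * norm u" using r by (simp add: v_def)
      also have "\<dots> \<le> r * 1" using u r by (intro mult_left_mono) auto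
      finally show ?thesis using r by simp
    next
      case False
      have "norm v \<le> r * norm u + norm B * norm (y' - y)"
        unfolding v_def by (intro order.trans[OF norm_triangle_ineq] add_mono norm_mv) (use r in simp)
      also have "r * norm u + norm B * norm (y' - y) \<le> r * 1 + norm B * norm (y' - y)"
        using u r by (intro add_right_mono mult_left_mono) auto
      also have "\<dots> < r * 1 + norm B * \<rho>"
        using False y' by (intro add_strict_left_mono mult_strict_left_mono) (auto simp: dist_norm)
      finally show ?thesis using \<rho> by simp
    qed
    moreover have "y' + (r *\<^sub>R A) *v u = y + A *v v"
      by (simp add: v_def matrix_vector_right_distrib matrix_vector_mul_assoc B scaleR_mv
          linear_scale[OF matrix_vector_mul_linear])
    ultimately show "y' + (r *\<^sub>R A) *v u \<in> Y" using A(1) by (simp add: inscribed_def)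
  qed
  moreover have "det (r *\<^sub>R A) \<noteq> 0" using d r by (simp add: det_scaleR)
  ultimately show ?thesis using lv \<rho>(1) by blast
qed

lemma open_less_log_max_vol: "open {y :: complex^'n. a < log_max_vol Y y}"
  unfolding open_dist
proof
  fix y assume "y \<in> {y. a < log_max_vol Y y}"
  then obtain c where c: "a < ereal c" "ereal c < log_max_vol Y y" using ereal_dense2 by blast
  obtain A where "inscribed Y y A" "c < log_vol A" using less_log_max_vol[OF c(2)] by blast
  from inscribed_robust[OF this] obtain A' \<rho> where A': "0 < \<rho>" "det A' \<noteq> 0" "c < log_vol A'"
    "\<And>y'. dist y' y < \<rho> \<Longrightarrow> fits Y y' A'" by blast
  have "a < log_max_vol Y y'" if "dist y' y < \<rho>" for y'
  proof -
    have "ereal c < ereal (log_vol A')" using A' by simp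
    also have "\<dots> \<le> log_max_vol Y y'" by (intro log_vol_le_log_max_vol fits_imp_inscribed A' that)
    finally show ?thesis using c(1) by order
  qed
  thus "\<exists>e>0. \<forall>y'. dist y' y < e \<longrightarrow> y' \<in> {y. a < log_max_vol Y y}"
    using A'(1) by auto
qed

section \<open>Discs of ellipsoids\<close>

lemma infinite_circ: "infinite circ"
proof
  assume "finite circ"
  have inj: "inj_on cis {0..1}"
  proof (rule inj_onI)
    fix x y :: real assume xy: "x \<in> {0..1}" "y \<in> {0..1}" "cis x = cis y"
    have "cos x = cos y" using arg_cong[OF xy(3), of Re] by simp
    moreover have "0 \<le> x" "x \<le> pi" "0 \<le> y" "y \<le> pi" using xy(1,2) pi_gt3 by auto
    ultimately show "x = y" using cos_inj_pi by blast
  qed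
  have "cis ` {0..1} \<subseteq> circ" by auto
  hence "finite (cis ` {0..1})" using \<open>finite circ\<close> by (rule finite_subset)
  hence "finite {0..1::real}" using inj by (rule finite_imageD)
  thus False by (simp add: infinite_Icc)
qed

lemma det_pencil_poly: "\<exists>p. \<forall>x. det (cscale x (mat 1) + A) = poly p x" for A :: "complex^'n^'n"
proof -
  have "det (cscale x (mat 1) + A) = poly (\<Sum>\<sigma> | \<sigma> permutes UNIV. smult (of_int (sign \<sigma>))
      (\<Prod>i\<in>UNIV. [: A $ i $ \<sigma> i, if i = \<sigma> i then 1 else 0 :])) x" for x
    unfolding det_def poly_sum poly_smult poly_prod
    by (intro sum.cong refl arg_cong2[where f = "(*)"] prod.cong) (auto simp: mat_def)
  thus ?thesis by blast
qed

lemma det_cscale: "det (cscale c A) = c ^ CARD('n) * det A" for A :: "complex^'n^'n"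
proof -
  have "cscale c A = (\<chi> i. c *s A $ i)" by (simp add: vec_eq_iff)
  thus ?thesis using det_rows_mul[of "\<lambda>i::'n. c" "\<lambda>i. A $ i"] by simp
qed

text \<open>
  Replacing \<open>A\<close> by \<open>\<theta> A\<close> does not change the ellipsoid. The segment from a positive scalar matrix to
  \<open>\<theta> A\<close> meets the singular matrices only if \<open>\<theta> A\<close> has a negative eigenvalue, which excludes finitely
  many \<open>\<theta>\<close>.
\<close>

lemma rotate_to_scalars:
  fixes A :: "complex^'n^'n"
  assumes "det A \<noteq> 0"
  shows "\<exists>\<theta>. cmod \<theta> = 1 \<and> (\<forall>\<eta>>0. \<forall>s\<in>{0..1}. det (((1 - s) * \<eta>) *\<^sub>R mat 1 + s *\<^sub>R cscale \<theta> A) \<noteq> 0)"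
proof -
  obtain p where p: "\<And>x. det (cscale x (mat 1) + A) = poly p x" using det_pencil_poly by blast
  have "poly p 0 = det A" using p[of 0] by simp
  hence "p \<noteq> 0" using assms by auto
  hence "finite {x. poly p x = 0}" by (rule poly_roots_finite)
  hence "finite ((\<lambda>x. cnj (x / of_real (cmod x))) ` {x. poly p x = 0})" by (rule finite_imageI)
  hence "\<not> circ \<subseteq> (\<lambda>x. cnj (x / of_real (cmod x))) ` {x. poly p x = 0}"
    using infinite_circ by (metis finite_subset)
  then obtain \<theta> where \<theta>: "\<theta> \<in> circ" "\<theta> \<notin> (\<lambda>x. cnj (x / of_real (cmod x))) ` {x. poly p x = 0}"
    by blast
  have \<theta>1: "cmod \<theta> = 1" using \<theta>(1) by simp
  have \<theta>\<theta>: "\<theta> * cnj \<theta> = 1" using \<theta>1 by (simp flip: complex_norm_square)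
  have "det (((1 - s) * \<eta>) *\<^sub>R mat 1 + s *\<^sub>R cscale \<theta> A) \<noteq> 0" if \<eta>: "0 < \<eta>" and s: "s \<in> {0..1}" for \<eta> s :: real
  proof (cases "s = 0")
    case True
    thus ?thesis using \<eta> by (simp add: det_scaleR)
  next
    case False
    hence s0: "0 < s" using s by simp
    define x where "x = (1 - s) * \<eta> / s"
    have x: "0 \<le> x" using s \<eta> s0 by (simp add: x_def)
    have "((1 - s) * \<eta>) *\<^sub>R mat 1 + s *\<^sub>R cscale \<theta> A = cscale (of_real s * \<theta>) (cscale (of_real x * cnj \<theta>) (mat 1) + A)"
    proof -
      have "of_real s * \<theta> * (of_real x * cnj \<theta>) = of_real s * of_real x * (\<theta> * cnj \<theta>)" by (simp add: mult_ac)
      also have "\<dots> = of_real (s * x)" unfolding \<theta>\<theta> by simp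
      also have "s * x = (1 - s) * \<eta>" using s0 by (simp add: x_def)
      finally have key: "of_real s * \<theta> * (of_real x * cnj \<theta>) = of_real ((1 - s) * \<eta>)" .
      have "cscale (of_real s * \<theta>) (cscale (of_real x * cnj \<theta>) (mat 1) + A) =
          cscale (of_real s * \<theta> * (of_real x * cnj \<theta>)) (mat 1) + cscale (of_real s) (cscale \<theta> A)"
        by (simp only: cscale_add cscale_cscale)
      thus ?thesis by (simp only: key cscale_of_real)
    qed
    hence "det (((1 - s) * \<eta>) *\<^sub>R mat 1 + s *\<^sub>R cscale \<theta> A) = (of_real s * \<theta>) ^ CARD('n) * poly p (of_real x * cnj \<theta>)"
      by (simp only: det_cscale p)
    moreover have "poly p (of_real x * cnj \<theta>) \<noteq> 0"
    proof
      assume root: "poly p (of_real x * cnj \<theta>) = 0"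
      show False
      proof (cases "x = 0")
        case True
        thus False using root \<open>poly p 0 = det A\<close> assms by simp
      next
        case False
        hence "cnj ((of_real x * cnj \<theta>) / of_real (cmod (of_real x * cnj \<theta>))) = \<theta>"
          using x \<theta>1 by (simp add: norm_mult)
        hence "\<theta> \<in> (\<lambda>x. cnj (x / of_real (cmod x))) ` {x. poly p x = 0}"
          using root by (intro image_eqI[of _ _ "of_real x * cnj \<theta>"]) auto
        thus False using \<theta>(2) by blast
      qed
    qed
    ultimately show ?thesis using s0 \<theta>1 by auto
  qed
  thus ?thesis using \<theta>1 by blast
qed

lemma fits_cscale:
  assumes "fits Y y A" "cmod \<theta> = 1"
  shows "fits Y y (cscale \<theta> A)"
  unfolding fits_def
proof (intro allI impI)
  fix u :: "complex^'a" assume "norm u \<le> 1"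
  hence "norm (\<theta> *s u) \<le> 1" using assms(2) by (simp add: norm_smult_vec)
  moreover have "cscale \<theta> A *v u = A *v (\<theta> *s u)"
    by (simp add: vec_eq_iff matrix_vector_mult_def mult_ac)
  ultimately show "y + cscale \<theta> A *v u \<in> Y" using assms(1) by (simp add: fits_def)
qed

text \<open>
  The segment from \<open>\<eta> 1\<close> to \<open>A\<close> consists of matrices mapping the ball into its image under \<open>A\<close>, which is
  convex, as soon as \<open>\<eta> 1\<close> does.
\<close>

lemma fits_towards_scalar:
  fixes A B :: "complex^'n^'n"
  assumes "fits Y y A" "A ** B = mat 1" "0 \<le> \<eta>" "\<eta> * norm B \<le> 1" "s \<in> {0..1}"
  shows "fits Y y (((1 - s) * \<eta>) *\<^sub>R mat 1 + s *\<^sub>R A)"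
  unfolding fits_def
proof (intro allI impI)
  fix u :: "complex^'n" assume u: "norm u \<le> 1"
  define v where "v = (1 - s) *\<^sub>R (\<eta> *\<^sub>R (B *v u)) + s *\<^sub>R u"
  have "norm (\<eta> *\<^sub>R (B *v u)) \<le> \<eta> * (norm B * norm u)" using norm_mv[of B u] assms(3) by (simp add: mult_left_mono)
  also have "\<dots> \<le> \<eta> * (norm B * 1)" using u assms(3) by (intro mult_left_mono) auto
  finally have "norm (\<eta> *\<^sub>R (B *v u)) \<le> 1" using assms(4) by simp
  hence "(1 - s) *\<^sub>R (\<eta> *\<^sub>R (B *v u)) + s *\<^sub>R u \<in> cball 0 1"
    using u assms(5) by (intro convexD[OF convex_cball]) auto
  hence "norm v \<le> 1" by (simp add: v_def)
  moreover have "(((1 - s) * \<eta>) *\<^sub>R mat 1 + s *\<^sub>R A) *v u = A *v v"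
    by (simp add: v_def matrix_vector_mult_add_rdistrib matrix_vector_right_distrib scaleR_mv
        linear_scale[OF matrix_vector_mul_linear] matrix_vector_mul_assoc assms(2))
  ultimately show "y + (((1 - s) * \<eta>) *\<^sub>R mat 1 + s *\<^sub>R A) *v u \<in> Y"
    using assms(1) by (simp add: fits_def)
qed

lemma log_vol_gap_arith:
  fixes h L D lB lM nl u g c :: real
  assumes "h \<le> L + D" "lB = lM - 2 * nl" "lM = 2 * D + u" "nl + L \<le> g / 4" "0 < g" "g = 2 * h + u - c"
  shows "c < lB"
  using assms by linarith

text \<open>
  The approximate spectral factor \<open>P\<close>, slightly shrunk, maps the ball into the given ellipsoid at
  each boundary point. The continuity principle is applied to the discs \<open>y + z d + t P(z) u\<close> with \<open>u\<close>
  in the ball and \<open>t\<close> growing from \<open>0\<close> to \<open>1\<close>.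
\<close>

theorem fits_at_center:
  fixes A :: "complex \<Rightarrow> complex^'n^'n"
  assumes pc: "pseudoconvex Y" and A: "circle_frame A"
    and disc: "\<And>z. cmod z \<le> 1 \<Longrightarrow> y + z *s d \<in> Y"
    and fitsA: "\<And>z. z \<in> circ \<Longrightarrow> fits Y (y + z *s d) (A z)"
    and c: "c < 2 * circle_avg (\<lambda>w. ln (cmod (det (A w)))) + ln (unit_vol TYPE('n))"
  shows "\<exists>B. inscribed Y y B \<and> c < log_vol B"
proof -
  interpret circle_frame A by (rule A)
  define g where "g = 2 * log_det_mean + ln (unit_vol TYPE('n)) - c"
  have g: "0 < g" using c by (simp add: g_def log_det_mean_def)
  \<comment> \<open>The determinant of the factor loses \<open>2 log (1 + e)\<close> and shrinking it loses \<open>2 CARD('n) log (1 + e)\<close>, together at most \<open>g / 2\<close>.\<close>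
  define e where "e = g / (4 * (real CARD('n) + 1))"
  have e: "0 < e" using g by (simp add: e_def add_nonneg_pos)
  obtain N M where NM: "\<And>z u. z \<in> circ \<Longrightarrow> \<exists>v. (\<Sum>p\<le>N. cscale (z ^ p) (M p)) *v u = A z *v v \<and> norm v \<le> (1 + e) * norm u"
    and dM: "exp log_det_mean \<le> (1 + e) * cmod (det (M 0))"
    using approximate_spectral_factor[OF e] by blast
  define B where "B = (1 / (1 + e)) *\<^sub>R M 0"
  have e1: "0 < 1 / (1 + e)" using e by simp
  have "0 < (1 + e) * cmod (det (M 0))" using dM exp_gt_zero[of log_det_mean] by linarith
  hence dM0: "det (M 0) \<noteq> 0" by auto
  hence dB: "det B \<noteq> 0"
  proof -
    have "1 / (1 + e) \<noteq> 0" using e1 by (rule less_imp_neq[symmetric])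
    thus ?thesis using dM0 unfolding B_def det_scaleR mult_eq_0_iff power_eq_0_iff of_real_eq_0_iff by blast
  qed
  have "ln (exp log_det_mean) \<le> ln ((1 + e) * cmod (det (M 0)))"
    using dM by (intro ln_mono) auto
  hence ldm: "log_det_mean \<le> ln (1 + e) + ln (cmod (det (M 0)))"
    using e dM0 by (simp add: ln_mult)
  define nl where "nl = real CARD('n) * ln (1 + e)"
  note ldm
  moreover have "log_vol B = log_vol (M 0) - 2 * nl"
    unfolding nl_def B_def log_vol_scaleR[OF e1 dM0] using e by (simp add: ln_div)
  moreover have "log_vol (M 0) = 2 * ln (cmod (det (M 0))) + ln (unit_vol TYPE('n))" by (rule log_vol_eq[OF dM0])
  moreover have "nl + ln (1 + e) \<le> g / 4"
  proof -
    define K where "K = real CARD('n) + 1"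
    have K: "0 < K" by (simp add: K_def add_nonneg_pos)
    have "K * ln (1 + e) \<le> K * e"
      using e K by (intro mult_left_mono ln_add_one_self_le_self) auto
    also have "K * e = g / 4" using K by (simp add: e_def flip: K_def)
    finally show ?thesis by (simp add: K_def nl_def distrib_right)
  qed
  ultimately have "c < log_vol B"
    using g g_def log_vol_gap_arith[of log_det_mean "ln (1 + e)" "ln (cmod (det (M 0)))" "log_vol B" "log_vol (M 0)" nl "ln (unit_vol TYPE('n))" g c]
    by blast
  hence lv: "c < log_vol B" .
  have "y + B *v u \<in> Y" if u: "norm u \<le> 1" for u
  proof -
    define cc where "cc i = [: y $ i, d $ i :]" for i
    define dd where "dd i = smult (of_real (1 / (1 + e))) (\<Sum>p\<le>N. monom ((M p *v u) $ i) p)" for i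
    have C: "poly_vec cc z = y + z *s d" for z
      by (simp add: poly_vec_def cc_def vec_eq_iff)
    have D: "poly_vec dd z = (1 / (1 + e)) *\<^sub>R ((\<Sum>p\<le>N. cscale (z ^ p) (M p)) *v u)" for z
    proof -
      have "(\<Sum>p\<le>N. cscale (z ^ p) (M p)) *v u = (\<Sum>p\<le>N. cscale (z ^ p) (M p) *v u)"
        by (rule linear_sum[OF linear_mv_left])
      moreover have "(cscale (z ^ p) (M p) *v u) $ i = (M p *v u) $ i * z ^ p" for p i
        by (simp add: matrix_vector_mult_def sum_distrib_right sum_distrib_left mult_ac)
      ultimately show ?thesis
        by (simp add: poly_vec_def dd_def vec_eq_iff poly_sum poly_monom scaleR_conv_of_real[where 'a = complex])
    qed
    have "poly_vec cc 0 + poly_vec dd 0 \<in> Y"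
    proof (rule disc_continuity_principle[OF pc])
      fix z :: complex and t :: real assume z: "cmod z = 1" and t: "0 \<le> t" "t \<le> 1"
      hence zc: "z \<in> circ" by simp
      obtain v where v: "(\<Sum>p\<le>N. cscale (z ^ p) (M p)) *v u = A z *v v" "norm v \<le> (1 + e) * norm u"
        using NM[OF zc] by blast
      have "poly_vec cc z + t *\<^sub>R poly_vec dd z = (y + z *s d) + A z *v ((t / (1 + e)) *\<^sub>R v)"
        by (simp add: C D v(1) linear_scale[OF matrix_vector_mul_linear])
      moreover have "norm ((t / (1 + e)) *\<^sub>R v) \<le> 1"
      proof -
        have "(1 + e) * norm u \<le> (1 + e) * 1" using u e by (intro mult_left_mono) auto
        hence "norm v \<le> (1 + e) * 1" using v(2) by linarith
        hence "(t / (1 + e)) * norm v \<le> (t / (1 + e)) * (1 + e)" using t e by (intro mult_left_mono) auto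
        moreover have "(t / (1 + e)) * (1 + e) = t" using e by simp
        moreover have "norm ((t / (1 + e)) *\<^sub>R v) = (t / (1 + e)) * norm v" using t e by simp
        ultimately show ?thesis using t by linarith
      qed
      ultimately show "poly_vec cc z + t *\<^sub>R poly_vec dd z \<in> Y"
        using fitsA[OF zc] by (simp add: fits_def)
    next
      fix z :: complex assume "cmod z \<le> 1"
      thus "poly_vec cc z \<in> Y" using disc by (simp add: C)
    qed simp
    thus ?thesis by (simp add: C D matrix_poly_0 B_def scaleR_mv)
  qed
  hence "inscribed Y y B" using dB by (simp add: inscribed_def)
  with lv show ?thesis by blast
qed

section \<open>Piecewise constant ellipsoids on the circle\<close>

definition circle_arc :: "nat \<Rightarrow> nat \<Rightarrow> real set" where
  "circle_arc N j = {2 * pi * real j / real N .. 2 * pi * real (Suc j) / real N}"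

text \<open>
  Points of the circle are addressed by the distance to this closed set, which avoids a
  continuous choice of the argument.
\<close>

definition off_arc :: "nat \<Rightarrow> nat \<Rightarrow> complex set" where
  "off_arc N j = cis ` ({0..2*pi} - {2 * pi * real j / real N <..< 2 * pi * real (Suc j) / real N})"

lemma arc_subset: "j < N \<Longrightarrow> circle_arc N j \<subseteq> {0..2*pi}"
proof -
  assume j: "j < N"
  hence "2 * pi * real (Suc j) / real N \<le> 2 * pi * real N / real N"
    by (intro divide_right_mono mult_left_mono) auto
  thus ?thesis using j by (auto simp: circle_arc_def intro: order.trans[rotated])
qed

lemma arc_cover:
  assumes "t \<in> {0..2*pi}" "0 < N"
  shows "\<exists>j<N. t \<in> circle_arc N j"
proof (cases "t = 2 * pi")
  case True
  have "t \<in> circle_arc N (N - 1)" using assms(2) by (simp add: circle_arc_def True divide_simps)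
  thus ?thesis using assms(2) by (intro exI[of _ "N - 1"]) auto
next
  case False
  define x where "x = t * real N / (2 * pi)"
  have x: "0 \<le> x" "x < real N"
    using assms False by (auto simp: x_def divide_simps)
  define j where "j = nat \<lfloor>x\<rfloor>"
  have j: "real j \<le> x" "x < real j + 1" using x by (auto simp: j_def)
  hence "j < N" using x by linarith
  moreover have "t = 2 * pi * x / real N" using assms(2) by (simp add: x_def)
  hence "t \<in> circle_arc N j"
    using j assms(2) by (auto simp: circle_arc_def intro!: divide_right_mono mult_left_mono)
  ultimately show ?thesis by blast
qed

lemma cis_off_arc: "t \<in> {0..2*pi} \<Longrightarrow> t \<notin> {2 * pi * real j / real N <..< 2 * pi * real (Suc j) / real N} \<Longrightarrow> cis t \<in> off_arc N j"
  unfolding off_arc_def by blast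

lemma off_arc_closed: "compact (off_arc N j)"
  unfolding off_arc_def
proof (intro compact_continuous_image)
  show "compact ({0..2*pi} - {2 * pi * real j / real N <..< 2 * pi * real (Suc j) / real N})"
    by (intro compact_diff) auto
qed (intro continuous_intros)

lemma cis_eq_imp_eq:
  assumes "cis s = cis t" "0 < t" "t < 2 * pi" "0 \<le> s" "s \<le> 2 * pi"
  shows "s = t"
proof -
  have "sin s = sin t \<and> cos s = cos t" using assms(1) by (simp add: complex_eq_iff)
  then obtain n :: int where n: "s = t + 2 * pi * of_int n" using sin_cos_eq_iff by blast
  have "- (2 * pi) < 2 * pi * of_int n" "2 * pi * of_int n < 2 * pi" using n assms by linarith+
  hence "2 * pi * (-1) < 2 * pi * real_of_int n" "2 * pi * real_of_int n < 2 * pi * 1" by simp_all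
  hence "- 1 < real_of_int n" "real_of_int n < 1" by (simp_all only: mult_less_cancel_left_pos[of "2 * pi"] pi_gt_zero zero_less_mult_iff zero_less_numeral simp_thms)
  hence "n = 0" by linarith
  thus ?thesis using n by simp
qed

lemma off_arc_nonempty: "off_arc N j \<noteq> {}"
proof -
  have "0 \<notin> {2 * pi * real j / real N <..< 2 * pi * real (Suc j) / real N}" by (auto simp: not_less)
  hence "cis 0 \<in> off_arc N j" by (intro cis_off_arc) auto
  thus ?thesis by blast
qed

lemma arc_interior_infdist:
  assumes "j < N" "t \<in> {2 * pi * real j / real N <..< 2 * pi * real (Suc j) / real N}"
  shows "0 < infdist (cis t) (off_arc N j)"
proof -
  have t: "0 < t" "t < 2 * pi"
  proof -
    have "0 \<le> 2 * pi * real j / real N" by simp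
    moreover have "t < 2 * pi * real (Suc j) / real N" "2 * pi * real j / real N < t" using assms(2) by auto
    moreover have "2 * pi * real (Suc j) / real N \<le> 2 * pi"
      using arc_subset[OF assms(1)] by (auto simp: circle_arc_def subset_iff divide_right_mono)
    ultimately show "0 < t" "t < 2 * pi" by linarith+
  qed
  have "cis t \<notin> off_arc N j"
  proof
    assume "cis t \<in> off_arc N j"
    then obtain s where s: "cis s = cis t" "s \<in> {0..2*pi}" "s \<notin> {2 * pi * real j / real N <..< 2 * pi * real (Suc j) / real N}"
      unfolding off_arc_def by auto
    from cis_eq_imp_eq[OF s(1) t] s(2,3) assms(2) show False by auto
  qed
  thus ?thesis
    using in_closed_iff_infdist_zero[OF compact_imp_closed[OF off_arc_closed] off_arc_nonempty]
    by (metis infdist_nonneg order_le_less)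
qed

lemma arc_disjoint_interior:
  assumes "t \<in> circle_arc N j" "i \<noteq> j"
  shows "t \<notin> {2 * pi * real i / real N <..< 2 * pi * real (Suc i) / real N}"
proof
  assume t: "t \<in> {2 * pi * real i / real N <..< 2 * pi * real (Suc i) / real N}"
  have mono: "2 * pi * real a / real N \<le> 2 * pi * real b / real N" if "a \<le> b" for a b
    using that by (intro divide_right_mono mult_left_mono) auto
  show False
  proof (cases "i < j")
    case True
    hence "2 * pi * real (Suc i) / real N \<le> 2 * pi * real j / real N" by (intro mono) simp
    thus False using t assms(1) by (simp add: circle_arc_def)
  next
    case False
    hence "2 * pi * real (Suc j) / real N \<le> 2 * pi * real i / real N" using assms(2) by (intro mono) simp
    thus False using t assms(1) by (simp add: circle_arc_def)
  qed
qed

lemma integral_arcs: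
  fixes f :: "real \<Rightarrow> real"
  assumes "f integrable_on {0..2*pi}" "0 < N"
  shows "integral {0..2*pi} f = (\<Sum>j<N. integral (circle_arc N j) f)"
proof -
  have "integral {0..2 * pi * real k / real N} f = (\<Sum>j<k. integral (circle_arc N j) f)" if "k \<le> N" for k
    using that
  proof (induction k)
    case (Suc k)
    have le: "2 * pi * real (Suc k) / real N \<le> 2 * pi"
      using Suc.prems assms(2) by (simp add: divide_simps)
    have "integral {0..2 * pi * real (Suc k) / real N} f =
        integral {0..2 * pi * real k / real N} f + integral (circle_arc N k) f"
      unfolding circle_arc_def
    proof (rule Henstock_Kurzweil_Integration.integral_combine[symmetric])
      show "f integrable_on {0..2 * pi * real (Suc k) / real N}"
        by (rule integrable_subinterval_real[OF assms(1)]) (use le in auto)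
    qed (auto simp: divide_right_mono)
    thus ?case using Suc by simp
  qed simp
  from this[of N] show ?thesis using assms(2) by simp
qed

definition bump :: "nat \<Rightarrow> nat \<Rightarrow> nat \<Rightarrow> complex \<Rightarrow> real" where
  "bump N k j z = min 1 (real k * infdist z (off_arc N j))"

lemma bump_range: "bump N k j z \<in> {0..1}"
  by (auto simp: bump_def infdist_nonneg)

lemma continuous_on_bump [continuous_intros]: "continuous_on S (bump N k j)"
  unfolding bump_def by (intro continuous_intros continuous_on_infdist continuous_on_id)

text \<open>
  On each arc this moves from \<open>\<eta> 1\<close> at the end points to the prescribed matrix \<open>A j\<close> inside, ever
  faster as \<open>k\<close> grows; at most one summand is different from \<open>0\<close>.
\<close>

definition arc_frame :: "nat \<Rightarrow> real \<Rightarrow> (nat \<Rightarrow> complex^'n^'n) \<Rightarrow> nat \<Rightarrow> complex \<Rightarrow> complex^'n^'n" where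
  "arc_frame N \<eta> A k z = \<eta> *\<^sub>R mat 1 + (\<Sum>j<N. bump N k j z *\<^sub>R (A j - \<eta> *\<^sub>R mat 1))"

lemma arc_frame_on_arc:
  assumes "j < N" "t \<in> circle_arc N j"
  shows "arc_frame N \<eta> A k (cis t) = ((1 - bump N k j (cis t)) * \<eta>) *\<^sub>R mat 1 + bump N k j (cis t) *\<^sub>R A j"
proof -
  have t: "t \<in> {0..2*pi}" using arc_subset assms by blast
  have "bump N k i (cis t) = 0" if "i \<noteq> j" for i
  proof -
    have "cis t \<in> off_arc N i" by (rule cis_off_arc[OF t arc_disjoint_interior[OF assms(2) that]])
    thus ?thesis by (simp add: bump_def)
  qed
  hence "(\<Sum>i<N. bump N k i (cis t) *\<^sub>R (A i - \<eta> *\<^sub>R mat 1)) = (\<Sum>i<N. if i = j then bump N k j (cis t) *\<^sub>R (A j - \<eta> *\<^sub>R mat 1) else 0)"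
    by (intro sum.cong) auto
  thus ?thesis using assms(1) by (simp add: arc_frame_def algebra_simps)
qed

text \<open>
  Dominated convergence on each arc: the logarithms are bounded because the segments avoid the
  singular matrices.
\<close>

lemma arc_frame_log_det_limit:
  fixes A :: "nat \<Rightarrow> complex^'n^'n"
  assumes N: "0 < N" and nz: "\<And>j s. j < N \<Longrightarrow> s \<in> {0..1} \<Longrightarrow> det (((1 - s) * \<eta>) *\<^sub>R mat 1 + s *\<^sub>R A j) \<noteq> 0"
    and frame: "\<And>k. circle_frame (arc_frame N \<eta> A k)"
  shows "(\<lambda>k. circle_avg (\<lambda>w. ln (cmod (det (arc_frame N \<eta> A k w))))) \<longlonglongrightarrow> (\<Sum>j<N. ln (cmod (det (A j)))) / real N"
proof -
  define h where "h k w = ln (cmod (det (arc_frame N \<eta> A k w)))" for k w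
  have ch: "continuous_on circ (h k)" for k
  proof -
    interpret circle_frame "arc_frame N \<eta> A k" by (rule frame)
    show ?thesis unfolding h_def using det_nz
      by (intro continuous_on_ln continuous_on_norm continuous_on_det cont) auto
  qed
  have piece: "(\<lambda>k. integral (circle_arc N j) (\<lambda>t. h k (cis t))) \<longlonglongrightarrow> 2 * pi / real N * ln (cmod (det (A j)))"
    if j: "j < N" for j
  proof -
    define l where "l s = ln (cmod (det (((1 - s) * \<eta>) *\<^sub>R mat 1 + s *\<^sub>R A j)))" for s :: real
    have hl: "h k (cis t) = l (bump N k j (cis t))" if "t \<in> circle_arc N j" for k t
      using arc_frame_on_arc[OF j that, of \<eta> A k] by (simp add: h_def l_def)
    have "continuous_on {0..1} l"
      unfolding l_def using nz[OF j]
      by (intro continuous_on_ln continuous_on_norm continuous_on_det continuous_intros) auto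
    hence "bounded (l ` {0..1})" by (intro compact_imp_bounded compact_continuous_image) auto
    then obtain B where B: "\<forall>v\<in>l ` {0..1}. norm v \<le> B" unfolding bounded_iff by blast
    \<comment> \<open>At the end points, a null set, the frame remains \<open>\<eta> 1\<close> for all \<open>k\<close>.\<close>
    define g where "g t = (if t \<in> {2 * pi * real j / real N, 2 * pi * real (Suc j) / real N} then l 0 else l 1)" for t
    have "(\<lambda>k. integral (circle_arc N j) (\<lambda>t. h k (cis t))) \<longlonglongrightarrow> integral (circle_arc N j) g"
    proof (rule dominated_convergence(2))
      show "(\<lambda>t. h k (cis t)) integrable_on circle_arc N j" for k
        unfolding circle_arc_def by (rule integrable_subinterval_real[OF circle_avg_integrable[OF ch] arc_subset[OF j, unfolded circle_arc_def]])
      show "(\<lambda>t. B) integrable_on circle_arc N j" unfolding circle_arc_def by (intro integrable_continuous_real continuous_on_const)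
      show "norm (h k (cis t)) \<le> B" if "t \<in> circle_arc N j" for k t
        unfolding hl[OF that] using B bump_range by blast
      show "(\<lambda>k. h k (cis t)) \<longlonglongrightarrow> g t" if t: "t \<in> circle_arc N j" for t
      proof (cases "t \<in> {2 * pi * real j / real N, 2 * pi * real (Suc j) / real N}")
        case True
        have "cis t \<in> off_arc N j" using arc_subset[OF j] t True by (intro cis_off_arc) auto
        hence "bump N k j (cis t) = 0" for k by (simp add: bump_def)
        thus ?thesis using True unfolding hl[OF t] g_def by simp
      next
        case False
        hence "t \<in> {2 * pi * real j / real N <..< 2 * pi * real (Suc j) / real N}" using t by (auto simp: circle_arc_def)
        hence pos: "0 < infdist (cis t) (off_arc N j)" by (rule arc_interior_infdist[OF j])
        then obtain K :: nat where K: "1 / infdist (cis t) (off_arc N j) < real K" using reals_Archimedean2 by blast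
        have "\<forall>\<^sub>F k in sequentially. h k (cis t) = g t"
          using eventually_ge_at_top[of K]
        proof eventually_elim
          case (elim k)
          hence "1 / infdist (cis t) (off_arc N j) \<le> real k" using K by linarith
          hence "1 \<le> real k * infdist (cis t) (off_arc N j)" using pos by (simp add: pos_divide_le_eq)
          hence "bump N k j (cis t) = 1" by (simp add: bump_def)
          thus ?case unfolding hl[OF t] g_def using False by simp
        qed
        thus ?thesis by (rule tendsto_eventually)
      qed
    qed
    moreover have "integral (circle_arc N j) g = 2 * pi / real N * ln (cmod (det (A j)))"
    proof -
      have "integral (circle_arc N j) g = integral (circle_arc N j) (\<lambda>t. l 1)"
        by (rule integral_spike[of "{2 * pi * real j / real N, 2 * pi * real (Suc j) / real N}"])
           (auto simp: g_def)
      also have "\<dots> = (2 * pi * real (Suc j) / real N - 2 * pi * real j / real N) * l 1"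
        unfolding circle_arc_def by (simp add: divide_right_mono)
      also have "2 * pi * real (Suc j) / real N - 2 * pi * real j / real N = 2 * pi / real N"
        by (simp add: diff_divide_distrib[symmetric] algebra_simps)
      finally show ?thesis by (simp add: l_def)
    qed
    ultimately show ?thesis by simp
  qed
  have "circle_avg (h k) = (1 / (2 * pi)) * (\<Sum>j<N. integral (circle_arc N j) (\<lambda>t. h k (cis t)))" for k
    unfolding circle_avg_def integral_arcs[OF circle_avg_integrable[OF ch] N] by simp
  moreover have "(\<lambda>k. (1 / (2 * pi)) * (\<Sum>j<N. integral (circle_arc N j) (\<lambda>t. h k (cis t)))) \<longlonglongrightarrow>
      (1 / (2 * pi)) * (\<Sum>j<N. 2 * pi / real N * ln (cmod (det (A j))))"
    by (intro tendsto_mult_left tendsto_sum piece) auto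
  moreover have "(1 / (2 * pi)) * (\<Sum>j<N. 2 * pi / real N * ln (cmod (det (A j)))) = (\<Sum>j<N. ln (cmod (det (A j)))) / real N"
    by (subst sum_distrib_left[symmetric]) simp
  ultimately show ?thesis unfolding h_def[abs_def] by simp
qed

theorem fits_arcs_imp_inscribed_center:
  fixes A :: "nat \<Rightarrow> complex^'n^'n"
  assumes pc: "pseudoconvex Y" and N: "0 < N"
    and disc: "\<And>z. cmod z \<le> 1 \<Longrightarrow> y + z *s d \<in> Y"
    and nz: "\<And>j. j < N \<Longrightarrow> det (A j) \<noteq> 0"
    and fitsA: "\<And>j t. j < N \<Longrightarrow> t \<in> circle_arc N j \<Longrightarrow> fits Y (y + cis t *s d) (A j)"
    and c: "c < (\<Sum>j<N. log_vol (A j)) / real N"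
  shows "\<exists>B. inscribed Y y B \<and> c < log_vol B"
proof -
  have "\<forall>j. \<exists>\<theta>. j < N \<longrightarrow> cmod \<theta> = 1 \<and> (\<forall>\<eta>>0. \<forall>s\<in>{0..1}. det (((1 - s) * \<eta>) *\<^sub>R mat 1 + s *\<^sub>R cscale \<theta> (A j)) \<noteq> 0)"
    using rotate_to_scalars[OF nz] by blast
  then obtain \<theta> where \<theta>: "\<And>j. j < N \<Longrightarrow> cmod (\<theta> j) = 1"
    "\<And>j \<eta> s. j < N \<Longrightarrow> 0 < \<eta> \<Longrightarrow> s \<in> {0..1} \<Longrightarrow> det (((1 - s) * \<eta>) *\<^sub>R mat 1 + s *\<^sub>R cscale (\<theta> j) (A j)) \<noteq> 0"
    by metis
  define A' where "A' j = cscale (\<theta> j) (A j)" for j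
  have nz': "det (A' j) \<noteq> 0" and det': "cmod (det (A' j)) = cmod (det (A j))" if "j < N" for j
    using \<theta>(1)[OF that] nz[OF that] by (auto simp: A'_def det_cscale norm_mult norm_power)
  have fits': "fits Y (y + cis t *s d) (A' j)" if "j < N" "t \<in> circle_arc N j" for j t
    unfolding A'_def by (intro fits_cscale fitsA \<theta> that)
  have "\<forall>j. \<exists>B. j < N \<longrightarrow> A' j ** B = mat 1"
    using nz' by (metis invertible_det_nz invertible_def)
  then obtain B where B: "\<And>j. j < N \<Longrightarrow> A' j ** B j = mat 1" by metis
  \<comment> \<open>The ball of radius \<open>\<eta>\<close> lies in all the ellipsoids.\<close>
  define \<eta> where "\<eta> = 1 / (1 + (\<Sum>j<N. norm (B j)))"
  have S0: "0 \<le> (\<Sum>j<N. norm (B j))" by (intro sum_nonneg) auto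
  have \<eta>0: "0 < \<eta>" using S0 by (simp add: \<eta>_def)
  have \<eta>B: "\<eta> * norm (B j) \<le> 1" if "j < N" for j
  proof -
    have "norm (B j) \<le> (\<Sum>j<N. norm (B j))" using that by (intro member_le_sum) auto
    thus ?thesis using S0 by (simp add: \<eta>_def divide_simps)
  qed
  have nonsing: "det (((1 - s) * \<eta>) *\<^sub>R mat 1 + s *\<^sub>R A' j) \<noteq> 0" if "j < N" "s \<in> {0..1}" for j s
    unfolding A'_def by (intro \<theta> that \<eta>0)
  have arcs: "\<exists>j t. z = cis t \<and> j < N \<and> t \<in> circle_arc N j" if "z \<in> circ" for z
  proof -
    have "z = cis (Arg2pi z)" using that Arg2pi_eq[of z] by (simp add: cis_conv_exp)
    moreover have "Arg2pi z \<in> {0..2*pi}" using Arg2pi_ge_0[of z] Arg2pi_lt_2pi[of z] by simp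
    ultimately show ?thesis using arc_cover[OF _ N] by metis
  qed
  have frame: "circle_frame (arc_frame N \<eta> A' k)" for k
  proof
    show "continuous_on circ (arc_frame N \<eta> A' k)"
      unfolding arc_frame_def by (intro continuous_intros)
    fix w assume "w \<in> circ"
    then obtain j t where w: "w = cis t" and j: "j < N" "t \<in> circle_arc N j" using arcs by blast
    show "det (arc_frame N \<eta> A' k w) \<noteq> 0"
      unfolding w arc_frame_on_arc[OF j] by (rule nonsing[OF j(1) bump_range])
  qed
  have ffits: "fits Y (y + z *s d) (arc_frame N \<eta> A' k z)" if z: "z \<in> circ" for z k
  proof -
    obtain j t where zt: "z = cis t" and j: "j < N" "t \<in> circle_arc N j" using arcs[OF z] by blast
    show ?thesis
      unfolding zt arc_frame_on_arc[OF j]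
      by (rule fits_towards_scalar[OF fits'[OF j] B[OF j(1)] less_imp_le[OF \<eta>0] \<eta>B[OF j(1)] bump_range])
  qed
  have "(\<lambda>k. 2 * circle_avg (\<lambda>w. ln (cmod (det (arc_frame N \<eta> A' k w)))) + ln (unit_vol TYPE('n))) \<longlonglongrightarrow>
      2 * ((\<Sum>j<N. ln (cmod (det (A' j)))) / real N) + ln (unit_vol TYPE('n))"
    by (intro tendsto_intros arc_frame_log_det_limit N nonsing frame)
  moreover have "2 * ((\<Sum>j<N. ln (cmod (det (A' j)))) / real N) + ln (unit_vol TYPE('n)) = (\<Sum>j<N. log_vol (A j)) / real N"
  proof -
    have "(\<Sum>j<N. log_vol (A j)) = (\<Sum>j<N. 2 * ln (cmod (det (A' j))) + ln (unit_vol TYPE('n)))"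
      by (intro sum.cong refl) (simp add: log_vol_eq nz det')
    thus ?thesis using N by (simp add: sum.distrib sum_distrib_left[symmetric] add_divide_distrib)
  qed
  ultimately have "\<forall>\<^sub>F k in sequentially. c < 2 * circle_avg (\<lambda>w. ln (cmod (det (arc_frame N \<eta> A' k w)))) + ln (unit_vol TYPE('n))"
    using c by (intro order_tendstoD(1)) auto
  then obtain k where "c < 2 * circle_avg (\<lambda>w. ln (cmod (det (arc_frame N \<eta> A' k w)))) + ln (unit_vol TYPE('n))"
    unfolding eventually_sequentially by blast
  from fits_at_center[OF pc frame disc ffits this] show ?thesis .
qed

section \<open>From circle means to ellipsoids over arcs\<close>

lemma near_supremum:
  fixes f :: "'a \<Rightarrow> real"
  assumes "S \<noteq> {}" "0 < e"
  shows "\<exists>x\<in>S. \<forall>y\<in>S. min (f y) m - e \<le> f x"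
proof -
  let ?I = "(\<lambda>y. min (f y) m) ` S"
  have bdd: "bdd_above ?I" by (rule bdd_aboveI2[where M = m]) simp
  have "Sup ?I - e < Sup ?I" using assms(2) by simp
  hence "\<exists>v\<in>?I. Sup ?I - e < v" using assms(1) by (intro less_cSupD) auto
  then obtain x where x: "x \<in> S" "Sup ?I - e < min (f x) m" by blast
  have "min (f y) m - e \<le> f x" if "y \<in> S" for y
  proof -
    have "min (f y) m \<le> Sup ?I" using bdd that by (intro cSup_upper) auto
    thus ?thesis using x(2) by linarith
  qed
  thus ?thesis using x(1) by blast
qed

lemma continuous_circle_path: "continuous_on S (\<lambda>t. y + cis t *s d)"
  unfolding vector_scalar_mult_def by (intro continuous_intros)

lemma borel_measurable_log_max_vol_path: "(\<lambda>t. log_max_vol Y (y + cis t *s d)) \<in> borel_measurable borel"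
  unfolding borel_measurable_ereal_iff_Ioi
proof
  fix a
  have "open ((\<lambda>t. y + cis t *s d) -` {x. a < log_max_vol Y x})"
    by (rule open_vimage[OF open_less_log_max_vol continuous_circle_path])
  moreover have "(\<lambda>t. log_max_vol Y (y + cis t *s d)) -` {a<..} \<inter> space borel = (\<lambda>t. y + cis t *s d) -` {x. a < log_max_vol Y x}" by auto
  ultimately show "(\<lambda>t. log_max_vol Y (y + cis t *s d)) -` {a<..} \<inter> space borel \<in> sets borel" by simp
qed

text \<open>
  Adding the constant \<open>B\<close> makes \<open>W\<close> nonnegative, so that its mean, originally a difference of two
  integrals in \<open>[0, \<infinity>]\<close>, becomes one integral. Only the integral of the negative part of \<open>W\<close> is known
  to be finite.
\<close>

lemma nn_integral_above_from_mean:
  fixes W :: "real \<Rightarrow> ereal"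
  assumes meas: "W \<in> borel_measurable borel" and low: "\<And>t. ereal (- B) \<le> W t" and B: "0 \<le> B" "m \<le> B"
    and mean: "(enn2ereal (\<integral>\<^sup>+t\<in>{0..2*pi}. e2ennreal (- W t) \<partial>lborel)
      - enn2ereal (\<integral>\<^sup>+t\<in>{0..2*pi}. e2ennreal (W t) \<partial>lborel)) / ereal (2 * pi) < ereal m"
  shows "ennreal (2 * pi * (B - m)) < (\<integral>\<^sup>+t\<in>{0..2*pi}. e2ennreal (W t + ereal B) \<partial>lborel)"
proof -
  define P where "P = (\<integral>\<^sup>+t\<in>{0..2*pi}. e2ennreal (- W t) \<partial>lborel)"
  define Q where "Q = (\<integral>\<^sup>+t\<in>{0..2*pi}. e2ennreal (W t) \<partial>lborel)"
  define V where "V = (\<integral>\<^sup>+t\<in>{0..2*pi}. e2ennreal (W t + ereal B) \<partial>lborel)"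
  have mW [measurable]: "W \<in> borel_measurable borel" by (rule meas)
  have len: "(\<integral>\<^sup>+t\<in>{0..2*pi}. ennreal B \<partial>lborel) = ennreal (2 * pi * B)"
    using B by (simp add: nn_integral_cmult_indicator ennreal_mult'[symmetric] mult.commute)
  have pt: "e2ennreal (W t + ereal B) + e2ennreal (- W t) = e2ennreal (W t) + ennreal B" for t
  proof (cases "W t")
    case (real r)
    hence r: "- B \<le> r" using low[of t] by simp
    show ?thesis
    proof (cases "0 \<le> r")
      case True thus ?thesis using real B by (simp add: ennreal_plus ennreal_neg)
    next
      case False
      hence "ennreal (r + B) + ennreal (- r) = ennreal (r + B + (- r))" using r by (intro ennreal_plus[symmetric]) auto
      thus ?thesis using real False by (simp add: ennreal_neg)
    qed
  next
    case PInf
    thus ?thesis by (simp add: e2ennreal_neg)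
  next
    case MInf
    thus ?thesis using low[of t] by simp
  qed
  have "V + P = (\<integral>\<^sup>+t. (e2ennreal (W t + ereal B) + e2ennreal (- W t)) * indicator {0..2*pi} t \<partial>lborel)"
    unfolding V_def P_def by (subst nn_integral_add[symmetric]) (auto simp: distrib_right)
  also have "\<dots> = Q + ennreal (2 * pi * B)"
    unfolding pt len[symmetric] Q_def by (subst nn_integral_add[symmetric]) (auto simp: distrib_right)
  finally have sum: "V + P = Q + ennreal (2 * pi * B)" .
  have "P \<le> ennreal (2 * pi * B)"
    unfolding P_def len[symmetric]
  proof (intro nn_integral_mono mult_right_mono)
    fix t
    have "- W t \<le> ereal B" using low[of t] by (metis ereal_minus_le_minus ereal_uminus_uminus uminus_ereal.simps(1))
    hence "e2ennreal (- W t) \<le> e2ennreal (ereal B)" by (rule e2ennreal_mono)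
    thus "e2ennreal (- W t) \<le> ennreal B" by simp
  qed auto
  then obtain p where p: "P = ennreal p" "0 \<le> p" by (cases P rule: ennreal_cases) (auto simp: top_unique)
  have "ennreal (2 * pi * (B - m)) < V"
  proof (cases Q rule: ennreal_cases)
    case (real q)
    have "(ereal p - ereal q) / ereal (2 * pi) < ereal m"
      using mean unfolding P_def[symmetric] Q_def[symmetric] p(1) real(2) using p(2) real(1) by (simp add: enn2ereal_ennreal)
    hence "(p - q) / (2 * pi) < m" by simp
    hence pq: "p - q < 2 * pi * m" by (simp add: pos_divide_less_eq mult.commute)
    have "V + P < top" unfolding sum real(2) by simp
    then obtain v where v: "V = ennreal v" "0 \<le> v" by (cases V rule: ennreal_cases) auto
    have "ennreal (v + p) = ennreal (q + 2 * pi * B)"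
      using sum v p real B by (simp add: ennreal_plus)
    moreover have "0 \<le> v + p" "0 \<le> q + 2 * pi * B" using v p real B by auto
    ultimately have "v + p = q + 2 * pi * B" using ennreal_inj by blast
    hence "2 * pi * (B - m) < v" using pq by (simp add: right_diff_distrib)
    thus ?thesis using v B by (simp add: ennreal_less_iff)
  next
    case top
    hence "V = top" using sum p by (simp add: ennreal_add_eq_top)
    thus ?thesis by simp
  qed
  thus ?thesis unfolding V_def .
qed

lemma cancel_two_pi:
  assumes "2 * pi * a < 2 * pi / n * s"
  shows "a < s / n"
proof -
  have two_pi: "0 < 2 * pi" by simp
  have "2 * pi / n * s = 2 * pi * (s / n)" by simp
  with assms have "2 * pi * a < 2 * pi * (s / n)" by (simp only:)
  thus ?thesis by (simp only: mult_less_cancel_left_pos[OF two_pi])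
qed

text \<open>
  On each of \<open>n\<close> equal arcs a nearly largest ellipsoid is chosen among those that fit along the whole
  arc. An ellipsoid fitting strictly at one point fits along every short arc through that point, so
  in the limit the step functions of logarithmic volumes dominate \<open>log w\<close> pointwise,
  and Fatou's lemma applies. The volumes are cut off at \<open>n\<close> as they may be unbounded.
\<close>

theorem arcs_from_mean:
  fixes Y :: "(complex^'n) set"
  assumes Y: "open Y" and circle: "\<And>z. z \<in> circ \<Longrightarrow> y + z *s d \<in> Y"
    and mean: "(enn2ereal (\<integral>\<^sup>+t\<in>{0..2*pi}. e2ennreal (- log_max_vol Y (y + cis t *s d)) \<partial>lborel)
      - enn2ereal (\<integral>\<^sup>+t\<in>{0..2*pi}. e2ennreal (log_max_vol Y (y + cis t *s d)) \<partial>lborel)) / ereal (2 * pi) < ereal m"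
  shows "\<exists>N>0. \<exists>A. (\<forall>j<N. det (A j) \<noteq> 0 \<and> (\<forall>t\<in>circle_arc N j. fits Y (y + cis t *s d) (A j)))
    \<and> - m < (\<Sum>j<N. log_vol (A j)) / real N"
proof -
  define x where "x t = y + cis t *s d" for t
  define W where "W t = log_max_vol Y (x t)" for t
  have cx: "continuous_on S x" for S unfolding x_def by (rule continuous_circle_path)
  define K' where "K' = (\<lambda>z. y + z *s d) ` circ"
  have K': "compact K'" "K' \<subseteq> Y"
    unfolding K'_def vector_scalar_mult_def using circle[unfolded vector_scalar_mult_def]
    by (auto intro!: compact_continuous_image continuous_intros)
  obtain s where s: "0 < s" "(\<Union>v\<in>K'. cball v s) \<subseteq> Y"
    using compact_subset_open_imp_cball_epsilon_subset[OF K'(1) Y K'(2)] by blast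
  define A0 :: "complex^'n^'n" where "A0 = s *\<^sub>R mat 1"
  have A0: "det A0 \<noteq> 0" using s by (simp add: A0_def det_scaleR)
  have fits0: "fits Y (x t) A0" for t
    unfolding fits_def
  proof (intro allI impI)
    fix u :: "complex^'n" assume "norm u \<le> 1"
    hence "s * norm u \<le> s * 1" using s(1) by (intro mult_left_mono) auto
    hence "x t + A0 *v u \<in> cball (x t) s" using s(1) by (simp add: A0_def scaleR_mv dist_norm)
    moreover have "x t \<in> K'" unfolding x_def K'_def by (intro imageI cis_circ)
    ultimately show "x t + A0 *v u \<in> Y" using s(2) by blast
  qed
  \<comment> \<open>The summand 1 absorbs the error of the near-supremum, and \<open>m \<le> B\<close> keeps \<open>B - m\<close> nonnegative.\<close>
  define B where "B = \<bar>log_vol A0\<bar> + 1 + \<bar>m\<bar>"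
  have B: "0 \<le> B" "m \<le> B" by (auto simp: B_def)
  have low: "ereal (- B) \<le> W t" for t
  proof -
    have "ereal (- B) \<le> ereal (log_vol A0)" by (simp add: B_def)
    also have "\<dots> \<le> W t" unfolding W_def by (intro log_vol_le_log_max_vol fits_imp_inscribed fits0 A0)
    finally show ?thesis .
  qed
  define S where "S n j = {A. det A \<noteq> 0 \<and> (\<forall>t\<in>circle_arc (Suc n) j. fits Y (x t) A)}" for n j
  have A0S: "A0 \<in> S n j" for n j using A0 fits0 by (simp add: S_def)
  have "\<forall>n j. \<exists>A\<in>S n j. \<forall>A'\<in>S n j. min (log_vol A') (real (Suc n)) - inverse (real (Suc n)) \<le> log_vol A"
  proof (intro allI near_supremum)
    fix n j show "S n j \<noteq> {}" using A0S by blast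
  qed simp
  then obtain A where A: "\<And>n j. A n j \<in> S n j"
    "\<And>n j A'. A' \<in> S n j \<Longrightarrow> min (log_vol A') (real (Suc n)) - inverse (real (Suc n)) \<le> log_vol (A n j)"
    by metis
  have nonneg: "0 \<le> log_vol (A n j) + B" for n j
  proof -
    have "inverse (real (Suc n)) \<le> 1" by (simp add: divide_simps)
    moreover have "min (log_vol A0) (real (Suc n)) - inverse (real (Suc n)) \<le> log_vol (A n j)"
      by (rule A(2)[OF A0S])
    ultimately show ?thesis by (simp add: B_def min_def split: if_splits)
  qed
  define F where "F n t = (\<Sum>j<Suc n. ennreal (log_vol (A n j) + B) * indicator (circle_arc (Suc n) j) t)" for n t
  have mF: "F n \<in> borel_measurable lborel" for n
    unfolding F_def circle_arc_def by measurable
  have intF: "(\<integral>\<^sup>+t. F n t \<partial>lborel) = ennreal (2 * pi / real (Suc n) * (\<Sum>j<Suc n. log_vol (A n j) + B))" for n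
  proof -
    have len: "emeasure lborel (circle_arc (Suc n) j) = ennreal (2 * pi / real (Suc n))" for j
    proof -
      have "2 * pi * real (Suc j) / real (Suc n) - 2 * pi * real j / real (Suc n) = 2 * pi / real (Suc n)"
        by (simp add: diff_divide_distrib[symmetric] algebra_simps del: of_nat_Suc) (simp add: algebra_simps)?
      thus ?thesis unfolding circle_arc_def by (subst emeasure_lborel_Icc) (auto simp: divide_right_mono)
    qed
    have "(\<integral>\<^sup>+t. F n t \<partial>lborel) = (\<Sum>j<Suc n. \<integral>\<^sup>+t. ennreal (log_vol (A n j) + B) * indicator (circle_arc (Suc n) j) t \<partial>lborel)"
      unfolding F_def by (rule nn_integral_sum) (auto simp: circle_arc_def)
    also have "\<dots> = (\<Sum>j<Suc n. ennreal ((log_vol (A n j) + B) * (2 * pi / real (Suc n))))"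
    proof (intro sum.cong refl)
      fix j
      have "(\<integral>\<^sup>+t. ennreal (log_vol (A n j) + B) * indicator (circle_arc (Suc n) j) t \<partial>lborel) = ennreal (log_vol (A n j) + B) * emeasure lborel (circle_arc (Suc n) j)"
        by (rule nn_integral_cmult_indicator) (simp add: circle_arc_def)
      also have "\<dots> = ennreal ((log_vol (A n j) + B) * (2 * pi / real (Suc n)))"
        unfolding len using nonneg by (intro ennreal_mult[symmetric]) auto
      finally show "(\<integral>\<^sup>+t. ennreal (log_vol (A n j) + B) * indicator (circle_arc (Suc n) j) t \<partial>lborel) = ennreal ((log_vol (A n j) + B) * (2 * pi / real (Suc n)))" .
    qed
    also have "\<dots> = ennreal (\<Sum>j<Suc n. (log_vol (A n j) + B) * (2 * pi / real (Suc n)))"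
      using nonneg by (intro sum_ennreal) auto
    also have "(\<Sum>j<Suc n. (log_vol (A n j) + B) * (2 * pi / real (Suc n))) = 2 * pi / real (Suc n) * (\<Sum>j<Suc n. log_vol (A n j) + B)"
      by (simp only: sum_distrib_right[symmetric] mult.commute)
    finally show ?thesis .
  qed
  have liminf: "e2ennreal (W t + ereal B) * indicator {0..2*pi} t \<le> liminf (\<lambda>n. F n t)" for t
  proof (cases "t \<in> {0..2*pi}")
    case True
    have "e2ennreal (W t + ereal B) \<le> liminf (\<lambda>n. F n t)"
      unfolding le_Liminf_iff
    proof (intro allI impI)
      fix v assume v: "v < e2ennreal (W t + ereal B)"
      then obtain c where c: "v = ennreal c" "0 \<le> c" by (cases v rule: ennreal_cases) auto
      have "ereal c < W t + ereal B"
      proof (rule ccontr)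
        assume "\<not> ereal c < W t + ereal B"
        hence "e2ennreal (W t + ereal B) \<le> e2ennreal (ereal c)" by (intro e2ennreal_mono) simp
        thus False using v c(1) by simp
      qed
      hence "ereal (c - B) < W t" by (cases "W t") auto
      then obtain A1 where "inscribed Y (x t) A1" "c - B < log_vol A1" using less_log_max_vol unfolding W_def by blast
      from inscribed_robust[OF this] obtain A' \<rho> where A': "0 < \<rho>" "det A' \<noteq> 0" "c - B < log_vol A'"
        "\<And>y'. dist y' (x t) < \<rho> \<Longrightarrow> fits Y y' A'" by blast
      have "isCont x t" using cx[of UNIV] by (simp add: continuous_on_eq_continuous_at)
      then obtain \<delta> where \<delta>: "0 < \<delta>" "\<And>t'. dist t' t < \<delta> \<Longrightarrow> dist (x t') (x t) < \<rho>"
        using A'(1) unfolding continuous_at_eps_delta by blast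
      have "(\<lambda>n. log_vol A' - inverse (real (Suc n))) \<longlonglongrightarrow> log_vol A' - 0"
        by (intro tendsto_intros LIMSEQ_inverse_real_of_nat)
      hence e1: "\<forall>\<^sub>F n in sequentially. c - B < log_vol A' - inverse (real (Suc n))"
        using A'(3) by (intro order_tendstoD(1)) auto
      have "(\<lambda>n. 2 * pi * inverse (real (Suc n))) \<longlonglongrightarrow> 2 * pi * 0"
        by (intro tendsto_intros LIMSEQ_inverse_real_of_nat)
      hence e2: "\<forall>\<^sub>F n in sequentially. 2 * pi * inverse (real (Suc n)) < \<delta>"
        using \<delta>(1) by (intro order_tendstoD(2)) auto
      have e3: "\<forall>\<^sub>F n in sequentially. log_vol A' \<le> real (Suc n)"
      proof -
        obtain n0 :: nat where "log_vol A' < real n0" using reals_Archimedean2 by blast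
        thus ?thesis unfolding eventually_sequentially by (intro exI[of _ n0]) auto
      qed
      from e1 e2 e3 show "\<forall>\<^sub>F n in sequentially. v < F n t"
      proof eventually_elim
        case (elim n)
        obtain j where j: "j < Suc n" "t \<in> circle_arc (Suc n) j" using arc_cover[OF True, of "Suc n"] by auto
        have "A' \<in> S n j"
          unfolding S_def
        proof (intro CollectI conjI ballI A')
          fix t' assume t': "t' \<in> circle_arc (Suc n) j"
          have "\<bar>t' - t\<bar> \<le> 2 * pi * real (Suc j) / real (Suc n) - 2 * pi * real j / real (Suc n)"
            using t' j(2) unfolding circle_arc_def abs_le_iff atLeastAtMost_iff by linarith
          also have "\<dots> = 2 * pi * inverse (real (Suc n))"
            by (simp add: diff_divide_distrib[symmetric] divide_inverse algebra_simps del: of_nat_Suc) (simp add: algebra_simps)?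
          finally show "dist (x t') (x t) < \<rho>" using elim(2) by (intro \<delta>(2)) (simp add: dist_real_def)
        qed
        from A(2)[OF this] have "c - B < log_vol (A n j)" using elim by simp
        hence "ennreal c < ennreal (log_vol (A n j) + B)" using c(2) by (simp add: ennreal_less_iff)
        also have "\<dots> = ennreal (log_vol (A n j) + B) * indicator (circle_arc (Suc n) j) t" using j by simp
        also have "\<dots> \<le> F n t"
          unfolding F_def using j by (intro member_le_sum) auto
        finally show ?case using c by simp
      qed
    qed
    thus ?thesis using True by simp
  qed simp
  have "ennreal (2 * pi * (B - m)) < (\<integral>\<^sup>+t\<in>{0..2*pi}. e2ennreal (W t + ereal B) \<partial>lborel)"
  proof (rule nn_integral_above_from_mean[OF _ low B])
    show "W \<in> borel_measurable borel" unfolding W_def[abs_def] x_def by (rule borel_measurable_log_max_vol_path)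
  qed (use mean in \<open>simp add: W_def x_def\<close>)
  also have "\<dots> \<le> (\<integral>\<^sup>+t. liminf (\<lambda>n. F n t) \<partial>lborel)" by (intro nn_integral_mono liminf)
  also have "\<dots> \<le> liminf (\<lambda>n. \<integral>\<^sup>+t. F n t \<partial>lborel)" by (rule nn_integral_liminf[OF mF])
  finally have "\<forall>\<^sub>F n in sequentially. ennreal (2 * pi * (B - m)) < (\<integral>\<^sup>+t. F n t \<partial>lborel)"
    by (rule less_LiminfD)
  then obtain n where "ennreal (2 * pi * (B - m)) < (\<integral>\<^sup>+t. F n t \<partial>lborel)"
    unfolding eventually_sequentially by blast
  hence "2 * pi * (B - m) < 2 * pi / real (Suc n) * (\<Sum>j<Suc n. log_vol (A n j) + B)"
    unfolding intF using B by (simp add: ennreal_less_iff del: of_nat_Suc sum.lessThan_Suc)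
  hence "B - m < (\<Sum>j<Suc n. log_vol (A n j) + B) / real (Suc n)" by (rule cancel_two_pi)
  also have "\<dots> = (\<Sum>j<Suc n. log_vol (A n j)) / real (Suc n) + B"
    by (simp add: sum.distrib add_divide_distrib del: of_nat_Suc sum.lessThan_Suc)
  finally have "- m < (\<Sum>j<Suc n. log_vol (A n j)) / real (Suc n)" by linarith
  thus ?thesis
    using A(1) unfolding S_def x_def by (intro exI[of _ "Suc n"] conjI exI[of _ "A n"]) auto
qed

text \<open>
  It remains to combine the two halves of the mean value inequality and to read semicontinuity off
  the openness of the superlevel sets of \<open>log w\<close>.
\<close>

theorem corollary1p3:
  fixes Y :: "(complex^'n) set"
  assumes "open Y" and "pseudoconvex Y"
  shows "plurisubharmonic_on Y (\<lambda>y. - ln_ennreal (max_ellipsoid_vol Y y))"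
proof -
  have op: "open {y. - log_max_vol Y y < c}" for c
    using open_less_log_max_vol[of "- c" Y] by (simp add: ereal_minus_less_minus[of "- c", simplified, symmetric] ereal_uminus_less_reorder)
  have fin: "- log_max_vol Y y < \<infinity>" if "y \<in> Y" for y
    using log_max_vol_gt_minf[OF assms(1) that] by (cases "log_max_vol Y y") auto
  have "plurisubharmonic_on Y (\<lambda>y. - log_max_vol Y y)"
    unfolding plurisubharmonic_on_def
  proof (intro conjI ballI allI)
    show "usc_on Y (\<lambda>y. - log_max_vol Y y)"
      unfolding usc_on_def
    proof
      fix c
      have eq: "{y \<in> Y. - log_max_vol Y y < c} = Y \<inter> {y. - log_max_vol Y y < c}" by auto
      show "openin (top_of_set Y) {y \<in> Y. - log_max_vol Y y < c}"
        unfolding eq by (rule openin_open_Int[OF op])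
    qed
    show "- log_max_vol Y y < \<infinity>" if "y \<in> Y" for y by (rule fin[OF that])
    fix a b :: "complex^'n"
    let ?S = "{z. a + z *s b \<in> Y}"
    have cl: "continuous_on UNIV (\<lambda>z. a + z *s b)"
      unfolding vector_scalar_mult_def by (intro continuous_intros)
    show "subharmonic_on ?S (\<lambda>z. - log_max_vol Y (a + z *s b))"
      unfolding subharmonic_on_def
    proof (intro conjI ballI allI impI)
      show "usc_on ?S (\<lambda>z. - log_max_vol Y (a + z *s b))"
        unfolding usc_on_def
      proof
        fix c
        have eq: "{z \<in> ?S. - log_max_vol Y (a + z *s b) < c} = ?S \<inter> (\<lambda>z. a + z *s b) -` {y. - log_max_vol Y y < c}" by auto
        show "openin (top_of_set ?S) {z \<in> ?S. - log_max_vol Y (a + z *s b) < c}"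
          unfolding eq by (rule openin_open_Int[OF open_vimage[OF op cl]])
      qed
      show "- log_max_vol Y (a + z *s b) < \<infinity>" if "z \<in> ?S" for z using that by (intro fin) simp
      fix z0 :: complex and r :: real
      assume r: "0 < r" and sub: "cball z0 r \<subseteq> ?S"
      define y where "y = a + z0 *s b"
      define d where "d = of_real r *s b"
      have pt: "a + (z0 + rcis r t) *s b = y + cis t *s d" for t
        by (simp add: y_def d_def rcis_def vec_eq_iff algebra_simps)
      have disc: "y + z *s d \<in> Y" if "cmod z \<le> 1" for z
      proof -
        have "z0 + of_real r * z \<in> cball z0 r"
        proof -
          have "r * cmod z \<le> r * 1" using that r by (intro mult_left_mono) auto
          thus ?thesis using r by (simp add: dist_norm norm_mult)
        qed
        hence "a + (z0 + of_real r * z) *s b \<in> Y" using sub by blast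
        moreover have "a + (z0 + of_real r * z) *s b = y + z *s d"
          by (simp add: y_def d_def vec_eq_iff algebra_simps)
        ultimately show ?thesis by simp
      qed
      have "- log_max_vol Y y \<le> circle_mean (\<lambda>z. - log_max_vol Y (a + z *s b)) z0 r"
      proof (rule ccontr)
        assume "\<not> - log_max_vol Y y \<le> circle_mean (\<lambda>z. - log_max_vol Y (a + z *s b)) z0 r"
        hence "circle_mean (\<lambda>z. - log_max_vol Y (a + z *s b)) z0 r < - log_max_vol Y y" by simp
        then obtain m where m: "circle_mean (\<lambda>z. - log_max_vol Y (a + z *s b)) z0 r < ereal m" "ereal m < - log_max_vol Y y"
          using ereal_dense2 by blast
        have mean: "(enn2ereal (\<integral>\<^sup>+t\<in>{0..2*pi}. e2ennreal (- log_max_vol Y (y + cis t *s d)) \<partial>lborel)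
            - enn2ereal (\<integral>\<^sup>+t\<in>{0..2*pi}. e2ennreal (log_max_vol Y (y + cis t *s d)) \<partial>lborel)) / ereal (2 * pi) < ereal m"
          using m(1) by (simp only: circle_mean_def pt ereal_uminus_uminus)
        have "\<exists>N>0. \<exists>A. (\<forall>j<N. det (A j) \<noteq> 0 \<and> (\<forall>t\<in>circle_arc N j. fits Y (y + cis t *s d) (A j)))
            \<and> - m < (\<Sum>j<N. log_vol (A j)) / real N"
          by (rule arcs_from_mean[OF assms(1) _ mean]) (use disc in simp)
        then obtain N A where NA: "0 < N" "\<And>j. j < N \<Longrightarrow> det (A j) \<noteq> 0"
          "\<And>j t. j < N \<Longrightarrow> t \<in> circle_arc N j \<Longrightarrow> fits Y (y + cis t *s d) (A j)" "- m < (\<Sum>j<N. log_vol (A j)) / real N"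
          by blast
        from fits_arcs_imp_inscribed_center[OF assms(2) NA(1) disc NA(2,3,4)]
        obtain B where B: "inscribed Y y B" "- m < log_vol B" by blast
        have "ereal (- m) < ereal (log_vol B)" using B(2) by simp
        also have "\<dots> \<le> log_max_vol Y y" by (rule log_vol_le_log_max_vol[OF B(1)])
        finally show False using m(2) by (cases "log_max_vol Y y") auto
      qed
      thus "- log_max_vol Y (a + z0 *s b) \<le> circle_mean (\<lambda>z. - log_max_vol Y (a + z *s b)) z0 r" by (simp add: y_def)
    qed
  qed
  thus ?thesis by (simp add: log_max_vol_def)
qed

end
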